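(* Let $\{f_{n,k}\in\mathbb{C}: 0\le k\le n,\ n\in\{0,1,\dots\}\}$ be coefficients satisfying the following two conditions. (i) There is a continuous function $V:\mathbb{C}\to\mathbb{R}$ such that $$\lim_{n\to\infty}\frac1n\log\left(\sum_{k=0}^n|f_{n,k}||z|^k\right)=V(z)\quad\text{for every } z\in\mathbb{C},$$ with the convergence locally uniform in $z$; moreover $V$ is subharmonic and $V(z)-\log|z|$ is bounded as $z\to\infty$. (ii) There is a set $\mathcal{D}\subset\mathbb{C}$ whose complement has Lebesgue measure zero such that for every $z\in\mathcal{D}$ and every $\epsilon>0$ there exist $n_0(\epsilon,z)\in\mathbb{N}$ and $\delta(\epsilon,z)>0$ such that for all $n\ge n_0(\epsilon,z)$, $$\left|\left\{k\in\{0,\dots,n\}: |f_{n,k}||z|^k\ge e^{n(V(z)-\epsilon)}\right\}\right|\ge n^{2/3+\delta(\epsilon,z)}.$$ Let $\xi_0,\xi_1,\dots$ be i.i.d. non-degenerate complex-valued random variables with $\mathbb{E}\log(1+|\xi_0|)<\infty$, and let $G_n(z)=\sum_{k=0}^n\xi_kf_{n,k}z^k$. Then almost surely $$Z_{G_n}\to\frac{1}{2\pi}\Delta V\qquad\text{in the weak* topology as } n\to\infty.$$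
   Context: A random variable is non-degenerate if its law is supported on at least two points. $\Delta V$ is the distributional Laplacian; under condition (i), $\frac1{2\pi}\Delta V$ is a probability measure. $Z_{G_n}=\frac{1}{2\pi}\Delta\left(\frac1n\log|G_n|\right)=\frac1n\sum_j\delta_{z_j}$, the sum being over the zeros of $G_n$ counted with multiplicity (set to be the zero measure when $G_n\equiv0$). It is a positive measure of total mass at most $1$; the weak* topology is that of testing against bounded continuous functions on $\mathbb{C}$. *)

theory Defs
  imports "HOL-Probability.Probability" "HOL-Computational_Algebra.Polynomial"
begin

definition dx :: "(complex \<Rightarrow> real) \<Rightarrow> complex \<Rightarrow> real" where
  "dx \<phi> z = deriv (\<lambda>t. \<phi> (Complex t (Im z))) (Re z)"

definition dy :: "(complex \<Rightarrow> real) \<Rightarrow> complex \<Rightarrow> real" where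
  "dy \<phi> z = deriv (\<lambda>t. \<phi> (Complex (Re z) t)) (Im z)"

definition laplacian :: "(complex \<Rightarrow> real) \<Rightarrow> complex \<Rightarrow> real" where
  "laplacian \<phi> z = dx (dx \<phi>) z + dy (dy \<phi>) z"

(* If all the iterates below are Frechet differentiable, then mixed derivatives commute
   (Schwarz-Young), so these are all the iterated partial derivatives and phi is C^infinity. *)
definition smooth :: "(complex \<Rightarrow> real) \<Rightarrow> bool" where
  "smooth \<phi> \<longleftrightarrow> (\<forall>i j. ((dx ^^ i) ((dy ^^ j) \<phi>)) differentiable_on UNIV)"

definition test_function :: "(complex \<Rightarrow> real) \<Rightarrow> bool" where
  "test_function \<phi> \<longleftrightarrow> smooth \<phi> \<and> compact (closure {z. \<phi> z \<noteq> 0})"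

(* (1/(2 pi)) Delta V = mu in the sense of distributions, for a locally finite Borel measure mu.
   Such a mu is unique. V is meant to be locally integrable (it is continuous where this is used),
   so that the right-hand integrals exist. *)
definition is_normalized_laplacian :: "(complex \<Rightarrow> real) \<Rightarrow> complex measure \<Rightarrow> bool" where
  "is_normalized_laplacian V \<mu> \<longleftrightarrow>
     sets \<mu> = sets borel \<and> (\<forall>K. compact K \<longrightarrow> emeasure \<mu> K < \<infinity>) \<and>
     (\<forall>\<phi>. test_function \<phi> \<longrightarrow>
        (LINT z|\<mu>. \<phi> z) = 1 / (2 * pi) * (LINT z|lborel. V z * laplacian \<phi> z))"

(* Restricted to continuous real-valued functions, so that the circle means always exist. *)
definition continuous_subharmonic :: "(complex \<Rightarrow> real) \<Rightarrow> bool" where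
  "continuous_subharmonic V \<longleftrightarrow> continuous_on UNIV V \<and>
     (\<forall>z r. r > 0 \<longrightarrow>
        V z \<le> 1 / (2 * pi) * integral {0..2 * pi} (\<lambda>t. V (z + of_real r * cis t)))"

definition measure_support :: "'a::topological_space measure \<Rightarrow> 'a set" where
  "measure_support \<mu> = {x. \<forall>U. open U \<longrightarrow> x \<in> U \<longrightarrow> emeasure \<mu> U > 0}"

definition non_degenerate :: "'w measure \<Rightarrow> ('w \<Rightarrow> complex) \<Rightarrow> bool" where
  "non_degenerate M X \<longleftrightarrow>
     (\<exists>a b. a \<noteq> b \<and> a \<in> measure_support (distr M borel X) \<and> b \<in> measure_support (distr M borel X))"

definition random_poly :: "(nat \<Rightarrow> nat \<Rightarrow> complex) \<Rightarrow> (nat \<Rightarrow> complex) \<Rightarrow> nat \<Rightarrow> complex poly" where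
  "random_poly f x n = (\<Sum>k\<le>n. monom (x k * f n k) k)"

(* (1/n) times the sum of the point masses at the zeros of p, with multiplicity: the measure on the
   zero set with weight (order z p) / n at z, pushed forward to a Borel measure on the plane. *)
definition zero_measure :: "nat \<Rightarrow> complex poly \<Rightarrow> complex measure" where
  "zero_measure n p = (if p = 0 then null_measure borel else
     distr (density (count_space {z. poly p z = 0}) (\<lambda>z. ennreal (real (order z p) / real n)))
       borel (\<lambda>z. z))"

(* Intended for finite measures, for which the integrals of bounded continuous functions exist. *)
definition weak_star_conv :: "(nat \<Rightarrow> complex measure) \<Rightarrow> complex measure \<Rightarrow> bool" where
  "weak_star_conv \<nu> \<mu> \<longleftrightarrow>
     (\<forall>\<phi>::complex \<Rightarrow> real. continuous_on UNIV \<phi> \<longrightarrow> bounded (range \<phi>) \<longrightarrow>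
        (\<lambda>n. LINT z|\<nu> n. \<phi> z) \<longlonglongrightarrow> (LINT z|\<mu>. \<phi> z))"

end

theory Submission
  imports Defs "HOL-Complex_Analysis.Conformal_Mappings" "HOL-Real_Asymp.Real_Asymp"
    "HOL-Computational_Algebra.Fundamental_Theorem_Algebra"
begin

text \<open>Write \<open>u\<^sub>n = (1/n) log \<bar>G\<^sub>n\<bar>\<close>. The logarithmic moment gives \<open>\<bar>\<xi>\<^sub>k\<bar> \<le> C e\<^bsup>\<epsilon>k\<^esup>\<close> almost surely,
  hence \<open>u\<^sub>n \<le> V + \<epsilon>\<close> locally uniformly. For a lower bound near a point \<open>z\<close> of \<open>D\<close>, suppose that
  \<open>\<bar>G\<^sub>n\<bar> \<le> e\<^bsup>n(V(z)-\<epsilon>)\<^esup>\<close> at all the points \<open>z (1 + 1/n)\<^sup>j\<close>, \<open>j < \<surd>n\<close>. Choose \<open>\<surd>n\<close> indices \<open>k\<close> with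
  \<open>\<bar>f\<^sub>n\<^sub>,\<^sub>k\<bar>\<bar>z\<bar>\<^sup>k \<ge> e\<^bsup>n(V(z)-\<epsilon>/2)\<^esup>\<close>. Lagrange interpolation shows that each of these \<open>\<xi>\<^sub>k\<close> is within \<open>\<rho>\<close> of a quantity
  determined by the coefficients with the other indices, which has probability at most \<open>Q\<^bsup>\<surd>n\<^esup>\<close> with \<open>Q < 1\<close>.
  By Borel-Cantelli, almost surely every point \<open>z\<close> of a countable dense set is a limit of points
  \<open>z\<^sub>n\<close> with \<open>liminf u\<^sub>n(z\<^sub>n) \<ge> V(z)\<close>.

  The rest is deterministic. Let \<open>c + \<integral>log (max s \<bar>z - w\<bar>) d\<nu>(w)\<close> denote, with the kernel normalised at infinity,
  a truncated potential of a subsequential limit \<open>\<nu>\<close> of the zero distributions. The lower bound passes to the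
  limit because the truncated kernel is Lipschitz in \<open>z\<close> and dominates \<open>log \<bar>z - w\<bar>\<close>; the upper bound
  passes to the limit because the potential of the zeros truncated at \<open>s\<close> is at most
  the maximum of \<open>u\<^sub>n\<close> on the circle of radius \<open>s\<close>. So the truncated potential lies between \<open>V(z)\<close> and
  \<open>max V\<close> over the disc of radius \<open>s\<close>, and letting \<open>s\<close> tend to 0 identifies \<open>\<nu>\<close> as the normalised Laplacian of \<open>V\<close>.
  This also proves that this measure exists.\<close>

section \<open>Concentration and Borel-Cantelli\<close>

text \<open>Conditioning on all coefficients but one bounds the probability of a small value at a
  single point by a constant Q < 1, which is not summable. Testing r points improves this to Q^r, at
  the price of an interpolation factor (4 n)^r. With r close to the square root of n, the bound Q^r
  is summable, the factor is only e^(o(n)), and (1 + 1/n)^r still tends to 1, so that the test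
  points collapse to z. The lower bound therefore holds at a moving point near z and not at z
  itself. This is one reason for truncating: log |z - w| is neither bounded in w nor uniformly
  continuous in z, whereas its truncation is bounded and continuous in w and Lipschitz in z
  uniformly in w. It can thus be integrated against weakly convergent measures and moved from the
  moving point to z. Mass could still escape to infinity along a subsequence; the growth of V like
  log |z| excludes this.\<close>

lemma (in prob_space) prob_affine_small_ball:
  fixes \<xi> :: "'i \<Rightarrow> 'a \<Rightarrow> complex"
  assumes ind: "indep_vars (\<lambda>_. borel) \<xi> UNIV"
    and fin: "finite T" "finite J" "T \<inter> J = {}"
    and Q: "\<And>k y. k \<in> T \<Longrightarrow> prob {\<omega> \<in> space M. cmod (\<xi> k \<omega> + y) \<le> \<rho>} \<le> Q"
  shows "prob {\<omega> \<in> space M. \<forall>k\<in>T. cmod (\<xi> k \<omega> + (\<Sum>l\<in>J. b k l * \<xi> l \<omega>)) \<le> \<rho>} \<le> Q ^ card T"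
proof (cases "T = {}")
  case True
  then show ?thesis by simp
next
  case False
  have rv [measurable]: "\<xi> k \<in> borel_measurable M" for k
    using ind by (auto simp: indep_vars_def)
  define S where "S = PiM T (\<lambda>_. borel :: complex measure)"
  define S' where "S' = PiM J (\<lambda>_. borel :: complex measure)"
  define X where "X \<omega> = restrict (\<lambda>i. \<xi> i \<omega>) T" for \<omega>
  define Y where "Y \<omega> = restrict (\<lambda>i. \<xi> i \<omega>) J" for \<omega>
  have iv: "indep_var S X S' Y"
    unfolding S_def S'_def X_def[abs_def] Y_def[abs_def]
    by (rule indep_var_restrict[OF ind]) (use fin in auto)
  then have [measurable]: "X \<in> measurable M S" "Y \<in> measurable M S'"
    and dist: "distr M S X \<Otimes>\<^sub>M distr M S' Y = distr M (S \<Otimes>\<^sub>M S') (\<lambda>x. (X x, Y x))"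
    by (auto simp: indep_var_distribution_eq)
  have cS [measurable]: "(\<lambda>x. x k) \<in> borel_measurable S" if "k \<in> T" for k
    unfolding S_def using that by measurable
  have cS' [measurable]: "(\<lambda>x. x k) \<in> borel_measurable S'" if "k \<in> J" for k
    unfolding S'_def using that by measurable
  define E where "E = {p \<in> space (S \<Otimes>\<^sub>M S'). \<forall>k\<in>T. cmod (fst p k + (\<Sum>l\<in>J. b k l * snd p l)) \<le> \<rho>}"
  have E [measurable]: "E \<in> sets (S \<Otimes>\<^sub>M S')"
  proof -
    have "(\<lambda>p. cmod (fst p k + (\<Sum>l\<in>J. b k l * snd p l))) \<in> borel_measurable (S \<Otimes>\<^sub>M S')" if "k \<in> T" for k
    proof -
      have 1: "(\<lambda>p. fst p k) \<in> borel_measurable (S \<Otimes>\<^sub>M S')"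
        by (rule measurable_compose[OF measurable_fst cS[OF that]])
      have 2: "(\<lambda>p. \<Sum>l\<in>J. b k l * snd p l) \<in> borel_measurable (S \<Otimes>\<^sub>M S')"
        by (intro borel_measurable_sum borel_measurable_times borel_measurable_const
            measurable_compose[OF measurable_snd cS'])
      show ?thesis by (rule measurable_compose[OF borel_measurable_add[OF 1 2] borel_measurable_norm])
    qed
    then show ?thesis
      unfolding E_def
      by (intro sets.sets_Collect_finite_All' borel_measurable_le borel_measurable_const)
         (use fin False in auto)
  qed
  interpret DX: prob_space "distr M S X" by (rule prob_space_distr) measurable
  interpret DY: prob_space "distr M S' Y" by (rule prob_space_distr) measurable
  interpret P: pair_prob_space "distr M S X" "distr M S' Y" ..
  \<comment> \<open>With the variables indexed by \<open>J\<close> frozen at \<open>y\<close>, the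
    sums become constants \<open>c k\<close>. The events for different \<open>k\<close> in
    \<open>T\<close> then concern different independent variables, so their joint probability is a
    product of \<open>card T\<close> factors, each at most \<open>Q\<close>. Since the joint law of
    \<open>X\<close> and \<open>Y\<close> is a product, Fubini removes the freezing.\<close>
  have slice: "emeasure (distr M S X) ((\<lambda>x. (x, y)) -` E) \<le> ennreal (Q ^ card T)"
    if y: "y \<in> space S'" for y
  proof -
    define c where "c k = (\<Sum>l\<in>J. b k l * y l)" for k
    have sl: "(\<lambda>x. (x, y)) -` E \<in> sets S"
      by (rule sets_Pair2[OF E])
    have "X -` ((\<lambda>x. (x, y)) -` E) \<inter> space M = {\<omega> \<in> space M. \<forall>k\<in>T. cmod (\<xi> k \<omega> + c k) \<le> \<rho>}"
      using y measurable_space[OF \<open>X \<in> measurable M S\<close>]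
      unfolding E_def c_def by (auto simp: space_pair_measure X_def)
    also have "\<dots> = (\<Inter>k\<in>T. \<xi> k -` {x. cmod (x + c k) \<le> \<rho>} \<inter> space M)"
      using False by auto
    finally have "emeasure (distr M S X) ((\<lambda>x. (x, y)) -` E)
        = ennreal (prob (\<Inter>k\<in>T. \<xi> k -` {x. cmod (x + c k) \<le> \<rho>} \<inter> space M))"
      by (subst emeasure_distr[OF _ sl]) (auto simp: emeasure_eq_measure)
    also have "prob (\<Inter>k\<in>T. \<xi> k -` {x. cmod (x + c k) \<le> \<rho>} \<inter> space M)
        = (\<Prod>k\<in>T. prob (\<xi> k -` {x. cmod (x + c k) \<le> \<rho>} \<inter> space M))"
      by (rule indep_varsD[OF ind]) (use False fin in auto)
    also have "\<dots> \<le> (\<Prod>k\<in>T. Q)"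
    proof (rule prod_mono, intro conjI)
      fix k assume "k \<in> T"
      then show "prob (\<xi> k -` {x. cmod (x + c k) \<le> \<rho>} \<inter> space M) \<le> Q"
        using Q[of k "c k"] by (simp add: vimage_def Int_def conj_commute)
    qed simp
    finally show ?thesis by (simp add: ennreal_leI)
  qed
  have "{\<omega> \<in> space M. \<forall>k\<in>T. cmod (\<xi> k \<omega> + (\<Sum>l\<in>J. b k l * \<xi> l \<omega>)) \<le> \<rho>} = (\<lambda>x. (X x, Y x)) -` E \<inter> space M"
    using measurable_space[OF \<open>X \<in> measurable M S\<close>] measurable_space[OF \<open>Y \<in> measurable M S'\<close>]
    unfolding E_def by (auto simp: space_pair_measure X_def Y_def cong: sum.cong)
  then have "emeasure M {\<omega> \<in> space M. \<forall>k\<in>T. cmod (\<xi> k \<omega> + (\<Sum>l\<in>J. b k l * \<xi> l \<omega>)) \<le> \<rho>}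
      = emeasure (distr M S X \<Otimes>\<^sub>M distr M S' Y) E"
    unfolding dist by (subst emeasure_distr) auto
  also have "\<dots> = (\<integral>\<^sup>+y. emeasure (distr M S X) ((\<lambda>x. (x, y)) -` E) \<partial>distr M S' Y)"
    using E sets_pair_measure_cong[of "distr M S X" S "distr M S' Y" S']
    by (intro P.emeasure_pair_measure_alt2) simp
  also have "\<dots> \<le> (\<integral>\<^sup>+y. ennreal (Q ^ card T) \<partial>distr M S' Y)"
    by (intro nn_integral_mono slice) simp
  also have "\<dots> = ennreal (Q ^ card T)"
    by (simp add: DY.emeasure_space_1[simplified])
  finally have "ennreal (prob {\<omega> \<in> space M. \<forall>k\<in>T. cmod (\<xi> k \<omega> + (\<Sum>l\<in>J. b k l * \<xi> l \<omega>)) \<le> \<rho>}) \<le> ennreal (Q ^ card T)"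
    by (simp add: emeasure_eq_measure)
  moreover have "0 \<le> Q"
  proof -
    obtain k where "k \<in> T" using False by blast
    have "0 \<le> prob {\<omega> \<in> space M. cmod (\<xi> k \<omega> + 0) \<le> \<rho>}" by (rule measure_nonneg)
    also have "\<dots> \<le> Q" by (rule Q[OF \<open>k \<in> T\<close>])
    finally show ?thesis .
  qed
  ultimately show ?thesis by simp
qed

text \<open>Induction on \<open>L\<close> inserts one node at a time. The factor
  \<open>(x m - x l) / (xk - x l)\<close> turns the weights \<open>c\<close> into weights whose
  power sum of order j combines the power sums of \<open>c\<close> of orders j + 1 and j, so every
  node uses up one further power sum and costs a factor \<open>B\<close>. In the application these
  power sums are the values of the polynomial at the points of the progression.\<close>

lemma lagrange_shift_bound:
  fixes c x :: "'i \<Rightarrow> complex"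
  assumes "finite L" "\<And>l. l \<in> L \<Longrightarrow> 1 + cmod (x l) \<le> B * cmod (xk - x l)"
    and "\<And>l. l \<in> L \<Longrightarrow> xk \<noteq> x l" and "0 \<le> B"
    and "\<And>j. j \<le> card L \<Longrightarrow> cmod (\<Sum>m\<in>A. c m * x m ^ j) \<le> K"
  shows "cmod (\<Sum>m\<in>A. c m * (\<Prod>l\<in>L. (x m - x l) / (xk - x l))) \<le> B ^ card L * K"
  using assms
proof (induction L arbitrary: c K rule: finite_induct)
  case empty
  then show ?case using empty(4)[of 0] by simp
next
  case (insert l L)
  define c' where "c' m = c m * ((x m - x l) / (xk - x l))" for m
  have "cmod (\<Sum>m\<in>A. c' m * (\<Prod>l\<in>L. (x m - x l) / (xk - x l))) \<le> B ^ card L * (B * K)"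
  proof (rule insert.IH)
    fix j assume j: "j \<le> card L"
    have "(\<Sum>m\<in>A. c' m * x m ^ j) = ((\<Sum>m\<in>A. c m * x m ^ Suc j) - x l * (\<Sum>m\<in>A. c m * x m ^ j)) / (xk - x l)"
      unfolding c'_def sum_distrib_left sum_subtractf[symmetric] sum_divide_distrib
      by (intro sum.cong) (auto simp: field_simps)
    also have "cmod \<dots> \<le> (K + cmod (x l) * K) / cmod (xk - x l)"
      unfolding norm_divide using insert.prems(4)[of "Suc j"] insert.prems(4)[of j] j insert.hyps
      by (intro divide_right_mono order_trans[OF norm_triangle_ineq4] add_mono)
         (auto simp: norm_mult intro!: mult_left_mono)
    also have "\<dots> = K * ((1 + cmod (x l)) / cmod (xk - x l))"
      by (simp add: algebra_simps)
    also have "\<dots> \<le> K * B"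
    proof (rule mult_left_mono)
      show "(1 + cmod (x l)) / cmod (xk - x l) \<le> B"
        using insert.prems(1)[of l] insert.prems(2)[of l] by (simp add: field_simps)
      show "0 \<le> K"
        using insert.prems(4)[of 0] order_trans[OF norm_ge_zero] by blast
    qed
    finally show "cmod (\<Sum>m\<in>A. c' m * x m ^ j) \<le> B * K" by (simp add: mult.commute)
  qed (use insert in auto)
  also have "(\<Sum>m\<in>A. c' m * (\<Prod>l\<in>L. (x m - x l) / (xk - x l)))
      = (\<Sum>m\<in>A. c m * (\<Prod>l\<in>insert l L. (x m - x l) / (xk - x l)))"
    using insert.hyps by (simp add: c'_def mult.assoc)
  finally show ?case using insert.hyps by (simp add: mult_ac)
qed

text \<open>On the geometric progression \<open>z\<close>, \<open>z q\<close>, \<open>z q\<^sup>2\<close> and so on, the monomials behave like exponentials, so a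
  polynomial that is small at \<open>card T\<close> of these points has, after elimination of the other
  monomials indexed by \<open>T\<close>, a small coefficient at \<open>k \<in> T\<close>.\<close>

lemma geometric_interpolation_bound:
  fixes g :: "nat \<Rightarrow> complex"
  assumes n: "n \<ge> 1" and T: "T \<subseteq> {..n}" "k \<in> T"
    and K: "\<And>j. j < card T \<Longrightarrow> cmod (\<Sum>m\<le>n. g m * (z * of_real (1 + 1 / real n) ^ j) ^ m) \<le> K"
  defines "x \<equiv> \<lambda>m. of_real (1 + 1 / real n) ^ m"
  shows "cmod (g k * z ^ k + (\<Sum>m\<in>{..n} - T. g m * z ^ m * (\<Prod>l\<in>T - {k}. (x m - x l) / (x k - x l))))
           \<le> (4 * real n) ^ card T * K"
proof -
  define q where "q = 1 + 1 / real n"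
  have q1: "q > 1" using n by (simp add: q_def)
  have xq: "x m = of_real (q ^ m)" for m by (simp add: x_def q_def)
  have finT: "finite T" using T finite_subset by blast
  \<comment> \<open>Exponents up to n keep all nodes between 1 and e. Together with the separation
    1/n shown next, this gives the ratio 4 n required by the interpolation bound.\<close>
  have q3: "q ^ l \<le> 3" if "l \<le> n" for l
  proof -
    have "q ^ l \<le> q ^ n" using that q1 by (intro power_increasing) auto
    also have "\<dots> \<le> exp 1"
      unfolding q_def by (rule exp_ge_one_plus_x_over_n_power_n) (use n in auto)
    finally show ?thesis using exp_le by linarith
  qed
  have sep1: "1 / real n \<le> q ^ b - q ^ a" if "a < b" for a b
  proof -
    have "q ^ Suc a \<le> q ^ b" using that q1 by (intro power_increasing) auto
    then have "q ^ a * (1 / real n) \<le> q ^ b - q ^ a" by (simp add: q_def algebra_simps)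
    moreover have "1 * (1 / real n) \<le> q ^ a * (1 / real n)"
      using q1 by (intro mult_right_mono one_le_power) auto
    ultimately show ?thesis by linarith
  qed
  have sep: "1 / real n \<le> cmod (x k - x l)" if "l \<noteq> k" for l
  proof -
    have "cmod (x k - x l) = \<bar>q ^ k - q ^ l\<bar>"
      unfolding xq of_real_diff[symmetric] norm_of_real ..
    then show ?thesis using sep1[of k l] sep1[of l k] that by (cases k l rule: linorder_cases) auto
  qed
  have L: "card (T - {k}) = card T - 1" "card T \<ge> 1"
    using T finT by (auto simp: Suc_le_eq card_gt_0_iff)
  have "cmod (\<Sum>m\<le>n. (g m * z ^ m) * (\<Prod>l\<in>T - {k}. (x m - x l) / (x k - x l))) \<le> (4 * real n) ^ card (T - {k}) * K"
  proof (rule lagrange_shift_bound)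
    fix l assume l: "l \<in> T - {k}"
    have "1 + cmod (x l) \<le> 4"
      unfolding xq norm_of_real using q3[of l] l T q1 by auto
    also have "4 = 4 * real n * (1 / real n)" using n by simp
    also have "\<dots> \<le> 4 * real n * cmod (x k - x l)"
      using sep[of l] l by (intro mult_left_mono) auto
    finally show "1 + cmod (x l) \<le> 4 * real n * cmod (x k - x l)" .
    show "x k \<noteq> x l" using sep[of l] l n by auto
  next
    fix j assume "j \<le> card (T - {k})"
    then have "j < card T" using L by linarith
    then show "cmod (\<Sum>m\<le>n. g m * z ^ m * x m ^ j) \<le> K"
      using K[of j] by (simp add: x_def power_mult_distrib power_mult[symmetric] mult_ac)
  qed (use finT in auto)
  also have "(\<Sum>m\<le>n. (g m * z ^ m) * (\<Prod>l\<in>T - {k}. (x m - x l) / (x k - x l)))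
     = (\<Sum>m\<in>T. (g m * z ^ m) * (\<Prod>l\<in>T - {k}. (x m - x l) / (x k - x l)))
       + (\<Sum>m\<in>{..n} - T. (g m * z ^ m) * (\<Prod>l\<in>T - {k}. (x m - x l) / (x k - x l)))"
    using T by (subst add.commute) (intro sum.subset_diff, auto)
  \<comment> \<open>For \<open>m\<close> in \<open>T\<close> other than \<open>k\<close>, the
    Lagrange product contains the vanishing factor with l = m: this is how the other unknowns of
    \<open>T\<close> are eliminated.\<close>
  also have "(\<Sum>m\<in>T. (g m * z ^ m) * (\<Prod>l\<in>T - {k}. (x m - x l) / (x k - x l)))
     = (\<Sum>m\<in>{k}. (g m * z ^ m) * (\<Prod>l\<in>T - {k}. (x m - x l) / (x k - x l)))"
    using T finT by (intro sum.mono_neutral_right) (auto intro!: prod_zero)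
  also have "\<dots> = g k * z ^ k"
  proof -
    have "(\<Prod>l\<in>T - {k}. (x k - x l) / (x k - x l)) = 1"
    proof (rule prod.neutral, rule ballI)
      fix l assume "l \<in> T - {k}"
      then have "x k \<noteq> x l" using sep[of l] n by auto
      then show "(x k - x l) / (x k - x l) = 1" by simp
    qed
    then show ?thesis by simp
  qed
  also have "(4 * real n) ^ card (T - {k}) * K \<le> (4 * real n) ^ card T * K"
  proof (rule mult_right_mono)
    show "(4 * real n) ^ card (T - {k}) \<le> (4 * real n) ^ card T"
      using n L by (intro power_increasing) auto
    show "0 \<le> K" using K[of 0] L order_trans[OF norm_ge_zero] by auto
  qed
  finally show ?thesis .
qed

lemma poly_random_poly: "poly (random_poly f x n) z = (\<Sum>k\<le>n. x k * f n k * z ^ k)"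
  by (simp add: random_poly_def poly_sum poly_monom)

text \<open>Divided by \<open>f n k * z ^ k\<close>, the interpolation bound says that
  \<open>\<xi> k\<close> is within \<open>\<rho>\<close> of a linear combination of variables
  outside \<open>T\<close>. There is one such constraint for each \<open>k\<close> in
  \<open>T\<close>, and none of them involves a second variable of \<open>T\<close>; this is the
  form to which independence applies.\<close>

lemma (in prob_space) prob_random_poly_small:
  fixes \<xi> :: "nat \<Rightarrow> 'a \<Rightarrow> complex"
  assumes ind: "indep_vars (\<lambda>_. borel) \<xi> UNIV"
    and Q: "\<And>k y. prob {\<omega> \<in> space M. cmod (\<xi> k \<omega> + y) \<le> \<rho>} \<le> Q"
    and n: "n \<ge> 1" and T: "T \<subseteq> {..n}"
    and big: "\<And>k. k \<in> T \<Longrightarrow> (4 * real n) ^ card T * K \<le> \<rho> * (cmod (f n k) * cmod z ^ k)"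
             "\<And>k. k \<in> T \<Longrightarrow> 0 < cmod (f n k) * cmod z ^ k"
  shows "prob {\<omega> \<in> space M. \<forall>j<card T.
           cmod (poly (random_poly f (\<lambda>k. \<xi> k \<omega>) n) (z * of_real (1 + 1 / real n) ^ j)) \<le> K} \<le> Q ^ card T"
proof -
  define x :: "nat \<Rightarrow> complex" where "x m = of_real (1 + 1 / real n) ^ m" for m
  define lag where "lag k m = (\<Prod>l\<in>T - {k}. (x m - x l) / (x k - x l))" for k m
  define b where "b k m = f n m * z ^ m * lag k m / (f n k * z ^ k)" for k m
  have rv [measurable]: "\<xi> k \<in> borel_measurable M" for k
    using ind by (auto simp: indep_vars_def)
  have finT: "finite T" using T finite_subset by blast
  have "prob {\<omega> \<in> space M. \<forall>j<card T.
           cmod (poly (random_poly f (\<lambda>k. \<xi> k \<omega>) n) (z * of_real (1 + 1 / real n) ^ j)) \<le> K}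
      \<le> prob {\<omega> \<in> space M. \<forall>k\<in>T. cmod (\<xi> k \<omega> + (\<Sum>l\<in>{..n} - T. b k l * \<xi> l \<omega>)) \<le> \<rho>}"
  proof (rule finite_measure_mono)
    show "{\<omega> \<in> space M. \<forall>k\<in>T. cmod (\<xi> k \<omega> + (\<Sum>l\<in>{..n} - T. b k l * \<xi> l \<omega>)) \<le> \<rho>} \<in> sets M"
      using finT by measurable
    show "{\<omega> \<in> space M. \<forall>j<card T.
           cmod (poly (random_poly f (\<lambda>k. \<xi> k \<omega>) n) (z * of_real (1 + 1 / real n) ^ j)) \<le> K}
       \<subseteq> {\<omega> \<in> space M. \<forall>k\<in>T. cmod (\<xi> k \<omega> + (\<Sum>l\<in>{..n} - T. b k l * \<xi> l \<omega>)) \<le> \<rho>}"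
    proof (intro subsetI CollectI conjI ballI)
      fix \<omega> k assume k: "k \<in> T" and w: "\<omega> \<in> {\<omega> \<in> space M. \<forall>j<card T.
           cmod (poly (random_poly f (\<lambda>k. \<xi> k \<omega>) n) (z * of_real (1 + 1 / real n) ^ j)) \<le> K}"
      then have small: "\<forall>j<card T.
           cmod (poly (random_poly f (\<lambda>k. \<xi> k \<omega>) n) (z * of_real (1 + 1 / real n) ^ j)) \<le> K" by blast
      have "cmod (\<xi> k \<omega> * f n k * z ^ k + (\<Sum>m\<in>{..n} - T. \<xi> m \<omega> * f n m * z ^ m * lag k m))
             \<le> (4 * real n) ^ card T * K"
        unfolding lag_def x_def using small
        by (intro geometric_interpolation_bound[OF n T k]) (auto simp: poly_random_poly)
      also have "\<xi> k \<omega> * f n k * z ^ k + (\<Sum>m\<in>{..n} - T. \<xi> m \<omega> * f n m * z ^ m * lag k m)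
          = (\<xi> k \<omega> + (\<Sum>l\<in>{..n} - T. b k l * \<xi> l \<omega>)) * (f n k * z ^ k)"
      proof -
        have "cmod (f n k * z ^ k) > 0"
          using big(2)[OF k] by (simp add: norm_mult norm_power)
        then have "f n k * z ^ k \<noteq> 0"
          unfolding zero_less_norm_iff .
        then have "b k l * \<xi> l \<omega> * (f n k * z ^ k) = \<xi> l \<omega> * f n l * z ^ l * lag k l" for l
          by (simp only: b_def times_divide_eq_left nonzero_divide_eq_eq[OF \<open>f n k * z ^ k \<noteq> 0\<close>]
              nonzero_mult_div_cancel_right[OF \<open>f n k * z ^ k \<noteq> 0\<close>] nonzero_eq_divide_eq) (simp add: mult_ac)
        then show ?thesis
          unfolding distrib_right sum_distrib_right by (simp only: mult.assoc)
      qed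
      finally have "cmod (\<xi> k \<omega> + (\<Sum>l\<in>{..n} - T. b k l * \<xi> l \<omega>)) * (cmod (f n k) * cmod z ^ k)
           \<le> \<rho> * (cmod (f n k) * cmod z ^ k)"
        using big(1)[OF k] by (simp add: norm_mult norm_power)
      then show "cmod (\<xi> k \<omega> + (\<Sum>l\<in>{..n} - T. b k l * \<xi> l \<omega>)) \<le> \<rho>"
        using big(2)[OF k] by (rule mult_right_le_imp_le)
    qed blast
  qed
  also have "\<dots> \<le> Q ^ card T"
    by (rule prob_affine_small_ball[OF ind]) (use finT Q in auto)
  finally show ?thesis .
qed

text \<open>Two support points \<open>a\<close> and \<open>b\<close> at distance 4
  \<open>\<rho>\<close> cannot both be closer than 2 \<open>\<rho>\<close> to \<open>-y\<close>.
  Hence the ball of radius \<open>\<rho>\<close> about \<open>-y\<close> misses the ball of radius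
  \<open>\<rho>\<close> about one of them, and that ball has positive probability. The maximum with
  1/2 makes \<open>Q > 0\<close> immediate.\<close>

lemma (in prob_space) non_degenerate_concentration:
  fixes X :: "'a \<Rightarrow> complex"
  assumes [measurable]: "X \<in> borel_measurable M" and nd: "non_degenerate M X"
  obtains \<rho> Q where "\<rho> > 0" "0 < Q" "Q < 1"
    "\<And>y. prob {\<omega> \<in> space M. cmod (X \<omega> + y) \<le> \<rho>} \<le> Q"
proof -
  obtain a b where ab: "a \<noteq> b"
    and a: "a \<in> measure_support (distr M borel X)" and b: "b \<in> measure_support (distr M borel X)"
    using nd unfolding non_degenerate_def by blast
  define \<rho> where "\<rho> = dist a b / 4"
  have \<rho>: "\<rho> > 0" using ab by (simp add: \<rho>_def)
  define P where "P c = prob {\<omega> \<in> space M. X \<omega> \<in> ball c \<rho>}" for c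
  have pos: "0 < P c" if "c \<in> measure_support (distr M borel X)" for c
  proof -
    have "0 < emeasure (distr M borel X) (ball c \<rho>)"
      using that \<rho> unfolding measure_support_def by (auto dest!: spec[of _ "ball c \<rho>"])
    then show ?thesis
      unfolding P_def by (subst (asm) emeasure_distr) (auto simp: emeasure_eq_measure vimage_def Int_def conj_commute)
  qed
  have [measurable]: "{\<omega> \<in> space M. X \<omega> \<in> ball c \<rho>} \<in> sets M" for c
    using measurable_sets[OF assms(1), of "ball c \<rho>"] by (simp add: vimage_def Int_def conj_commute)
  define Q where "Q = max (1 / 2) (1 - min (P a) (P b))"
  have "prob {\<omega> \<in> space M. cmod (X \<omega> + y) \<le> \<rho>} \<le> Q" for y
  proof -
    have sub: "prob {\<omega> \<in> space M. cmod (X \<omega> + y) \<le> \<rho>} \<le> 1 - P c" if "\<not> dist (-y) c < 2 * \<rho>" for c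
    proof -
      have "{\<omega> \<in> space M. cmod (X \<omega> + y) \<le> \<rho>} \<subseteq> space M - {\<omega> \<in> space M. X \<omega> \<in> ball c \<rho>}"
      proof clarsimp
        fix \<omega> assume "cmod (X \<omega> + y) \<le> \<rho>" "dist c (X \<omega>) < \<rho>"
        moreover have "dist (-y) c \<le> dist (-y) (X \<omega>) + dist c (X \<omega>)"
          by (metis dist_commute dist_triangle)
        moreover have "dist (-y) (X \<omega>) = cmod (X \<omega> + y)"
          by (metis dist_norm norm_minus_cancel minus_diff_eq diff_minus_eq_add)
        ultimately show False using that by linarith
      qed
      then have "prob {\<omega> \<in> space M. cmod (X \<omega> + y) \<le> \<rho>} \<le> prob (space M - {\<omega> \<in> space M. X \<omega> \<in> ball c \<rho>})"
        by (intro finite_measure_mono) measurable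
      also have "\<dots> = 1 - P c"
        unfolding P_def by (subst prob_compl) auto
      finally show ?thesis .
    qed
    have "\<not> dist (-y) a < 2 * \<rho> \<or> \<not> dist (-y) b < 2 * \<rho>"
      using dist_triangle3[of a b "-y"] \<rho>_def by linarith
    then show ?thesis
      using sub[of a] sub[of b] unfolding Q_def by (auto simp: min_def max_def)
  qed
  moreover have "0 < Q" "Q < 1" using pos[OF a] pos[OF b] by (auto simp: Q_def)
  ultimately show ?thesis using \<rho> that by blast
qed

lemma (in prob_space) AE_random_poly_not_small:
  fixes \<xi> :: "nat \<Rightarrow> 'a \<Rightarrow> complex"
  assumes ind: "indep_vars (\<lambda>_. borel) \<xi> UNIV"
    and Q: "\<And>k y. prob {\<omega> \<in> space M. cmod (\<xi> k \<omega> + y) \<le> \<rho>} \<le> Q" "\<rho> > 0" "0 < Q" "Q < 1"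
    and large: "\<forall>n\<ge>n0. real (card {k \<in> {0..n}. cmod (f n k) * cmod z ^ k \<ge> exp (real n * (v - \<epsilon> / 2))})
            \<ge> real n powr (2/3 + \<delta>)" "\<delta> > 0"
    and \<epsilon>: "\<epsilon> > 0"
  shows "AE \<omega> in M. \<forall>\<^sub>F n in sequentially. \<exists>j<nat \<lfloor>sqrt (real n)\<rfloor>.
           cmod (poly (random_poly f (\<lambda>k. \<xi> k \<omega>) n) (z * of_real (1 + 1 / real n) ^ j)) > exp (real n * (v - \<epsilon>))"
proof -
  have rv [measurable]: "\<xi> k \<in> borel_measurable M" for k
    using ind by (auto simp: indep_vars_def)
  \<comment> \<open>Interpolation through \<open>r n\<close> points loses (4 n)^(r n), at most exp
    (sqrt n * ln (4 n)). This is eventually below \<open>\<rho>\<close> exp (n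
    \<open>\<epsilon>\<close> / 2), which is the room between the threshold
    \<open>\<epsilon> / 2\<close> in the hypothesis and \<open>\<epsilon>\<close> in the conclusion.
    Rounding down leaves at least sqrt n - 1 points, enough for summability.\<close>
  define r where "r n = nat \<lfloor>sqrt (real n)\<rfloor>" for n
  define A where "A n = {\<omega> \<in> space M. \<forall>j<r n.
     cmod (poly (random_poly f (\<lambda>k. \<xi> k \<omega>) n) (z * of_real (1 + 1 / real n) ^ j)) \<le> exp (real n * (v - \<epsilon>))}" for n
  have [measurable]: "A n \<in> sets M" for n
    unfolding A_def poly_random_poly by measurable
  have r: "real (r n) \<le> sqrt (real n)" "sqrt (real n) - 1 \<le> real (r n)" for n
    unfolding r_def by (auto simp: of_nat_nat)
  have "\<forall>\<^sub>F x in at_top. (4 * x) powr sqrt x \<le> \<rho> * exp (x * (\<epsilon> / 2))"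
    using Q(2) \<epsilon> by real_asymp
  then have ev: "\<forall>\<^sub>F n in sequentially. (4 * real n) powr sqrt (real n) \<le> \<rho> * exp (real n * (\<epsilon> / 2))"
    by (rule eventually_compose_filterlim[OF _ filterlim_real_sequentially])
  have bound: "\<forall>\<^sub>F n in sequentially. prob (A n) \<le> Q powr (sqrt (real n) - 1)"
    using ev eventually_ge_at_top[of "max 1 n0"]
  proof eventually_elim
    case (elim n)
    have n: "n \<ge> 1" "n \<ge> n0" using elim by auto
    define S where "S = {k \<in> {0..n}. cmod (f n k) * cmod z ^ k \<ge> exp (real n * (v - \<epsilon> / 2))}"
    have "real (r n) \<le> real n powr (1/2)" using r(1)[of n] by (simp add: powr_half_sqrt)
    also have "\<dots> \<le> real n powr (2/3 + \<delta>)" using n large(2) by (intro powr_mono) auto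
    also have "\<dots> \<le> real (card S)" unfolding S_def using large(1) n by auto
    finally have "r n \<le> card S" by simp
    then obtain T where T: "T \<subseteq> S" "card T = r n"
      by (meson obtain_subset_with_card_n)
    have "(4 * real n) ^ r n = (4 * real n) powr real (r n)"
      using n by (subst powr_realpow) auto
    also have "\<dots> \<le> (4 * real n) powr sqrt (real n)"
      using n r(1)[of n] by (intro powr_mono) auto
    also note elim(1)
    finally have "(4 * real n) ^ r n * exp (real n * (v - \<epsilon>)) \<le> \<rho> * exp (real n * (\<epsilon> / 2)) * exp (real n * (v - \<epsilon>))"
      by (intro mult_right_mono) auto
    also have "\<dots> = \<rho> * exp (real n * (v - \<epsilon> / 2))"
      by (simp add: exp_add[symmetric] algebra_simps)
    finally have le: "(4 * real n) ^ r n * exp (real n * (v - \<epsilon>)) \<le> \<rho> * exp (real n * (v - \<epsilon> / 2))" .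
    have "prob {\<omega> \<in> space M. \<forall>j<card T.
           cmod (poly (random_poly f (\<lambda>k. \<xi> k \<omega>) n) (z * of_real (1 + 1 / real n) ^ j)) \<le> exp (real n * (v - \<epsilon>))}
         \<le> Q ^ card T"
    proof (rule prob_random_poly_small[OF ind Q(1) n(1)])
      fix k assume "k \<in> T"
      then have k: "exp (real n * (v - \<epsilon> / 2)) \<le> cmod (f n k) * cmod z ^ k"
        using T by (auto simp: S_def)
      then show "0 < cmod (f n k) * cmod z ^ k" using exp_gt_zero less_le_trans by blast
      have "\<rho> * exp (real n * (v - \<epsilon> / 2)) \<le> \<rho> * (cmod (f n k) * cmod z ^ k)"
        using k Q(2) by (intro mult_left_mono) auto
      then show "(4 * real n) ^ card T * exp (real n * (v - \<epsilon>)) \<le> \<rho> * (cmod (f n k) * cmod z ^ k)"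
        using le T by simp
    qed (use T in \<open>auto simp: S_def\<close>)
    then have "prob (A n) \<le> Q ^ r n" by (simp add: A_def T)
    also have "\<dots> = Q powr real (r n)" using Q(3) by (subst powr_realpow) auto
    also have "\<dots> \<le> Q powr (sqrt (real n) - 1)"
      using r(2)[of n] Q(3,4) by (intro powr_mono') auto
    finally show ?case .
  qed
  have "(\<lambda>n. Q powr (sqrt (real n) - 1)) \<in> O(\<lambda>n. real n powr -2)"
    using Q(3,4) by real_asymp
  then have "summable (\<lambda>n. Q powr (sqrt (real n) - 1))"
    by (rule summable_comparison_test_bigo[rotated]) (simp add: summable_real_powr_iff)
  then have "summable (\<lambda>n. prob (A n))"
    by (rule summable_comparison_test_ev[rotated]) (use bound in eventually_elim, simp)
  then have "AE \<omega> in M. \<forall>\<^sub>F n in sequentially. \<omega> \<in> space M - A n"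
    by (intro borel_cantelli_AE1) (auto simp: emeasure_eq_measure)
  then show ?thesis
  proof eventually_elim
    case (elim \<omega>)
    then show ?case
      by eventually_elim (auto simp: A_def r_def not_le)
  qed
qed

section \<open>Growth of the random coefficients under a logarithmic moment\<close>

lemma (in prob_space) AE_subexponential_growth:
  fixes \<xi> :: "nat \<Rightarrow> 'a \<Rightarrow> complex"
  assumes rv [measurable]: "\<And>k. \<xi> k \<in> borel_measurable M"
    and ident: "\<And>k. distr M borel (\<xi> k) = distr M borel (\<xi> 0)"
    and log_moment: "integrable M (\<lambda>\<omega>. ln (1 + cmod (\<xi> 0 \<omega>)))"
  shows "AE \<omega> in M. \<forall>\<epsilon>>0. \<exists>C. \<forall>k. cmod (\<xi> k \<omega>) \<le> C * exp (\<epsilon> * real k)"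
proof -
  define L where "L k \<omega> = ln (1 + cmod (\<xi> k \<omega>))" for k \<omega>
  have [measurable]: "L k \<in> borel_measurable M" for k
    unfolding L_def by measurable
  have L0: "0 \<le> L k \<omega>" for k \<omega> unfolding L_def by simp
  have int: "integrable M (L 0)" using log_moment by (simp add: L_def[abs_def])
  have "AE \<omega> in M. \<forall>\<^sub>F k in sequentially. L k \<omega> \<le> \<epsilon> * real k" if \<epsilon>: "\<epsilon> > 0" for \<epsilon>
  proof -
    define A where "A k = {\<omega> \<in> space M. L k \<omega> > \<epsilon> * real k}" for k
    have [measurable]: "A k \<in> sets M" for k unfolding A_def by measurable
    have same: "prob (A k) = prob {\<omega> \<in> space M. L 0 \<omega> > \<epsilon> * real k}" for k
    proof -
      have "prob {\<omega> \<in> space M. L i \<omega> > \<epsilon> * real k} = measure (distr M borel (\<xi> i)) {x. ln (1 + cmod x) > \<epsilon> * real k}" for i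
        by (subst measure_distr) (auto simp: L_def vimage_def Int_def conj_commute)
      then show ?thesis unfolding A_def using ident[of k] by simp
    qed
    \<comment> \<open>All tails are tails of the one variable \<open>L 0\<close>. The number of k
      with \<open>\<epsilon>\<close> k < \<open>L 0\<close> is at most \<open>L 0\<close> /
      \<open>\<epsilon>\<close> + 1, so the partial sums are bounded by the expectation of the
      latter.\<close>
    have "summable (\<lambda>k. prob (A k))"
    proof (rule summableI_nonneg_bounded)
      fix N :: nat
      have "(\<Sum>k<N. prob (A k)) = (\<Sum>k<N. expectation (indicator {\<omega> \<in> space M. L 0 \<omega> > \<epsilon> * real k}))"
        unfolding same by simp
      also have "\<dots> = expectation (\<lambda>\<omega>. \<Sum>k<N. indicator {\<omega> \<in> space M. L 0 \<omega> > \<epsilon> * real k} \<omega>)"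
        by (rule Bochner_Integration.integral_sum[symmetric]) (auto simp: emeasure_eq_measure)
      also have "\<dots> \<le> expectation (\<lambda>\<omega>. L 0 \<omega> / \<epsilon> + 1)"
      proof (rule integral_mono)
        fix \<omega> assume w: "\<omega> \<in> space M"
        have "(\<Sum>k<N. indicator {\<omega> \<in> space M. L 0 \<omega> > \<epsilon> * real k} \<omega> :: real)
             = (\<Sum>k<N. if L 0 \<omega> > \<epsilon> * real k then 1 else 0)"
          using w by (intro sum.cong) (auto simp: indicator_def)
        also have "\<dots> = real (card {k. k < N \<and> L 0 \<omega> > \<epsilon> * real k})"
          by (subst sum.If_cases) (auto simp: Int_def)
        also have "\<dots> \<le> real (card {..nat \<lfloor>L 0 \<omega> / \<epsilon>\<rfloor>})"
        proof (intro of_nat_mono card_mono)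
          show "{k. k < N \<and> L 0 \<omega> > \<epsilon> * real k} \<subseteq> {..nat \<lfloor>L 0 \<omega> / \<epsilon>\<rfloor>}"
          proof clarify
            fix k assume "\<epsilon> * real k < L 0 \<omega>"
            then have "real k \<le> L 0 \<omega> / \<epsilon>" using \<epsilon> by (simp add: field_simps)
            then show "k \<le> nat \<lfloor>L 0 \<omega> / \<epsilon>\<rfloor>" by (rule le_nat_floor)
          qed
        qed simp
        also have "\<dots> \<le> L 0 \<omega> / \<epsilon> + 1"
          using L0[of 0 \<omega>] \<epsilon> by (simp add: of_nat_nat)
        finally show "(\<Sum>k<N. indicator {\<omega> \<in> space M. L 0 \<omega> > \<epsilon> * real k} \<omega>) \<le> L 0 \<omega> / \<epsilon> + 1" .
      qed (use int in \<open>auto simp: emeasure_eq_measure\<close>)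
      finally show "(\<Sum>k<N. prob (A k)) \<le> expectation (\<lambda>\<omega>. L 0 \<omega> / \<epsilon> + 1)" .
    qed simp
    then have "AE \<omega> in M. \<forall>\<^sub>F k in sequentially. \<omega> \<in> space M - A k"
      by (intro borel_cantelli_AE1) (auto simp: emeasure_eq_measure)
    then show ?thesis
    proof eventually_elim
      case (elim \<omega>)
      then show ?case by eventually_elim (auto simp: A_def not_less)
    qed
  qed
  \<comment> \<open>Countably many rates suffice: they keep the exceptional set null and are cofinal
    for all \<open>\<epsilon> > 0\<close>.\<close>
  then have "AE \<omega> in M. \<forall>m. \<forall>\<^sub>F k in sequentially. L k \<omega> \<le> inverse (real (Suc m)) * real k"
    by (subst AE_all_countable) auto
  then show ?thesis
  proof eventually_elim
    case (elim \<omega>)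
    show ?case
    proof (intro allI impI)
      fix \<epsilon> :: real assume "\<epsilon> > 0"
      then obtain m where m: "inverse (real (Suc m)) < \<epsilon>" using reals_Archimedean by blast
      obtain N where N: "\<And>k. k \<ge> N \<Longrightarrow> L k \<omega> \<le> inverse (real (Suc m)) * real k"
        using elim[rule_format, of m] unfolding eventually_sequentially by blast
      \<comment> \<open>The sum covers the finitely many indices below \<open>N\<close>, at which
        nothing is known; the summand 1 covers all the others.\<close>
      define C where "C = 1 + (\<Sum>k<N. cmod (\<xi> k \<omega>))"
      have C1: "1 \<le> C" unfolding C_def by (simp add: sum_nonneg)
      have "cmod (\<xi> k \<omega>) \<le> C * exp (\<epsilon> * real k)" for k
      proof (cases "k < N")
        case True
        then have "cmod (\<xi> k \<omega>) \<le> (\<Sum>k<N. cmod (\<xi> k \<omega>))"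
          by (intro member_le_sum) auto
        then have "cmod (\<xi> k \<omega>) \<le> C * 1" by (simp add: C_def)
        also have "\<dots> \<le> C * exp (\<epsilon> * real k)"
          using C1 \<open>\<epsilon> > 0\<close> by (intro mult_left_mono) auto
        finally show ?thesis .
      next
        case False
        then have "L k \<omega> \<le> inverse (real (Suc m)) * real k" by (intro N) auto
        also have "\<dots> \<le> \<epsilon> * real k" using m by (intro mult_right_mono) auto
        finally have "exp (L k \<omega>) \<le> exp (\<epsilon> * real k)" by simp
        moreover have "exp (L k \<omega>) = 1 + cmod (\<xi> k \<omega>)"
          unfolding L_def by (rule exp_ln) (simp add: add_pos_nonneg)
        ultimately have "cmod (\<xi> k \<omega>) \<le> 1 * exp (\<epsilon> * real k)" by simp
        also have "\<dots> \<le> C * exp (\<epsilon> * real k)"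
          using C1 by (intro mult_right_mono) auto
        finally show ?thesis .
      qed
      then show "\<exists>C. \<forall>k. cmod (\<xi> k \<omega>) \<le> C * exp (\<epsilon> * real k)" by blast
    qed
  qed
qed

section \<open>Weak compactness of tight measures on the plane\<close>

text \<open>Schoenberg's space-filling curve, made to sweep out the whole plane: measures on the plane lift along
  it to the line, where Helly's theorem gives compactness.\<close>

definition tri :: "real \<Rightarrow> real" where
  "tri t = arccos (cos (pi * t)) / pi"

lemma continuous_on_tri [continuous_intros]:
  fixes g :: "'a :: t2_space \<Rightarrow> real"
  shows "continuous_on A g \<Longrightarrow> continuous_on A (\<lambda>x. tri (g x))"
  unfolding tri_def by (intro continuous_intros) auto

lemma tri_id: "0 \<le> t \<Longrightarrow> t \<le> 1 \<Longrightarrow> tri t = t"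
  unfolding tri_def by (subst arccos_cos) (auto simp: mult_left_le)

lemma tri_periodic: "tri (t + 2 * of_int m) = tri t"
proof -
  have "cos (pi * (t + 2 * of_int m)) = cos (pi * t + 2 * pi * of_int m)"
    by (simp add: algebra_simps)
  also have "\<dots> = cos (pi * t)"
    by (simp add: cos_add)
  finally show ?thesis by (simp add: tri_def)
qed

text \<open>Here \<open>tri\<close> is the triangle wave of period 2, and \<open>plateau\<close> is
  0 where \<open>tri\<close> is at most 1/3 and 1 where it is at least 2/3. On the Cantor set it
  detects whether the first ternary digit is 0 or 2, and \<open>plateau (3 ^ j * t)\<close> does the
  same for the digit in position j.\<close>

definition plateau :: "real \<Rightarrow> real" where
  "plateau t = max 0 (min 1 (3 * tri t - 1))"

lemma continuous_on_plateau [continuous_intros]: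
  fixes g :: "'a :: t2_space \<Rightarrow> real"
  shows "continuous_on A g \<Longrightarrow> continuous_on A (\<lambda>x. plateau (g x))"
  unfolding plateau_def by (intro continuous_intros)

lemma plateau_bounds: "0 \<le> plateau t" "plateau t \<le> 1"
  by (auto simp: plateau_def)

lemma plateau_periodic: "plateau (t + 2 * of_int m) = plateau t"
  by (simp add: plateau_def tri_periodic)

text \<open>The parameter \<open>b\<close> selects the digits of \<open>t\<close> in even positions
  (0) or odd positions (1), which are reread as the binary digits of one coordinate. A single number
  thus carries two coordinates.\<close>

definition schoenberg :: "nat \<Rightarrow> real \<Rightarrow> real" where
  "schoenberg b t = (\<Sum>k. plateau (3 ^ (2 * k + b) * t) / 2 ^ Suc k)"

lemma continuous_on_schoenberg: "continuous_on UNIV (schoenberg b)"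
proof -
  have "uniform_limit UNIV (\<lambda>n t. \<Sum>k<n. plateau (3 ^ (2 * k + b) * t) / 2 ^ Suc k)
          (\<lambda>t. \<Sum>k. plateau (3 ^ (2 * k + b) * t) / 2 ^ Suc k) sequentially"
  proof (rule Weierstrass_m_test[where M = "\<lambda>k. (1/2) ^ Suc k"])
    show "norm (plateau (3 ^ (2 * n + b) * x) / 2 ^ Suc n) \<le> (1/2) ^ Suc n" for n x
      using plateau_bounds by (auto simp: field_simps power_divide)
    show "summable (\<lambda>k. (1 / 2 :: real) ^ Suc k)"
      by (subst summable_Suc_iff) (simp add: summable_geometric)
  qed
  then have "continuous_on UNIV (\<lambda>t. \<Sum>k. plateau (3 ^ (2 * k + b) * t) / 2 ^ Suc k)"
    by (rule uniform_limit_theorem[rotated]) (auto intro!: always_eventually continuous_intros)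
  then show ?thesis
    unfolding schoenberg_def[abs_def] .
qed

lemma schoenberg_periodic: "schoenberg b (t + 2 * of_int m) = schoenberg b t"
proof -
  have "plateau (3 ^ (2 * k + b) * (t + 2 * of_int m)) = plateau (3 ^ (2 * k + b) * t)" for k
    using plateau_periodic[of "3 ^ (2 * k + b) * t" "3 ^ (2 * k + b) * m"]
    by (simp add: algebra_simps)
  then show ?thesis by (simp add: schoenberg_def)
qed

text \<open>The point has ternary digits 0 and 2. The integer part of 3^j t is then even, hence
  invisible to functions of period 2, and the leading digit of the remainder \<open>T j\<close> puts
  it in the lower or the upper third of the unit interval, where \<open>plateau\<close> is
  constant.\<close>

lemma ternary_point_plateau:
  fixes a :: "nat \<Rightarrow> bool"
  shows "\<exists>t. 0 \<le> t \<and> t \<le> 1 \<and> (\<forall>j. plateau (3 ^ j * t) = of_bool (a j))"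
proof -
  define T where "T j = (\<Sum>i. 2 * of_bool (a (i + j)) / 3 ^ Suc i :: real)" for j
  have s0: "(\<lambda>i. 2 / 3 ^ Suc i :: real) sums 1"
    using sums_mult[OF geometric_sums[of "1/3 :: real"], of "2/3"]
    by (simp add: power_divide)
  have sm: "summable (\<lambda>i. 2 * of_bool (a (i + j)) / 3 ^ Suc i :: real)" for j
    by (rule summable_comparison_test'[OF sums_summable[OF s0], of 0]) auto
  have T0: "0 \<le> T j" for j
    unfolding T_def by (rule suminf_nonneg[OF sm]) auto
  have T1: "T j \<le> 1" for j
    unfolding T_def sums_unique[OF s0] by (rule suminf_le[OF _ sm sums_summable[OF s0]]) auto
  have step: "3 * T j = 2 * of_bool (a j) + T (Suc j)" for j
  proof -
    have "T j = 2 * of_bool (a j) / 3 + (\<Sum>i. 2 * of_bool (a (Suc i + j)) / 3 ^ Suc (Suc i))"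
      unfolding T_def using suminf_split_head[OF sm[of j]] by simp
    also have "(\<Sum>i. 2 * of_bool (a (Suc i + j)) / 3 ^ Suc (Suc i)) = T (Suc j) / 3"
      unfolding T_def using suminf_divide[OF sm[of "Suc j"], of 3] by (simp add: mult.commute mult.left_commute)
    finally show ?thesis by simp
  qed
  have "\<exists>m::int. 3 ^ j * T 0 = T j + 2 * of_int m" for j
  proof (induction j)
    case 0
    show ?case by (rule exI[of _ 0]) simp
  next
    case (Suc j)
    then obtain m :: int where "3 ^ j * T 0 = T j + 2 * of_int m" by blast
    then have "3 ^ Suc j * T 0 = T (Suc j) + 2 * of_int (of_bool (a j) + 3 * m)"
      using step[of j] by (simp add: algebra_simps)
    then show ?case by blast
  qed
  then have "tri (3 ^ j * T 0) = T j" for j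
    using tri_periodic tri_id[OF T0 T1, of j] by metis
  then have "plateau (3 ^ j * T 0) = of_bool (a j)" for j
    unfolding plateau_def using step[of j] T0[of "Suc j"] T1[of "Suc j"] by (cases "a j") auto
  then show ?thesis using T0 T1 by blast
qed

text \<open>The digits are differences of consecutive rounded values, so the partial sums telescope
  to floor (2^n x) / 2^n. The bound \<open>x < 1\<close> makes the initial floor vanish.\<close>

lemma binary_expansion:
  fixes x :: real
  assumes "0 \<le> x" "x < 1"
  shows "\<exists>a :: nat \<Rightarrow> bool. (\<lambda>k. of_bool (a k) / 2 ^ Suc k) sums x"
proof -
  define d where "d k = \<lfloor>2 ^ Suc k * x\<rfloor> - 2 * \<lfloor>2 ^ k * x\<rfloor>" for k
  have "d k = 0 \<or> d k = 1" for k
    unfolding d_def power_Suc by linarith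
  then have d: "of_bool (d k = 1) = (of_int (d k) :: real)" for k
    by (metis of_bool_eq of_int_0 of_int_1 zero_neq_one)
  have part: "(\<Sum>k<n. of_int (d k) / 2 ^ Suc k) = of_int \<lfloor>2 ^ n * x\<rfloor> / (2 ^ n :: real)" for n
  proof (induction n)
    case 0
    have "\<lfloor>x\<rfloor> = 0" using assms by linarith
    then show ?case by simp
  next
    case (Suc n)
    then show ?case by (simp add: d_def field_simps)
  qed
  have "(\<lambda>n. of_int \<lfloor>2 ^ n * x\<rfloor> / (2 ^ n :: real)) \<longlonglongrightarrow> x"
  proof (rule tendsto_sandwich[of "\<lambda>n. x - 1 / 2 ^ n" _ _ "\<lambda>n. x"])
    show "\<forall>\<^sub>F n in sequentially. x - 1 / 2 ^ n \<le> of_int \<lfloor>2 ^ n * x\<rfloor> / (2 ^ n :: real)"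
    proof (rule always_eventually, rule allI)
      fix n :: nat
      have "2 ^ n * x - 1 \<le> of_int \<lfloor>2 ^ n * x\<rfloor>" by linarith
      then have "(2 ^ n * x - 1) / 2 ^ n \<le> of_int \<lfloor>2 ^ n * x\<rfloor> / (2 ^ n :: real)"
        by (intro divide_right_mono) auto
      then show "x - 1 / 2 ^ n \<le> of_int \<lfloor>2 ^ n * x\<rfloor> / (2 ^ n :: real)"
        by (simp add: diff_divide_distrib)
    qed
    show "\<forall>\<^sub>F n in sequentially. of_int \<lfloor>2 ^ n * x\<rfloor> / (2 ^ n :: real) \<le> x"
    proof (rule always_eventually, rule allI)
      fix n :: nat
      have "of_int \<lfloor>2 ^ n * x\<rfloor> \<le> 2 ^ n * x" by linarith
      then show "of_int \<lfloor>2 ^ n * x\<rfloor> / (2 ^ n :: real) \<le> x" by (simp add: field_simps)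
    qed
    have "(\<lambda>n. x - 1 / 2 ^ n) \<longlonglongrightarrow> x - 0"
      by (intro tendsto_intros LIMSEQ_divide_realpow_zero) auto
    then show "(\<lambda>n. x - 1 / 2 ^ n) \<longlonglongrightarrow> x" by simp
  qed simp
  then show ?thesis
    unfolding sums_def by (intro exI[of _ "\<lambda>k. d k = 1"]) (simp only: d part)
qed

lemma schoenberg_surj:
  assumes "0 \<le> x" "x < 1" "0 \<le> y" "y < 1"
  shows "\<exists>t. 0 \<le> t \<and> t \<le> 1 \<and> schoenberg 0 t = x \<and> schoenberg 1 t = y"
proof -
  obtain a b :: "nat \<Rightarrow> bool" where a: "(\<lambda>k. of_bool (a k) / 2 ^ Suc k) sums x"
    and b: "(\<lambda>k. of_bool (b k) / 2 ^ Suc k) sums y"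
    using binary_expansion assms by metis
  obtain t where t: "0 \<le> t" "t \<le> 1"
    and p: "\<And>j. plateau (3 ^ j * t) = of_bool (if even j then a (j div 2) else b (j div 2))"
    using ternary_point_plateau[of "\<lambda>j. if even j then a (j div 2) else b (j div 2)"] by blast
  have "schoenberg 0 t = x" "schoenberg 1 t = y"
    unfolding schoenberg_def p using sums_unique[OF a] sums_unique[OF b] by auto
  then show ?thesis using t by blast
qed

text \<open>A right inverse of at most linear growth carries tightness from the plane to the line.
  It is chosen pointwise, with no measurability claimed, because it is applied only to measures of
  type \<open>pmf\<close>, for which every function is measurable.\<close>

lemma plane_filling_curve:
  "\<exists>(c :: real \<Rightarrow> complex) s. continuous_on UNIV c \<and>
     (\<forall>w. c (s w) = w \<and> 0 \<le> s w \<and> s w \<le> cmod w + 7)"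
proof -
  define c where "c t = of_real (t - tri t) * Complex (2 * schoenberg 0 t - 1) (2 * schoenberg 1 t - 1)" for t
  have "continuous_on UNIV c"
    unfolding c_def complex_eq
    by (intro continuous_intros continuous_on_schoenberg)
  moreover have "\<exists>t. c t = w \<and> 0 \<le> t \<and> t \<le> cmod w + 7" for w
  proof -
    \<comment> \<open>\<open>t - tri t\<close> is constantly \<open>2 m\<close> on the interval from \<open>2 m\<close> to \<open>2 m + 1\<close>, on which the curve fills a square.\<close>
    define m where "m = \<lceil>cmod w / 2\<rceil> + 1"
    have m: "cmod w < 2 * of_int m" "2 * of_int m \<le> cmod w + 6" "0 < (of_int m :: real)"
      unfolding m_def of_int_add of_int_1 using norm_ge_zero[of w]
        ceiling_correct[of "cmod w / 2", THEN conjunct1] ceiling_correct[of "cmod w / 2", THEN conjunct2]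
      by argo+
    define x where "x = (Re w / (2 * of_int m) + 1) / 2"
    define y where "y = (Im w / (2 * of_int m) + 1) / 2"
    have "\<bar>Re w\<bar> < 2 * of_int m" "\<bar>Im w\<bar> < 2 * of_int m"
      using m(1) abs_Re_le_cmod[of w] abs_Im_le_cmod[of w] by linarith+
    then have "0 \<le> x" "x < 1" "0 \<le> y" "y < 1"
      using m unfolding x_def y_def by (auto simp: field_simps)
    then obtain t where t: "0 \<le> t" "t \<le> 1" "schoenberg 0 t = x" "schoenberg 1 t = y"
      using schoenberg_surj by metis
    have "c (t + 2 * of_int m) = w"
      unfolding c_def schoenberg_periodic tri_periodic tri_id[OF t(1,2)] t(3,4)
      using m(3) by (simp add: x_def y_def complex_eq_iff field_simps)
    moreover have "0 \<le> t + 2 * of_int m" "t + 2 * of_int m \<le> cmod w + 7"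
      using t m by auto
    ultimately show ?thesis by blast
  qed
  ultimately show ?thesis by metis
qed

text \<open>The measures are lifted along the right inverse \<open>l\<close> of the curve
  \<open>c\<close>. Because \<open>c (l w) = w\<close>, integrating \<open>g (c t)\<close> against a
  lift is integrating \<open>g\<close> against the original measure, so the limit in the plane is
  the image under \<open>c\<close> of the limit on the line.\<close>

lemma tight_pmf_convergent_subsequence:
  fixes N :: "nat \<Rightarrow> complex pmf"
  assumes tight: "\<And>\<epsilon>. \<epsilon> > 0 \<Longrightarrow> \<exists>R. \<forall>n. measure_pmf.prob (N n) {w. cmod w > R} \<le> \<epsilon>"
    and s: "strict_mono (s :: nat \<Rightarrow> nat)"
  shows "\<exists>r \<nu>. strict_mono r \<and> prob_space \<nu> \<and> sets \<nu> = sets borel \<and>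
     (\<forall>g :: complex \<Rightarrow> real. continuous_on UNIV g \<longrightarrow> bounded (range g) \<longrightarrow>
        (\<lambda>n. measure_pmf.expectation (N (s (r n))) g) \<longlonglongrightarrow> (LINT w|\<nu>. g w))"
proof -
  obtain c :: "real \<Rightarrow> complex" and l where c: "continuous_on UNIV c"
    and l: "\<And>w. c (l w) = w" "\<And>w. 0 \<le> l w" "\<And>w. l w \<le> cmod w + 7"
    using plane_filling_curve by metis
  have [measurable]: "c \<in> borel_measurable borel"
    by (rule borel_measurable_continuous_onI[OF c])
  define \<mu> where "\<mu> n = distr (measure_pmf (N n)) borel l" for n
  have rd: "real_distribution (\<mu> n)" for n
    unfolding \<mu>_def real_distribution_def real_distribution_axioms_def
    by (auto intro!: prob_space.prob_space_distr measure_pmf.prob_space_axioms)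
  have "tight \<mu>"
    unfolding tight_def
  proof (intro conjI allI impI rd)
    fix \<epsilon> :: real assume "0 < \<epsilon>"
    then obtain R where R: "measure_pmf.prob (N n) {w. cmod w > R} \<le> \<epsilon> / 2" for n
      using tight[of "\<epsilon> / 2"] by auto
    \<comment> \<open>The interval excludes its left endpoint, so it starts at -1 in order to
      contain the possible value 0 of \<open>l\<close>.\<close>
    have "1 - \<epsilon> < measure (\<mu> n) {-1<..max 0 R + 7}" for n
    proof -
      have "measure_pmf.prob (N n) {w. cmod w > R} = 1 - measure_pmf.prob (N n) {w. cmod w \<le> R}"
        using measure_pmf.prob_compl[of "{w. cmod w \<le> R}" "N n"]
        by (auto simp: Collect_neg_eq[symmetric] Compl_eq_Diff_UNIV[symmetric] not_le)
      then have "1 - \<epsilon> < measure_pmf.prob (N n) {w. cmod w \<le> R}"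
        using R[of n] \<open>0 < \<epsilon>\<close> by linarith
      also have "\<dots> \<le> measure_pmf.prob (N n) (l -` {-1<..max 0 R + 7})"
      proof (rule measure_pmf.finite_measure_mono)
        show "{w. cmod w \<le> R} \<subseteq> l -` {-1<..max 0 R + 7}"
        proof
          fix w assume "w \<in> {w. cmod w \<le> R}"
          then show "w \<in> l -` {-1<..max 0 R + 7}" using l(2,3)[of w] by auto
        qed
      qed simp
      also have "\<dots> = measure (\<mu> n) {-1<..max 0 R + 7}"
        unfolding \<mu>_def by (subst measure_distr) auto
      finally show ?thesis .
    qed
    then show "\<exists>a b. a < b \<and> (\<forall>n. 1 - \<epsilon> < measure (\<mu> n) {a<..b})"
      by (intro exI[of _ "-1"] exI[of _ "max 0 R + 7"]) auto
  qed
  then obtain r M where r: "strict_mono (r :: nat \<Rightarrow> nat)" and M: "real_distribution M"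
    and wc: "weak_conv_m (\<mu> \<circ> s \<circ> r) M"
    using tight_imp_convergent_subsubsequence[OF _ s] by blast
  interpret M: real_distribution M by fact
  have cM [measurable]: "c \<in> borel_measurable M"
    by (metis \<open>c \<in> borel_measurable borel\<close> M.events_eq_borel measurable_cong_sets)
  have "(\<lambda>n. measure_pmf.expectation (N (s (r n))) g) \<longlonglongrightarrow> (LINT w|distr M borel c. g w)"
    if g: "continuous_on UNIV g" "bounded (range g)" for g :: "complex \<Rightarrow> real"
  proof -
    have [measurable]: "g \<in> borel_measurable borel"
      by (rule borel_measurable_continuous_onI[OF g(1)])
    obtain B where B: "\<And>x. norm (g x) \<le> B"
      using g(2) unfolding bounded_iff by auto
    have rdn: "real_distribution ((\<mu> \<circ> s \<circ> r) n)" for n by (simp add: rd)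
    have "continuous_on UNIV (\<lambda>t. g (c t))"
      using continuous_on_compose2[OF g(1) c] by auto
    then have "(\<lambda>n. LINT t|(\<mu> \<circ> s \<circ> r) n. g (c t)) \<longlonglongrightarrow> (LINT t|M. g (c t))"
      by (intro weak_conv_imp_integral_bdd_continuous_conv[OF rdn M wc, where B = B])
         (auto simp: continuous_on_eq_continuous_at B[unfolded real_norm_def])
    also have "(\<lambda>n. LINT t|(\<mu> \<circ> s \<circ> r) n. g (c t)) = (\<lambda>n. measure_pmf.expectation (N (s (r n))) g)"
      unfolding \<mu>_def comp_def by (subst integral_distr) (auto simp: l(1))
    also have "(LINT t|M. g (c t)) = (LINT w|distr M borel c. g w)"
      by (subst integral_distr) auto
    finally show ?thesis .
  qed
  moreover have "prob_space (distr M borel c)"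
    by (intro M.prob_space_distr) measurable
  ultimately show ?thesis using r by (intro exI[of _ r] exI[of _ "distr M borel c"]) auto
qed

section \<open>Truncated logarithmic potentials of zeros\<close>

text \<open>Subtracting \<open>ln (max 1 (cmod w))\<close> cancels the growth at infinity, which
  leaves a bounded continuous function of \<open>w\<close>: an admissible test function for weak
  limits. The subtracted terms are collected in \<open>log_size\<close>.\<close>

definition log_kernel :: "real \<Rightarrow> complex \<Rightarrow> complex \<Rightarrow> real" where
  "log_kernel s z w = ln (max s (cmod (z - w))) - ln (max 1 (cmod w))"

lemma continuous_on_log_kernel: "s > 0 \<Longrightarrow> continuous_on UNIV (log_kernel s z)"
  unfolding log_kernel_def[abs_def] by (intro continuous_intros) (auto simp: max_def)

lemma log_kernel_le:
  assumes "s > 0"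
  shows "log_kernel s z w \<le> ln (max s 1 + cmod z)"
proof -
  have "cmod (z - w) \<le> cmod z * 1 + cmod w" using norm_triangle_ineq4[of z w] by simp
  also have "\<dots> \<le> cmod z * max 1 (cmod w) + max s 1 * max 1 (cmod w)"
  proof (intro add_mono mult_left_mono)
    have "1 * cmod w \<le> max s 1 * max 1 (cmod w)" by (intro mult_mono) auto
    then show "cmod w \<le> max s 1 * max 1 (cmod w)" by simp
  qed auto
  finally have 1: "cmod (z - w) \<le> (max s 1 + cmod z) * max 1 (cmod w)"
    by (simp only: distrib_right add.commute)
  have "s * 1 \<le> (max s 1 + cmod z) * max 1 (cmod w)"
    using assms by (intro mult_mono add_increasing2) auto
  with 1 have "max s (cmod (z - w)) \<le> (max s 1 + cmod z) * max 1 (cmod w)" by simp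
  then have "ln (max s (cmod (z - w))) \<le> ln ((max s 1 + cmod z) * max 1 (cmod w))"
    using assms by (subst ln_le_cancel_iff) (auto simp: max_def intro!: mult_pos_pos add_pos_nonneg)
  also have "\<dots> = ln (max s 1 + cmod z) + ln (max 1 (cmod w))"
    by (intro ln_mult_pos) (auto simp: max_def intro!: add_pos_nonneg)
  finally show ?thesis by (simp add: log_kernel_def)
qed

lemma log_kernel_ge:
  assumes "s > 0"
  shows "- ln ((cmod z + 1) / s + 1) \<le> log_kernel s z w"
proof -
  let ?m = "max s (cmod (z - w))"
  have m: "?m \<ge> s" "?m > 0" using assms by auto
  have a: "cmod z + 1 \<le> (cmod z + 1) / s * ?m"
    using mult_left_mono[OF m(1), of "(cmod z + 1) / s"] assms by simp
  have "cmod w \<le> cmod z + cmod (z - w)" using norm_triangle_ineq4[of z "z - w"] by simp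
  then have "max 1 (cmod w) \<le> (cmod z + 1) + ?m" using m assms by auto
  also have "\<dots> \<le> ((cmod z + 1) / s + 1) * ?m" using a by (simp only: distrib_right)
  finally have "ln (max 1 (cmod w)) \<le> ln (((cmod z + 1) / s + 1) * ?m)"
    using m assms by (subst ln_le_cancel_iff) (auto simp: max_def intro!: mult_pos_pos add_nonneg_pos divide_nonneg_pos)
  also have "\<dots> = ln ((cmod z + 1) / s + 1) + ln ?m"
    using m assms by (intro ln_mult_pos) (auto intro!: add_nonneg_pos divide_nonneg_pos)
  finally show ?thesis by (simp add: log_kernel_def)
qed

lemma bounded_log_kernel: "s > 0 \<Longrightarrow> bounded (range (log_kernel s z))"
  unfolding bounded_iff
  using log_kernel_le[of s z] log_kernel_ge[of s z]
  by (intro exI[of _ "\<bar>ln (max s 1 + cmod z)\<bar> + \<bar>ln ((cmod z + 1) / s + 1)\<bar>"]) (smt (verit) rangeE real_norm_def)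

lemma abs_ln_diff_le:
  fixes a b s :: real
  assumes "s > 0" "a \<ge> s" "b \<ge> s"
  shows "\<bar>ln a - ln b\<bar> \<le> \<bar>a - b\<bar> / s"
proof -
  have *: "ln x - ln y \<le> \<bar>x - y\<bar> / s" if "x \<ge> s" "y \<ge> s" for x y
  proof -
    have "ln x - ln y = ln (x / y)" using that assms by (simp add: ln_div)
    also have "\<dots> \<le> x / y - 1" using that assms by (intro ln_le_minus_one) auto
    also have "\<dots> = (x - y) / y" using that assms by (simp add: field_simps)
    also have "\<dots> \<le> \<bar>x - y\<bar> / s" using that assms by (intro frac_le) auto
    finally show ?thesis .
  qed
  show ?thesis using *[of a b] *[of b a] assms by (simp add: abs_le_iff abs_minus_commute)
qed

text \<open>The constant 1/s is independent of \<open>w\<close>, so the estimate survives averaging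
  over any distribution of zeros. It serves to transfer a lower bound from a nearby point to the
  intended one.\<close>

lemma log_kernel_lipschitz:
  assumes "s > 0"
  shows "\<bar>log_kernel s z w - log_kernel s z' w\<bar> \<le> dist z z' / s"
proof -
  have "\<bar>log_kernel s z w - log_kernel s z' w\<bar> \<le> \<bar>max s (cmod (z - w)) - max s (cmod (z' - w))\<bar> / s"
    unfolding log_kernel_def using abs_ln_diff_le[OF assms, of "max s (cmod (z - w))" "max s (cmod (z' - w))"] by simp
  also have "\<dots> \<le> dist z z' / s"
  proof (rule divide_right_mono)
    have "\<bar>cmod (z - w) - cmod (z' - w)\<bar> \<le> dist z z'"
      using norm_triangle_ineq3[of "z - w" "z' - w"] by (simp add: dist_norm)
    then show "\<bar>max s (cmod (z - w)) - max s (cmod (z' - w))\<bar> \<le> dist z z'" by (auto simp: max_def)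
  qed (use assms in auto)
  finally show ?thesis .
qed

text \<open>Reflecting the zeros inside the circle does not change the modulus on the circle, and the value at
  the centre becomes \<open>C \<Prod> max s \<bar>z - w\<^sub>i\<bar>\<close>; this replaces Jensen's formula.\<close>

lemma prod_max_le_sup_circle:
  fixes w :: "'i \<Rightarrow> complex"
  assumes "s > 0" "C \<ge> 0"
    and B: "\<And>x. dist z x = s \<Longrightarrow> C * (\<Prod>i\<in>I. cmod (x - w i)) \<le> B"
  shows "C * (\<Prod>i\<in>I. max s (cmod (z - w i))) \<le> B"
proof -
  define q where "q x = of_real C * (\<Prod>i\<in>I. if cmod (z - w i) < s
      then of_real s - cnj (w i - z) * (x - z) / of_real s else x - w i)" for x
  have hol: "q holomorphic_on A" for A
    unfolding q_def
  proof (intro holomorphic_intros)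
    show "(\<lambda>x. if cmod (z - w i) < s then of_real s - cnj (w i - z) * (x - z) / of_real s else x - w i) holomorphic_on A" for i
      using assms(1) by (cases "cmod (z - w i) < s") (auto intro!: holomorphic_intros)
  qed
  have "norm (q z) \<le> B"
  proof (rule maximum_modulus_frontier[where S = "cball z s" and f = q])
    show "q holomorphic_on interior (cball z s)" by (rule hol)
    show "continuous_on (closure (cball z s)) q" by (rule holomorphic_on_imp_continuous_on[OF hol])
    fix x assume "x \<in> frontier (cball z s)"
    then have x: "dist z x = s" using assms(1) by (simp add: frontier_cball)
    have refl: "cmod (of_real s - cnj (w i - z) * (x - z) / of_real s) = cmod (x - w i)" for i
    proof -
      define u where "u = x - z"
      define a where "a = w i - z"
      have u: "cmod u = s" using x by (simp add: u_def dist_norm norm_minus_commute)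
      then have uu: "u * cnj u = of_real s * of_real s"
        using complex_norm_square[of u] by (simp add: power2_eq_square)
      have "cmod (of_real s - cnj a * u / of_real s) = cmod (cnj (of_real s - cnj a * u / of_real s))"
        by (rule complex_mod_cnj[symmetric])
      also have "\<dots> = cmod (of_real s - a * cnj u / of_real s)" by simp
      also have "\<dots> = cmod u / s * cmod (of_real s - a * cnj u / of_real s)" using u assms(1) by simp
      also have "\<dots> = cmod (u / of_real s * (of_real s - a * cnj u / of_real s))"
        using assms(1) by (simp add: norm_mult norm_divide)
      also have "u / of_real s * (of_real s - a * cnj u / of_real s) = u - a * (u * cnj u) / (of_real s * of_real s)"
        using assms(1) by (simp add: field_simps)
      also have "\<dots> = u - a" unfolding uu using assms(1) by simp
      finally show ?thesis by (simp add: u_def a_def)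
    qed
    have "norm (q x) = C * (\<Prod>i\<in>I. cmod (x - w i))"
      unfolding q_def norm_mult prod_norm[symmetric]
      using assms(2) refl by (auto intro!: prod.cong arg_cong2[where f = "(*)"])
    then show "norm (q x) \<le> B" using B[OF x] by simp
  qed (use assms in auto)
  moreover have "norm (q z) = C * (\<Prod>i\<in>I. max s (cmod (z - w i)))"
    unfolding q_def norm_mult prod_norm[symmetric]
    using assms by (auto intro!: prod.cong arg_cong2[where f = "(*)"])
  ultimately show ?thesis by simp
qed

section \<open>Root distributions and Mahler measure\<close>

lemma sum_mset_multiplicity:
  fixes g :: "'a \<Rightarrow> real"
  shows "(\<Sum>x\<in>#A. g x) = (\<Sum>x\<in>set_mset A. real (count A x) * g x)"
proof (induction A)
  case (add x A)
  have "(\<Sum>y\<in>set_mset (add_mset x A). real (count (add_mset x A) y) * g y)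
      = (\<Sum>y\<in>insert x (set_mset A). real (count A y) * g y + (if y = x then g y else 0))"
    by (intro sum.cong) (auto simp: algebra_simps)
  also have "\<dots> = (\<Sum>y\<in>insert x (set_mset A). real (count A y) * g y) + g x"
    by (simp add: sum.distrib)
  also have "(\<Sum>y\<in>insert x (set_mset A). real (count A y) * g y) = (\<Sum>y\<in>set_mset A. real (count A y) * g y)"
    by (rule sum.mono_neutral_right) (auto simp: not_in_iff)
  finally show ?case using add by simp
qed simp

lemma proots_enumerate:
  fixes p :: "complex poly"
  obtains w where "proots p = image_mset w (mset_set {..<degree p})"
proof -
  obtain xs where xs: "mset xs = proots p"
    using ex_mset by blast
  then have len: "length xs = degree p"
    using size_proots_complex[of p] by (metis size_mset)
  have "proots p = mset (map ((!) xs) [0..<length xs])"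
    by (simp add: xs map_nth)
  also have "\<dots> = image_mset ((!) xs) (mset_set {..<degree p})"
    by (simp add: len mset_upt atLeast0LessThan)
  finally show ?thesis using that by blast
qed

text \<open>A constant polynomial receives a default point mass, since a \<open>pmf\<close> has
  total mass 1; the formula for expectations assumes positive degree.\<close>

definition root_pmf :: "complex poly \<Rightarrow> complex pmf" where
  "root_pmf p = (if degree p = 0 then return_pmf 0 else pmf_of_multiset (proots p))"

text \<open>The logarithm of the Mahler measure, divided by the degree. It restores what the
  normalisation of \<open>log_kernel\<close> at infinity removes.\<close>

definition log_size :: "complex poly \<Rightarrow> real" where
  "log_size p = (ln (cmod (lead_coeff p)) + (\<Sum>w\<in>#proots p. ln (max 1 (cmod w)))) / real (degree p)"

lemma expectation_root_pmf:
  fixes g :: "complex \<Rightarrow> real"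
  assumes "degree p > 0"
  shows "measure_pmf.expectation (root_pmf p) g = (\<Sum>w\<in>#proots p. g w) / real (degree p)"
proof -
  have ne: "proots p \<noteq> {#}" using assms size_proots_complex[of p] by auto
  have "measure_pmf.expectation (root_pmf p) g = (\<Sum>w\<in>set_mset (proots p). pmf (pmf_of_multiset (proots p)) w * g w)"
    using assms ne unfolding root_pmf_def
    by (subst integral_measure_pmf_real[where A = "set_mset (proots p)"]) (auto simp: set_pmf_of_multiset mult.commute)
  also have "\<dots> = (\<Sum>w\<in>set_mset (proots p). real (count (proots p) w) * g w) / real (degree p)"
    using ne by (simp add: pmf_of_multiset size_proots_complex sum_divide_distrib)
  also have "(\<Sum>w\<in>set_mset (proots p). real (count (proots p) w) * g w) = (\<Sum>w\<in>#proots p. g w)"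
    by (simp add: sum_mset_multiplicity)
  finally show ?thesis .
qed


lemma finite_set_root_pmf: "finite (set_pmf (root_pmf p))"
proof (cases "degree p = 0")
  case False
  then have "proots p \<noteq> {#}" using size_proots_complex[of p] by auto
  then show ?thesis using False by (simp add: root_pmf_def set_pmf_of_multiset)
qed (simp add: root_pmf_def)

lemma poly_eq_prod_roots:
  fixes p :: "complex poly"
  assumes "proots p = image_mset w (mset_set {..<degree p})"
  shows "poly p z = lead_coeff p * (\<Prod>i<degree p. z - w i)"
proof -
  have "poly p z = poly (smult (lead_coeff p) (\<Prod>x\<in>#proots p. [:-x, 1:])) z"
    by (simp only: complex_poly_decompose_multiset)
  also have "(\<Prod>x\<in>#proots p. [:-x, 1:]) = (\<Prod>i<degree p. [:- w i, 1:])"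
    unfolding assms prod_unfold_prod_mset by (simp add: image_mset.compositionality comp_def)
  finally show ?thesis by (simp add: poly_prod)
qed

lemma exp_log_size:
  assumes "p \<noteq> 0" and p: "degree p > 0" and w: "proots p = image_mset w (mset_set {..<degree p})" and s: "s > 0"
  shows "exp (real (degree p) * (log_size p + measure_pmf.expectation (root_pmf p) (log_kernel s z)))
       = cmod (lead_coeff p) * (\<Prod>i<degree p. max s (cmod (z - w i)))"
proof -
  have sw: "(\<Sum>x\<in>#proots p. g x) = (\<Sum>i<degree p. g (w i))" for g :: "complex \<Rightarrow> real"
    unfolding w sum_unfold_sum_mset by (simp add: image_mset.compositionality comp_def)
  have "real (degree p) * (log_size p + measure_pmf.expectation (root_pmf p) (log_kernel s z))
     = ln (cmod (lead_coeff p)) + (\<Sum>i<degree p. ln (max 1 (cmod (w i)))) + (\<Sum>i<degree p. log_kernel s z (w i))"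
    unfolding expectation_root_pmf[OF p] log_size_def sw using p by (simp add: field_simps)
  also have "\<dots> = ln (cmod (lead_coeff p)) + (\<Sum>i<degree p. ln (max s (cmod (z - w i))))"
    by (simp add: log_kernel_def sum_subtractf)
  also have "exp \<dots> = cmod (lead_coeff p) * (\<Prod>i<degree p. max s (cmod (z - w i)))"
    using assms by (simp add: exp_add exp_sum less_max_iff_disj)
  finally show ?thesis .
qed

lemma poly_le_exp_kernel:
  assumes "p \<noteq> 0" and p: "degree p > 0" and s: "s > 0"
  shows "cmod (poly p z) \<le> exp (real (degree p) * (log_size p + measure_pmf.expectation (root_pmf p) (log_kernel s z)))"
proof -
  obtain w where w: "proots p = image_mset w (mset_set {..<degree p})"
    by (rule proots_enumerate)
  show ?thesis
    unfolding exp_log_size[OF assms(1,2) w s] poly_eq_prod_roots[OF w] norm_mult prod_norm[symmetric]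
    by (intro mult_left_mono prod_mono) auto
qed

lemma exp_kernel_le_sup_circle:
  assumes "p \<noteq> 0" and p: "degree p > 0" and s: "s > 0"
    and B: "\<And>x. dist z x = s \<Longrightarrow> cmod (poly p x) \<le> exp (real (degree p) * t)"
  shows "log_size p + measure_pmf.expectation (root_pmf p) (log_kernel s z) \<le> t"
proof -
  obtain w where w: "proots p = image_mset w (mset_set {..<degree p})"
    by (rule proots_enumerate)
  have "exp (real (degree p) * (log_size p + measure_pmf.expectation (root_pmf p) (log_kernel s z))) \<le> exp (real (degree p) * t)"
    unfolding exp_log_size[OF assms(1,2) w s]
  proof (rule prod_max_le_sup_circle[OF s])
    show "cmod (lead_coeff p) * (\<Prod>i<degree p. cmod (x - w i)) \<le> exp (real (degree p) * t)" if "dist z x = s" for x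
      using B[OF that] unfolding poly_eq_prod_roots[OF w] norm_mult prod_norm[symmetric] .
  qed simp
  then show ?thesis using p by simp
qed

lemma integrable_bounded_pmf:
  fixes g :: "complex \<Rightarrow> real"
  assumes "bounded (range g)"
  shows "integrable (measure_pmf N) g"
proof -
  obtain B where "\<And>x. norm (g x) \<le> B" using assms unfolding bounded_iff by auto
  then show ?thesis by (intro measure_pmf.integrable_const_bound[of _ B]) auto
qed

lemma integrable_log_kernel_pmf: "s > 0 \<Longrightarrow> integrable (measure_pmf N) (log_kernel s z)"
  by (rule integrable_bounded_pmf[OF bounded_log_kernel])

lemma expectation_log_kernel_le:
  assumes "s > 0"
  shows "measure_pmf.expectation N (log_kernel s z) \<le> ln (max s 1 + cmod z)"
  by (rule measure_pmf.integral_le_const[OF integrable_log_kernel_pmf[OF assms]])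
     (simp add: log_kernel_le assms)

lemma expectation_log_kernel_lipschitz:
  assumes "s > 0"
  shows "measure_pmf.expectation N (log_kernel s z) \<le> measure_pmf.expectation N (log_kernel s z') + dist z z' / s"
proof -
  have "measure_pmf.expectation N (log_kernel s z) \<le> measure_pmf.expectation N (\<lambda>w. log_kernel s z' w + dist z z' / s)"
  proof (rule integral_mono)
    fix w show "log_kernel s z w \<le> log_kernel s z' w + dist z z' / s"
      using log_kernel_lipschitz[OF assms, of z w z'] by linarith
  qed (use integrable_log_kernel_pmf assms in auto)
  then show ?thesis using integrable_log_kernel_pmf[OF assms] by simp
qed

text \<open>Zeros of modulus greater than \<open>R\<^sup>2\<close> contribute at most 1 to \<open>log_kernel 1\<close> at distance \<open>R\<close>, against \<open>ln (R + 2)\<close> for the others, so the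
  growth of the potential from the unit disc to distance \<open>R\<close> forces most zeros to be in the disc of radius \<open>R\<^sup>2\<close>.\<close>

lemma log_kernel_le_tail:
  assumes R: "R \<ge> 2" and z: "cmod z \<le> R + 1"
  shows "log_kernel 1 z w \<le> ln (R + 2) - (ln (R + 2) - 1) * of_bool (cmod w > R\<^sup>2)"
proof (cases "cmod w > R\<^sup>2")
  case False
  have "log_kernel 1 z w \<le> ln (1 + cmod z)" using log_kernel_le[of 1 z w] by simp
  also have "\<dots> \<le> ln (R + 2)"
    using z R by (subst ln_le_cancel_iff) (auto intro: add_pos_nonneg)
  finally show ?thesis using False by simp
next
  case True
  have R2: "R * R \<ge> R + 1" using mult_right_mono[of 2 R R] R by linarith
  have w1: "cmod w \<ge> R + 1" "cmod w \<ge> 1" "cmod w > 0"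
    using True R2 R by (auto simp: power2_eq_square)
  \<comment> \<open>Since \<open>cmod z \<le> R + 1 \<le> cmod w\<close>, the kernel retains only ln
    2 after \<open>ln (cmod w)\<close> is subtracted.\<close>
  have "max 1 (cmod (z - w)) \<le> 2 * cmod w"
    using norm_triangle_ineq4[of z w] w1 z by auto
  then have "ln (max 1 (cmod (z - w))) \<le> ln (2 * cmod w)"
    using w1 by (subst ln_le_cancel_iff) auto
  also have "\<dots> = ln 2 + ln (cmod w)" using w1 by (intro ln_mult_pos) auto
  also have "ln 2 \<le> (1 :: real)" using ln_le_minus_one[of 2] by simp
  finally show ?thesis using True w1 by (simp add: log_kernel_def max_def)
qed

lemma prob_tail_le:
  assumes R: "R \<ge> 2" and z: "cmod z \<le> R + 1"
  shows "(ln (R + 2) - 1) * measure_pmf.prob N {w. cmod w > R\<^sup>2}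
     \<le> ln (R + 2) - measure_pmf.expectation N (log_kernel 1 z)"
proof -
  have "measure_pmf.expectation N (log_kernel 1 z)
     \<le> measure_pmf.expectation N (\<lambda>w. ln (R + 2) - (ln (R + 2) - 1) * indicator {w. cmod w > R\<^sup>2} w)"
  proof (rule integral_mono)
    show "integrable (measure_pmf N) (\<lambda>w. ln (R + 2) - (ln (R + 2) - 1) * indicator {w. cmod w > R\<^sup>2} w)"
      by (intro Bochner_Integration.integrable_diff integrable_mult_right) (auto simp: measure_pmf.emeasure_eq_measure)
    show "log_kernel 1 z w \<le> ln (R + 2) - (ln (R + 2) - 1) * indicator {w. cmod w > R\<^sup>2} w" for w
      using log_kernel_le_tail[OF R z, of w] by (simp add: indicator_def of_bool_def split: if_splits)
  qed (simp add: integrable_log_kernel_pmf)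
  also have "\<dots> = ln (R + 2) - (ln (R + 2) - 1) * measure_pmf.prob N {w. cmod w > R\<^sup>2}"
    by (subst Bochner_Integration.integral_diff) (auto simp: measure_pmf.emeasure_eq_measure)
  finally show ?thesis by linarith
qed

text \<open>Each of the finitely many exceptional measures has finite support, so a larger radius
  captures all of their mass.\<close>

lemma tight_if_eventually_tight:
  fixes N :: "nat \<Rightarrow> complex pmf"
  assumes fin: "\<And>n. finite (set_pmf (N n))"
    and ev: "\<forall>\<^sub>F n in sequentially. measure_pmf.prob (N n) {w. cmod w > R} \<le> \<epsilon>" and "\<epsilon> \<ge> 0"
  shows "\<exists>R. \<forall>n. measure_pmf.prob (N n) {w. cmod w > R} \<le> \<epsilon>"
proof -
  obtain n0 where n0: "\<And>n. n \<ge> n0 \<Longrightarrow> measure_pmf.prob (N n) {w. cmod w > R} \<le> \<epsilon>"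
    using ev unfolding eventually_sequentially by blast
  have "bounded (\<Union>n<n0. set_pmf (N n))"
    using fin by (intro finite_imp_bounded) auto
  then obtain R' where R': "\<And>n w. n < n0 \<Longrightarrow> w \<in> set_pmf (N n) \<Longrightarrow> cmod w \<le> R'"
    unfolding bounded_iff by blast
  have "measure_pmf.prob (N n) {w. cmod w > max R R'} \<le> \<epsilon>" for n
  proof (cases "n < n0")
    case True
    then have "measure_pmf.prob (N n) {w. cmod w > max R R'} = 0"
      using R'[of n] by (subst measure_pmf_zero_iff) fastforce
    then show ?thesis using assms(3) by simp
  next
    case False
    have "measure_pmf.prob (N n) {w. cmod w > max R R'} \<le> measure_pmf.prob (N n) {w. cmod w > R}"
      by (rule measure_pmf.finite_measure_mono) auto
    then show ?thesis using n0[of n] False by linarith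
  qed
  then show ?thesis by blast
qed

text \<open>The deterministic core. Degree exactly n makes normalisation by n and by the degree
  agree. The lower bound is asked for only at some point within \<open>\<epsilon>\<close> of
  \<open>z\<close>, which is all that the probabilistic argument provides.\<close>

locale log_potential_limit =
  fixes P :: "nat \<Rightarrow> complex poly" and V :: "complex \<Rightarrow> real"
  assumes P: "\<And>n. P n \<noteq> 0" "\<And>n. degree (P n) = n"
    and V_cont: "continuous_on UNIV V"
    and V_growth: "\<exists>R C. \<forall>z. cmod z \<ge> R \<longrightarrow> \<bar>V z - ln (cmod z)\<bar> \<le> C"
    and upper: "\<And>R \<epsilon>. \<epsilon> > 0 \<Longrightarrow>
        \<forall>\<^sub>F n in sequentially. \<forall>z. cmod z \<le> R \<longrightarrow> cmod (poly (P n) z) \<le> exp (real n * (V z + \<epsilon>))"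
    and lower: "\<And>z \<epsilon>. \<epsilon> > 0 \<Longrightarrow>
        \<forall>\<^sub>F n in sequentially. \<exists>x. dist x z < \<epsilon> \<and> cmod (poly (P n) x) \<ge> exp (real n * (V z - \<epsilon>))"
begin

lemma kernel_mean_le:
  assumes "s > 0" "\<epsilon> > 0" and T: "\<And>x. dist z x \<le> s \<Longrightarrow> V x \<le> T"
  shows "\<forall>\<^sub>F n in sequentially. log_size (P n) + measure_pmf.expectation (root_pmf (P n)) (log_kernel s z) \<le> T + \<epsilon>"
  using upper[OF assms(2), of "cmod z + s"] eventually_gt_at_top[of 0]
proof eventually_elim
  case (elim n)
  show ?case
  proof (rule exp_kernel_le_sup_circle[OF P(1)])
    show "0 < degree (P n)" using elim P by simp
    fix x assume x: "dist z x = s"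
    then have "cmod x \<le> cmod z + s"
      using norm_triangle_ineq4[of z "z - x"] by (simp add: dist_norm)
    then have "cmod (poly (P n) x) \<le> exp (real n * (V x + \<epsilon>))" using elim by auto
    also have "\<dots> \<le> exp (real n * (T + \<epsilon>))"
      using T[of x] x by (auto intro!: mult_left_mono)
    finally show "cmod (poly (P n) x) \<le> exp (real (degree (P n)) * (T + \<epsilon>))" by (simp add: P)
  qed fact
qed

lemma kernel_mean_ge:
  assumes "s > 0" "\<epsilon> > 0"
  shows "\<forall>\<^sub>F n in sequentially. \<exists>x. dist x z < \<epsilon> \<and>
    V z - \<epsilon> \<le> log_size (P n) + measure_pmf.expectation (root_pmf (P n)) (log_kernel s x)"
  using lower[OF assms(2), of z] eventually_gt_at_top[of 0]
proof eventually_elim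
  case (elim n)
  then obtain x where x: "dist x z < \<epsilon>" "exp (real n * (V z - \<epsilon>)) \<le> cmod (poly (P n) x)" by blast
  note x(2)
  also have "cmod (poly (P n) x) \<le> exp (real n * (log_size (P n) + measure_pmf.expectation (root_pmf (P n)) (log_kernel s x)))"
    using poly_le_exp_kernel[OF P(1), of n s x] elim assms by (simp add: P)
  finally show ?case using x(1) elim by auto
qed

text \<open>The kernel with z = 0 and s = 1 vanishes identically, so the upper bound for the
  truncated potential at 0 is a bound for \<open>log_size\<close> itself. For the other side, a
  point of the unit disc where the polynomial is large is used; there the kernel is at most ln
  2.\<close>

lemma log_size_bounded: "\<exists>A. \<forall>\<^sub>F n in sequentially. \<bar>log_size (P n)\<bar> \<le> A"
proof -
  have "compact (V ` cball 0 1)"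
    by (intro compact_continuous_image continuous_on_subset[OF V_cont]) auto
  then obtain T where T: "\<And>x. dist 0 x \<le> 1 \<Longrightarrow> V x \<le> T"
    using compact_imp_bounded bounded_iff by (metis abs_le_D1 imageI mem_cball real_norm_def)
  have "\<forall>\<^sub>F n in sequentially. log_size (P n) + measure_pmf.expectation (root_pmf (P n)) (log_kernel 1 0) \<le> T + 1"
    by (rule kernel_mean_le) (use T in auto)
  then have "\<forall>\<^sub>F n in sequentially. \<bar>log_size (P n)\<bar> \<le> \<bar>T + 1\<bar> + \<bar>V 0 - 1 - ln 2\<bar>"
    using kernel_mean_ge[of 1 1 0, simplified]
  proof eventually_elim
    case (elim n)
    have "log_kernel 1 0 = (\<lambda>w. 0)" by (simp add: log_kernel_def fun_eq_iff)
    then have 1: "log_size (P n) \<le> T + 1" using elim(1) by simp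
    obtain x where x: "cmod x < 1"
      "V 0 - 1 \<le> log_size (P n) + measure_pmf.expectation (root_pmf (P n)) (log_kernel 1 x)"
      using elim(2) by blast
    have "measure_pmf.expectation (root_pmf (P n)) (log_kernel 1 x) \<le> ln (1 + cmod x)"
      using expectation_log_kernel_le[of 1 "root_pmf (P n)" x] by simp
    also have "\<dots> \<le> ln 2" using x(1) by (subst ln_le_cancel_iff) (auto intro: add_pos_nonneg)
    finally show ?case using 1 x(2) by linarith
  qed
  then show ?thesis by blast
qed

lemma root_pmf_tight:
  assumes "\<epsilon> > 0"
  shows "\<exists>R. \<forall>\<^sub>F n in sequentially. measure_pmf.prob (root_pmf (P n)) {w. cmod w > R} \<le> \<epsilon>"
proof -
  obtain A where A: "\<forall>\<^sub>F n in sequentially. \<bar>log_size (P n)\<bar> \<le> A"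
    using log_size_bounded by blast
  \<comment> \<open>Since V at \<open>R\<close> is at least \<open>ln R - C\<close>, the mean of the
    kernel near \<open>R\<close> falls short of \<open>ln (R + 2)\<close> by at most
    \<open>A + C + 1 + (ln (R + 2) - ln R)\<close>, which stays bounded. The tail probability enters
    with the weight \<open>ln (R + 2) - 1\<close>, which tends to infinity.\<close>
  obtain R0 C where C: "\<And>z. cmod z \<ge> R0 \<Longrightarrow> \<bar>V z - ln (cmod z)\<bar> \<le> C"
    using V_growth by blast
  have "\<forall>\<^sub>F R in at_top. A + C + 1 + (ln (R + 2) - ln R) \<le> \<epsilon> * (ln (R + 2) - 1)"
    using assms by real_asymp
  moreover have "\<forall>\<^sub>F R in at_top. ln (R + 2) - 1 > (0 :: real)" by real_asymp
  ultimately have "\<forall>\<^sub>F R in at_top. A + C + 1 + (ln (R + 2) - ln R) \<le> \<epsilon> * (ln (R + 2) - 1)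
      \<and> ln (R + 2) - 1 > 0 \<and> R \<ge> max 2 R0"
    using eventually_ge_at_top[of "max 2 R0"] by (intro eventually_conj)
  then obtain R where R: "A + C + 1 + (ln (R + 2) - ln R) \<le> \<epsilon> * (ln (R + 2) - 1)"
      "ln (R + 2) - 1 > 0" "R \<ge> 2" "R \<ge> R0"
    unfolding eventually_at_top_linorder by (metis max.bounded_iff order_refl)
  have "\<forall>\<^sub>F n in sequentially. measure_pmf.prob (root_pmf (P n)) {w. cmod w > R\<^sup>2} \<le> \<epsilon>"
    using A kernel_mean_ge[of 1 1 "of_real R", OF zero_less_one zero_less_one]
  proof eventually_elim
    case (elim n)
    obtain x where x: "dist x (of_real R) < 1"
      "V (of_real R) - 1 \<le> log_size (P n) + measure_pmf.expectation (root_pmf (P n)) (log_kernel 1 x)"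
      using elim(2) by blast
    have "cmod x \<le> R + 1"
      using norm_triangle_sub[of x "of_real R"] x(1) R(3) by (simp add: dist_norm)
    then have "(ln (R + 2) - 1) * measure_pmf.prob (root_pmf (P n)) {w. cmod w > R\<^sup>2}
      \<le> ln (R + 2) - measure_pmf.expectation (root_pmf (P n)) (log_kernel 1 x)"
      using R(3) by (intro prob_tail_le)
    also have "\<dots> \<le> (ln (R + 2) - 1) * \<epsilon>"
      using x(2) elim(1) R C[of "of_real R"] by (simp add: mult.commute)
    finally show ?case using R(2) by simp
  qed
  then show ?thesis by blast
qed

lemma subsequential_limit:
  assumes s: "strict_mono (s :: nat \<Rightarrow> nat)"
  obtains r \<nu> c where "strict_mono (r :: nat \<Rightarrow> nat)" "prob_space \<nu>" "sets \<nu> = sets borel"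
    "\<And>g :: complex \<Rightarrow> real. continuous_on UNIV g \<Longrightarrow> bounded (range g) \<Longrightarrow>
       (\<lambda>n. measure_pmf.expectation (root_pmf (P (s (r n)))) g) \<longlonglongrightarrow> (LINT w|\<nu>. g w)"
    "\<And>t z. t > 0 \<Longrightarrow> V z \<le> c + (LINT w|\<nu>. log_kernel t z w)"
    "\<And>t z T. t > 0 \<Longrightarrow> (\<And>x. dist z x \<le> t \<Longrightarrow> V x \<le> T) \<Longrightarrow> c + (LINT w|\<nu>. log_kernel t z w) \<le> T"
proof -
  have "\<exists>R. \<forall>n. measure_pmf.prob (root_pmf (P n)) {w. cmod w > R} \<le> \<epsilon>" if "\<epsilon> > 0" for \<epsilon>
    using root_pmf_tight[OF that] tight_if_eventually_tight[OF finite_set_root_pmf] that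
    by (meson less_imp_le)
  from tight_pmf_convergent_subsequence[OF this s] obtain r \<nu> where r: "strict_mono r"
    and \<nu>: "prob_space \<nu>" "sets \<nu> = sets borel"
    and conv: "\<And>g :: complex \<Rightarrow> real. continuous_on UNIV g \<Longrightarrow> bounded (range g) \<Longrightarrow>
       (\<lambda>n. measure_pmf.expectation (root_pmf (P (s (r n)))) g) \<longlonglongrightarrow> (LINT w|\<nu>. g w)"
    by blast
  obtain A where A: "\<forall>\<^sub>F n in sequentially. \<bar>log_size (P n)\<bar> \<le> A"
    using log_size_bounded by blast
  \<comment> \<open>Clamping places every term in a compact interval, from which a limit
    \<open>c\<close> can be extracted; the clamp is inactive from some index on.\<close>
  define a where "a n = max (-A) (min A (log_size (P (s (r n)))))" for n
  have "A \<ge> 0"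
    using eventually_happens[OF A] by fastforce
  then have "\<forall>n. a n \<in> {-A..A}" by (auto simp: a_def)
  then obtain c q where q: "strict_mono q" and c: "(a \<circ> q) \<longlonglongrightarrow> c"
    using seq_compactE[OF compact_imp_seq_compact[OF compact_Icc]] by blast
  define k where "k n = s (r (q n))" for n
  have k: "strict_mono k"
    using strict_mono_o[OF s strict_mono_o[OF r q]] by (simp add: k_def[abs_def] comp_def)
  have kev: "\<forall>\<^sub>F n in sequentially. Q (k n)" if "\<forall>\<^sub>F n in sequentially. Q n" for Q
    using eventually_subseq[OF k that] .
  have "\<forall>\<^sub>F n in sequentially. (a \<circ> q) n = log_size (P (k n))"
    using kev[OF A] by eventually_elim (auto simp: a_def k_def)
  then have c: "(\<lambda>n. log_size (P (k n))) \<longlonglongrightarrow> c"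
    using c by (rule Lim_transform_eventually[rotated])
  have conv: "(\<lambda>n. measure_pmf.expectation (root_pmf (P (k n))) g) \<longlonglongrightarrow> (LINT w|\<nu>. g w)"
    if "continuous_on UNIV g" "bounded (range g)" for g :: "complex \<Rightarrow> real"
    using LIMSEQ_subseq_LIMSEQ[OF conv[OF that] q] by (simp add: comp_def k_def)
  have lim: "(\<lambda>n. log_size (P (k n)) + measure_pmf.expectation (root_pmf (P (k n))) (log_kernel t z))
      \<longlonglongrightarrow> c + (LINT w|\<nu>. log_kernel t z w)" if "t > 0" for t z
    by (intro tendsto_add c conv continuous_on_log_kernel bounded_log_kernel that)
  show ?thesis
  proof (rule that)
    show "strict_mono (\<lambda>n. r (q n))"
      using strict_mono_o[OF r q] by (simp add: comp_def)
    show "(\<lambda>n. measure_pmf.expectation (root_pmf (P (s (r (q n))))) g) \<longlonglongrightarrow> (LINT w|\<nu>. g w)"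
      if "continuous_on UNIV g" "bounded (range g)" for g :: "complex \<Rightarrow> real"
      using conv[OF that] by (simp add: k_def)
    show "c + (LINT w|\<nu>. log_kernel t z w) \<le> T" if t: "t > 0" and T: "\<And>x. dist z x \<le> t \<Longrightarrow> V x \<le> T" for t z T
    proof (rule field_le_epsilon)
      fix e :: real assume "e > 0"
      have "\<forall>\<^sub>F n in sequentially. log_size (P n) + measure_pmf.expectation (root_pmf (P n)) (log_kernel t z) \<le> T + e"
        by (rule kernel_mean_le) (use t T \<open>e > 0\<close> in auto)
      from tendsto_upperbound[OF lim[OF t] kev[OF this]]
      show "c + (LINT w|\<nu>. log_kernel t z w) \<le> T + e" by simp
    qed
    show "V z \<le> c + (LINT w|\<nu>. log_kernel t z w)" if t: "t > 0" for t z
    proof (rule field_le_epsilon)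
      fix e :: real assume "e > 0"
      \<comment> \<open>The two terms of the minimum make the loss at the moving point and the
        Lipschitz error of moving from it to \<open>z\<close> at most \<open>e / 2\<close>
        each.\<close>
      define e' where "e' = min (e / 2) (e / 2 * t)"
      have "e' > 0" using \<open>e > 0\<close> t by (simp add: e'_def)
      have "\<forall>\<^sub>F n in sequentially. V z - e \<le> log_size (P (k n)) + measure_pmf.expectation (root_pmf (P (k n))) (log_kernel t z)"
        using kev[OF kernel_mean_ge[OF t \<open>e' > 0\<close>, of z]]
      proof eventually_elim
        case (elim n)
        then obtain x where x: "dist x z < e'"
          "V z - e' \<le> log_size (P (k n)) + measure_pmf.expectation (root_pmf (P (k n))) (log_kernel t x)"
          by blast
        have "dist x z / t \<le> e / 2"
          using x(1) t by (simp add: e'_def field_simps)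
        moreover have "e' \<le> e / 2" by (simp add: e'_def)
        ultimately show ?case
          using x expectation_log_kernel_lipschitz[OF t, of "root_pmf (P (k n))" x z] by linarith
      qed
      then have "V z - e \<le> c + (LINT w|\<nu>. log_kernel t z w)"
        by (rule tendsto_lowerbound[OF lim[OF t]]) simp
      then show "V z \<le> c + (LINT w|\<nu>. log_kernel t z w) + e" by simp
    qed
  qed fact+
qed

end

section \<open>The Laplacian of a truncated potential\<close>

lemma measurable_Complex_pair [measurable]:
  "(\<lambda>(x, y). Complex x y) \<in> borel_measurable (lborel \<Otimes>\<^sub>M lborel)"
  unfolding Complex_eq by measurable

text \<open>Boxes of the plane are products of intervals, and they determine Lebesgue measure. The
  product form gives Fubini along the horizontal and vertical lines on which \<open>dx\<close> and
  \<open>dy\<close> act.\<close>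

lemma lborel_complex: "(lborel :: complex measure) = distr (lborel \<Otimes>\<^sub>M lborel) borel (\<lambda>(x, y). Complex x y)"
proof (rule lborel_eqI)
  fix l u :: complex
  assume le: "\<And>b. b \<in> Basis \<Longrightarrow> l \<bullet> b \<le> u \<bullet> b"
  then have le': "Re l \<le> Re u" "Im l \<le> Im u"
    using le[of 1] le[of \<i>] by (auto simp: Basis_complex_def)
  have "emeasure (distr (lborel \<Otimes>\<^sub>M lborel) borel (\<lambda>(x, y). Complex x y)) (box l u)
      = emeasure (lborel \<Otimes>\<^sub>M lborel) ({Re l<..<Re u} \<times> {Im l<..<Im u})"
    by (subst emeasure_distr)
       (auto intro!: arg_cong[where f = "emeasure (lborel \<Otimes>\<^sub>M lborel)"] simp: space_pair_measure in_box_complex_iff)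
  also have "\<dots> = emeasure lborel {Re l<..<Re u} * emeasure lborel {Im l<..<Im u}"
    by (rule lborel.emeasure_pair_measure_Times) auto
  also have "\<dots> = ennreal (\<Prod>b\<in>Basis. (u - l) \<bullet> b)"
    using le' by (simp add: ennreal_mult Basis_complex_def complex_eq_iff)
  finally show "emeasure (distr (lborel \<Otimes>\<^sub>M lborel) borel (\<lambda>(x, y). Complex x y)) (box l u)
      = ennreal (\<Prod>b\<in>Basis. (u - l) \<bullet> b)" .
qed simp

lemma integral_complex_iterated:
  fixes F :: "complex \<Rightarrow> real"
  assumes "integrable lborel F"
  shows "(LINT z|lborel. F z) = (LINT y|lborel. LINT x|lborel. F (Complex x y))"
    and "(LINT z|lborel. F z) = (LINT x|lborel. LINT y|lborel. F (Complex x y))"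
proof -
  have [measurable]: "F \<in> borel_measurable borel"
    using borel_measurable_integrable[OF assms] by simp
  have int: "integrable (lborel \<Otimes>\<^sub>M lborel) (\<lambda>(x, y). F (Complex x y))"
    using assms unfolding lborel_complex by (subst (asm) integrable_distr_eq) (auto simp: split_beta')
  have eq: "(LINT z|lborel. F z) = (LINT p|(lborel \<Otimes>\<^sub>M lborel). (\<lambda>(x, y). F (Complex x y)) p)"
    unfolding lborel_complex by (subst integral_distr) (auto simp: split_beta')
  show "(LINT z|lborel. F z) = (LINT x|lborel. LINT y|lborel. F (Complex x y))"
    unfolding eq using lborel_pair.integral_fst[OF int] by simp
  then show "(LINT z|lborel. F z) = (LINT y|lborel. LINT x|lborel. F (Complex x y))"
    using lborel_pair.Fubini_integral[of "\<lambda>x y. F (Complex x y)"] int by (simp add: split_beta')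
qed

lemma integrable_compact_support:
  fixes F :: "complex \<Rightarrow> real"
  assumes "continuous_on UNIV F" "\<And>z. cmod z > R \<Longrightarrow> F z = 0"
  shows "integrable lborel F"
proof -
  have "integrable lborel (\<lambda>z. indicator (cball 0 R) z *\<^sub>R F z)"
    by (rule borel_integrable_compact) (auto intro: continuous_on_subset[OF assms(1)])
  also have "(\<lambda>z. indicator (cball 0 R) z *\<^sub>R F z) = F"
    using assms(2) by (auto simp: fun_eq_iff indicator_def not_le)
  finally show ?thesis .
qed

lemma has_real_derivative_dx:
  assumes "g differentiable_on UNIV"
  shows "((\<lambda>t. g (Complex t y)) has_real_derivative dx g (Complex x y)) (at x)"
proof -
  have "(\<lambda>t. Complex t y) differentiable at x"
    unfolding Complex_eq by (auto intro!: derivative_intros)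
  moreover have "g differentiable at (Complex x y)"
    using assms by (simp add: differentiable_on_def)
  ultimately have "(\<lambda>t. g (Complex t y)) differentiable at x"
    using differentiable_chain_at[of "\<lambda>t. Complex t y" x g] by (simp add: comp_def)
  then show ?thesis
    unfolding dx_def by (simp add: DERIV_deriv_iff_real_differentiable)
qed

lemma has_real_derivative_dy:
  assumes "g differentiable_on UNIV"
  shows "((\<lambda>t. g (Complex x t)) has_real_derivative dy g (Complex x y)) (at y)"
proof -
  have "(\<lambda>t. Complex x t) differentiable at y"
    unfolding Complex_eq by (auto intro!: derivative_intros)
  moreover have "g differentiable at (Complex x y)"
    using assms by (simp add: differentiable_on_def)
  ultimately have "(\<lambda>t. g (Complex x t)) differentiable at y"
    using differentiable_chain_at[of "\<lambda>t. Complex x t" y g] by (simp add: comp_def)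
  then show ?thesis
    unfolding dy_def by (simp add: DERIV_deriv_iff_real_differentiable)
qed

lemma eventually_norm_Complex_gt:
  assumes "cmod z > R"
  shows "\<forall>\<^sub>F t in nhds (Re z). cmod (Complex t (Im z)) > R" "\<forall>\<^sub>F t in nhds (Im z). cmod (Complex (Re z) t) > R"
proof -
  have "isCont (\<lambda>t. cmod (Complex t (Im z))) (Re z)" "isCont (\<lambda>t. cmod (Complex (Re z) t)) (Im z)"
    unfolding Complex_eq by (intro continuous_intros)+
  then show "\<forall>\<^sub>F t in nhds (Re z). cmod (Complex t (Im z)) > R" "\<forall>\<^sub>F t in nhds (Im z). cmod (Complex (Re z) t) > R"
    using assms tendsto_at_iff_tendsto_nhds[of "\<lambda>t. cmod (Complex t (Im z))" "Re z"]
      tendsto_at_iff_tendsto_nhds[of "\<lambda>t. cmod (Complex (Re z) t)" "Im z"]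
    by (auto simp: isCont_def intro: order_tendstoD(1))
qed

lemma dx_support:
  assumes "\<And>z. cmod z > R \<Longrightarrow> g z = 0" "cmod z > R"
  shows "dx g z = 0" "dy g z = 0"
proof -
  have "deriv (\<lambda>t. g (Complex t (Im z))) (Re z) = deriv (\<lambda>t. 0) (Re z)"
    by (rule deriv_cong_ev) (use eventually_norm_Complex_gt(1)[OF assms(2)] in eventually_elim, simp_all add: assms(1))
  then show "dx g z = 0" by (simp add: dx_def)
  have "deriv (\<lambda>t. g (Complex (Re z) t)) (Im z) = deriv (\<lambda>t. 0) (Im z)"
    by (rule deriv_cong_ev) (use eventually_norm_Complex_gt(2)[OF assms(2)] in eventually_elim, simp_all add: assms(1))
  then show "dy g z = 0" by (simp add: dy_def)
qed

lemma test_function_facts: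
  assumes "test_function \<phi>"
  shows "\<phi> differentiable_on UNIV" "dx \<phi> differentiable_on UNIV" "dy \<phi> differentiable_on UNIV"
    "continuous_on UNIV \<phi>" "continuous_on UNIV (dx (dx \<phi>))" "continuous_on UNIV (dy (dy \<phi>))"
    "continuous_on UNIV (laplacian \<phi>)"
    "\<exists>R>0. \<forall>z. cmod z > R \<longrightarrow> \<phi> z = 0"
proof -
  have s: "(dx ^^ i) ((dy ^^ j) \<phi>) differentiable_on UNIV" for i j
    using assms unfolding test_function_def smooth_def by blast
  show d: "\<phi> differentiable_on UNIV" "dx \<phi> differentiable_on UNIV" "dy \<phi> differentiable_on UNIV"
    using s[of 0 0] s[of 1 0] s[of 0 1] by simp_all
  have "dx (dx \<phi>) differentiable_on UNIV" "dy (dy \<phi>) differentiable_on UNIV"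
    using s[of 2 0] s[of 0 2] by (simp_all add: numeral_2_eq_2)
  then show "continuous_on UNIV \<phi>" and c: "continuous_on UNIV (dx (dx \<phi>))" "continuous_on UNIV (dy (dy \<phi>))"
    using d by (auto intro: differentiable_imp_continuous_on)
  then show "continuous_on UNIV (laplacian \<phi>)"
    unfolding laplacian_def[abs_def] by (intro continuous_intros)
  have "bounded {z. \<phi> z \<noteq> 0}"
    using assms compact_imp_bounded bounded_subset closure_subset unfolding test_function_def by metis
  then obtain R where R: "R > 0" "\<And>z. \<phi> z \<noteq> 0 \<Longrightarrow> cmod z \<le> R"
    unfolding bounded_pos by blast
  then show "\<exists>R>0. \<forall>z. cmod z > R \<longrightarrow> \<phi> z = 0"
    by (metis not_le)
qed

text \<open>The integrand is the derivative of \<open>L x * g' x - L' x * g x\<close>, which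
  vanishes at both ends of an interval reaching strictly beyond the support.\<close>

lemma integral_Green_real:
  fixes g g' g'' L L' L'' :: "real \<Rightarrow> real"
  assumes g: "\<And>x. (g has_real_derivative g' x) (at x)" "\<And>x. (g' has_real_derivative g'' x) (at x)"
    and L: "\<And>x. (L has_real_derivative L' x) (at x)" "\<And>x. (L' has_real_derivative L'' x) (at x)"
    and cont: "continuous_on UNIV g''" "continuous_on UNIV L''"
    and supp: "\<And>x. \<bar>x\<bar> > R \<Longrightarrow> g x = 0" "\<And>x. \<bar>x\<bar> > R \<Longrightarrow> g' x = 0" "\<And>x. \<bar>x\<bar> > R \<Longrightarrow> g'' x = 0"
  shows "(LINT x|lborel. L x * g'' x - L'' x * g x) = 0"
proof -
  define S where "S = \<bar>R\<bar> + 1"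
  have "(LINT x|lborel. L x * g'' x - L'' x * g x)
      = (LINT x|lborel. (L x * g'' x - L'' x * g x) * indicator {-S..S} x)"
  proof (rule Bochner_Integration.integral_cong[OF refl])
    fix x
    show "L x * g'' x - L'' x * g x = (L x * g'' x - L'' x * g x) * indicator {-S..S} x"
      using supp(1,3)[of x] by (cases "\<bar>x\<bar> > R") (auto simp: S_def indicator_def)
  qed
  also have "\<dots> = (L S * g' S - L' S * g S) - (L (-S) * g' (-S) - L' (-S) * g (-S))"
  proof (rule integral_FTC_Icc_real)
    show "-S \<le> S" by (simp add: S_def)
    show "((\<lambda>x. L x * g' x - L' x * g x) has_real_derivative L x * g'' x - L'' x * g x) (at x)" for x
      by (auto intro!: derivative_eq_intros g L simp: algebra_simps)
    have "isCont L x" "isCont g x" for x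
      using L(1) g(1) DERIV_isCont by blast+
    then show "isCont (\<lambda>x. L x * g'' x - L'' x * g x) x" for x
      using cont by (auto simp: continuous_on_eq_continuous_at intro!: continuous_intros)
  qed
  also have "\<dots> = 0" using supp(1,2)[of S] supp(1,2)[of "-S"] by (simp add: S_def)
  finally show ?thesis .
qed

lemma continuous_on_slice:
  assumes "continuous_on UNIV F"
  shows "continuous_on UNIV (\<lambda>t. F (Complex t y))" "continuous_on UNIV (\<lambda>t. F (Complex x t))"
  unfolding Complex_eq by (intro continuous_on_compose2[OF assms] continuous_intros; simp)+

text \<open>The one-dimensional identity is applied to \<open>dx\<close> on horizontal lines and to
  \<open>dy\<close> on vertical lines, with Fubini taken in the corresponding order. The differences
  integrated are continuous with compact support, hence integrable.\<close>

lemma integral_Green: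
  fixes L :: "complex \<Rightarrow> real"
  assumes \<phi>: "test_function \<phi>" and Lc: "continuous_on UNIV L" "continuous_on UNIV Lxx" "continuous_on UNIV Lyy"
    and Lx: "\<And>x y. ((\<lambda>t. L (Complex t y)) has_real_derivative Lx (Complex x y)) (at x)"
            "\<And>x y. ((\<lambda>t. Lx (Complex t y)) has_real_derivative Lxx (Complex x y)) (at x)"
    and Ly: "\<And>x y. ((\<lambda>t. L (Complex x t)) has_real_derivative Ly (Complex x y)) (at y)"
            "\<And>x y. ((\<lambda>t. Ly (Complex x t)) has_real_derivative Lyy (Complex x y)) (at y)"
  shows "(LINT z|lborel. L z * laplacian \<phi> z) = (LINT z|lborel. (Lxx z + Lyy z) * \<phi> z)"
proof -
  note tf = test_function_facts[OF \<phi>]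
  obtain R where R: "\<And>z. cmod z > R \<Longrightarrow> \<phi> z = 0" using tf(8) by blast
  have R1: "dx \<phi> z = 0" "dy \<phi> z = 0" if "cmod z > R" for z using dx_support[of R \<phi> z] R that by auto
  have R2: "dx (dx \<phi>) z = 0" "dy (dy \<phi>) z = 0" if "cmod z > R" for z
    using dx_support(1)[of R "dx \<phi>" z] dx_support(2)[of R "dy \<phi>" z] R1 that by auto
  have out: "cmod (Complex x y) > R" "cmod (Complex y x) > R" if "\<bar>x\<bar> > R" for x y
    using that abs_Re_le_cmod[of "Complex x y"] abs_Im_le_cmod[of "Complex y x"] by auto
  have intx: "integrable lborel (\<lambda>z. L z * dx (dx \<phi>) z - Lxx z * \<phi> z)"
    by (rule integrable_compact_support[where R = R]) (auto intro!: continuous_intros Lc tf simp: R R2)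
  have inty: "integrable lborel (\<lambda>z. L z * dy (dy \<phi>) z - Lyy z * \<phi> z)"
    by (rule integrable_compact_support[where R = R]) (auto intro!: continuous_intros Lc tf simp: R R2)
  have int1: "integrable lborel (\<lambda>z. L z * laplacian \<phi> z)" "integrable lborel (\<lambda>z. (Lxx z + Lyy z) * \<phi> z)"
    by (rule integrable_compact_support[where R = R]; auto intro!: continuous_intros Lc tf simp: R R2 laplacian_def)+
  have "(LINT x|lborel. L (Complex x y) * dx (dx \<phi>) (Complex x y) - Lxx (Complex x y) * \<phi> (Complex x y)) = 0" for y
    by (rule integral_Green_real[where R = R and g' = "\<lambda>x. dx \<phi> (Complex x y)" and L' = "\<lambda>x. Lx (Complex x y)"])
       (auto intro!: has_real_derivative_dx tf Lx continuous_on_slice Lc R[OF out(1)] R1[OF out(1)] R2[OF out(1)])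
  then have "(LINT z|lborel. L z * dx (dx \<phi>) z - Lxx z * \<phi> z) = 0"
    unfolding integral_complex_iterated(1)[OF intx] by simp
  moreover have "(LINT y|lborel. L (Complex x y) * dy (dy \<phi>) (Complex x y) - Lyy (Complex x y) * \<phi> (Complex x y)) = 0" for x
    by (rule integral_Green_real[where R = R and g' = "\<lambda>y. dy \<phi> (Complex x y)" and L' = "\<lambda>y. Ly (Complex x y)"])
       (auto intro!: has_real_derivative_dy tf Ly continuous_on_slice Lc R[OF out(2)] R1[OF out(2)] R2[OF out(2)])
  then have "(LINT z|lborel. L z * dy (dy \<phi>) z - Lyy z * \<phi> z) = 0"
    unfolding integral_complex_iterated(2)[OF inty] by simp
  ultimately have "0 = (LINT z|lborel. (L z * dx (dx \<phi>) z - Lxx z * \<phi> z) + (L z * dy (dy \<phi>) z - Lyy z * \<phi> z))"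
    by (subst Bochner_Integration.integral_add[OF intx inty]) simp
  also have "\<dots> = (LINT z|lborel. L z * laplacian \<phi> z - (Lxx z + Lyy z) * \<phi> z)"
    by (simp add: laplacian_def algebra_simps)
  also have "\<dots> = (LINT z|lborel. L z * laplacian \<phi> z) - (LINT z|lborel. (Lxx z + Lyy z) * \<phi> z)"
    by (rule Bochner_Integration.integral_diff[OF int1])
  finally show ?thesis by simp
qed

text \<open>The truncation in \<open>log_kernel\<close> has a corner on the circle of radius s. This
  regularisation is smooth in \<open>z\<close>, so Green's identity applies to it, and it is
  comparable with \<open>log_kernel\<close> in both directions.\<close>

definition smooth_kernel :: "real \<Rightarrow> complex \<Rightarrow> complex \<Rightarrow> real" where
  "smooth_kernel s z w = ln ((cmod (z - w))\<^sup>2 + s\<^sup>2) / 2 - ln (max 1 (cmod w))"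

text \<open>The Laplacian of \<open>smooth_kernel s z w\<close> in \<open>z\<close>: a positive
  kernel of total mass 2 pi that concentrates at \<open>w\<close> as s tends to 0. This mass is the
  source of the factor 1/(2 pi).\<close>

definition bump :: "real \<Rightarrow> complex \<Rightarrow> complex \<Rightarrow> real" where
  "bump s z w = 2 * s\<^sup>2 / ((cmod (z - w))\<^sup>2 + s\<^sup>2)\<^sup>2"

lemma smooth_kernel_Green:
  assumes "test_function \<phi>" and s: "s > 0"
  shows "(LINT z|lborel. smooth_kernel s z w * laplacian \<phi> z) = (LINT z|lborel. bump s z w * \<phi> z)"
proof -
  define q where "q z = (cmod (z - w))\<^sup>2 + s\<^sup>2" for z
  have q0: "q z > 0" for z using s by (simp add: q_def add_nonneg_pos)
  then have qn: "q z \<noteq> 0" for z using less_imp_neq by metis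
  have qC: "q (Complex x y) = (x - Re w)\<^sup>2 + (y - Im w)\<^sup>2 + s\<^sup>2" for x y
    by (simp add: q_def cmod_power2)
  define p where "p x y = (x - Re w)\<^sup>2 + (y - Im w)\<^sup>2 + s\<^sup>2" for x y
  have p0: "p x y > 0" for x y using q0[of "Complex x y"] by (simp add: qC p_def)
  have qp: "q (Complex x y) = p x y" for x y by (simp add: qC p_def)
  have dp: "((\<lambda>t. p t y) has_real_derivative 2 * (x - Re w)) (at x)"
           "((\<lambda>t. p x t) has_real_derivative 2 * (y - Im w)) (at y)" for x y
    unfolding p_def by (auto intro!: derivative_eq_intros)
  have cq: "continuous_on UNIV q" unfolding q_def by (intro continuous_intros)
  have "(LINT z|lborel. smooth_kernel s z w * laplacian \<phi> z)
    = (LINT z|lborel. ((1 / q z - 2 * (Re z - Re w)\<^sup>2 / (q z)\<^sup>2) + (1 / q z - 2 * (Im z - Im w)\<^sup>2 / (q z)\<^sup>2)) * \<phi> z)"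
  proof (rule integral_Green[OF assms(1), where Lx = "\<lambda>z. (Re z - Re w) / q z" and Ly = "\<lambda>z. (Im z - Im w) / q z"])
    show "continuous_on UNIV (\<lambda>z. smooth_kernel s z w)"
      unfolding smooth_kernel_def q_def[symmetric] using qn by (intro continuous_intros cq) auto
    show "continuous_on UNIV (\<lambda>z. 1 / q z - 2 * (Re z - Re w)\<^sup>2 / (q z)\<^sup>2)"
         "continuous_on UNIV (\<lambda>z. 1 / q z - 2 * (Im z - Im w)\<^sup>2 / (q z)\<^sup>2)"
      using qn by (intro continuous_intros cq; simp)+
    show "((\<lambda>t. smooth_kernel s (Complex t y) w) has_real_derivative (Re (Complex x y) - Re w) / q (Complex x y)) (at x)" for x y
      unfolding smooth_kernel_def q_def[symmetric] qp
      using p0[of x y] by (auto intro!: derivative_eq_intros dp simp: field_simps)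
    show "((\<lambda>t. smooth_kernel s (Complex x t) w) has_real_derivative (Im (Complex x y) - Im w) / q (Complex x y)) (at y)" for x y
      unfolding smooth_kernel_def q_def[symmetric] qp
      using p0[of x y] by (auto intro!: derivative_eq_intros dp simp: field_simps)
    show "((\<lambda>t. (Re (Complex t y) - Re w) / q (Complex t y)) has_real_derivative
        1 / q (Complex x y) - 2 * (Re (Complex x y) - Re w)\<^sup>2 / (q (Complex x y))\<^sup>2) (at x)" for x y
      unfolding qp using p0[of x y]
      by (auto intro!: derivative_eq_intros dp simp: power2_eq_square field_simps)
    show "((\<lambda>t. (Im (Complex x t) - Im w) / q (Complex x t)) has_real_derivative
        1 / q (Complex x y) - 2 * (Im (Complex x y) - Im w)\<^sup>2 / (q (Complex x y))\<^sup>2) (at y)" for x y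
      unfolding qp using p0[of x y]
      by (auto intro!: derivative_eq_intros dp simp: power2_eq_square field_simps)
  qed
  also have "\<dots> = (LINT z|lborel. bump s z w * \<phi> z)"
  proof (rule Bochner_Integration.integral_cong[OF refl])
    fix z
    have frac: "(1 / u - 2 * X / u\<^sup>2) + (1 / u - 2 * Y / u\<^sup>2) = 2 * (u - (X + Y)) / u\<^sup>2" if "u \<noteq> 0" for u X Y :: real
      using that by (simp add: field_simps power2_eq_square)
    have "(1 / q z - 2 * (Re z - Re w)\<^sup>2 / (q z)\<^sup>2) + (1 / q z - 2 * (Im z - Im w)\<^sup>2 / (q z)\<^sup>2)
      = 2 * (q z - ((Re z - Re w)\<^sup>2 + (Im z - Im w)\<^sup>2)) / (q z)\<^sup>2"
      by (intro frac[OF qn])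
    also have "\<dots> = bump s z w"
      unfolding bump_def q_def by (simp add: cmod_power2)
    finally show "((1 / q z - 2 * (Re z - Re w)\<^sup>2 / (q z)\<^sup>2) + (1 / q z - 2 * (Im z - Im w)\<^sup>2 / (q z)\<^sup>2)) * \<phi> z = bump s z w * \<phi> z"
      by simp
  qed
  finally show ?thesis .
qed

lemma integral_laplacian:
  assumes "test_function \<phi>"
  shows "(LINT z|lborel. laplacian \<phi> z) = 0"
  using integral_Green[OF assms, of "\<lambda>_. 1" "\<lambda>_. 0" "\<lambda>_. 0" "\<lambda>_. 0" "\<lambda>_. 0"] by simp

lemma integral_over_line:
  fixes f F :: "real \<Rightarrow> real"
  assumes "\<And>x. (F has_real_derivative f x) (at x)" "\<And>x. isCont f x" "\<And>x. 0 \<le> f x"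
    and "(F \<longlongrightarrow> A) at_bot" "(F \<longlongrightarrow> B) at_top"
  shows "integrable lborel f" "(LINT x|lborel. f x) = B - A"
proof -
  have l: "((F \<circ> real_of_ereal) \<longlongrightarrow> A) (at_right (-\<infinity>))" "((F \<circ> real_of_ereal) \<longlongrightarrow> B) (at_left \<infinity>)"
    using assms(4,5) by (simp_all add: ereal_tendsto_simps)
  note * = interval_integral_FTC_nonneg[of "-\<infinity>" "\<infinity>" F f A B, OF _ assms(1) assms(2) _ l]
  show "integrable lborel f"
    using *(1) assms(3) by (simp add: set_integrable_def)
  show "(LINT x|lborel. f x) = B - A"
    using *(2) assms(3) by (simp add: interval_lebesgue_integral_def set_lebesgue_integral_def)
qed

text \<open>The integral is iterated in Cartesian coordinates. With a = sqrt (1 + x^2), the integral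
  over y has the primitive y/(a^2 (a^2 + y^2)) + arctan (y/a)/a^3 and equals pi/a^3; the remaining
  integrand has the primitive pi x / sqrt (1 + x^2).\<close>

lemma integral_bump_unit:
  "integrable lborel (\<lambda>z. bump 1 z 0)" "(LINT z|lborel. bump 1 z 0) = 2 * pi"
proof -
  have inner: "integrable lborel (\<lambda>y. 2 / (a\<^sup>2 + y\<^sup>2)\<^sup>2)" "(LINT y|lborel. 2 / (a\<^sup>2 + y\<^sup>2)\<^sup>2) = pi / a ^ 3"
    if a: "a > 0" for a :: real
  proof -
    have ne: "a\<^sup>2 + y\<^sup>2 \<noteq> 0" for y using a by (simp add: sum_power2_eq_zero_iff)
    have d: "((\<lambda>y. y / (a\<^sup>2 * (a\<^sup>2 + y\<^sup>2)) + arctan (y / a) / a ^ 3) has_real_derivative 2 / (a\<^sup>2 + y\<^sup>2)\<^sup>2) (at y)" for y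
    proof -
      have d1: "((\<lambda>y. y / (a\<^sup>2 * (a\<^sup>2 + y\<^sup>2))) has_real_derivative
          (a\<^sup>2 * (a\<^sup>2 + y\<^sup>2) - y * (a\<^sup>2 * (2 * y))) / (a\<^sup>2 * (a\<^sup>2 + y\<^sup>2))\<^sup>2) (at y)"
        using a ne[of y] by (auto intro!: derivative_eq_intros simp: power2_eq_square)
      have "((\<lambda>y. arctan (y / a)) has_real_derivative (1 / a) / (1 + (y / a)\<^sup>2)) (at y)"
        using a by (auto intro!: derivative_eq_intros simp: divide_simps)
      from DERIV_cdivide[OF this, of "a ^ 3"] d1
      have "((\<lambda>y. y / (a\<^sup>2 * (a\<^sup>2 + y\<^sup>2)) + arctan (y / a) / a ^ 3) has_real_derivative
          (a\<^sup>2 * (a\<^sup>2 + y\<^sup>2) - y * (a\<^sup>2 * (2 * y))) / (a\<^sup>2 * (a\<^sup>2 + y\<^sup>2))\<^sup>2 + (1 / a) / (1 + (y / a)\<^sup>2) / a ^ 3) (at y)"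
        by (intro DERIV_add)
      moreover have "(1 / a) / (1 + (y / a)\<^sup>2) / a ^ 3 = 1 / (a\<^sup>2 * (a\<^sup>2 + y\<^sup>2))"
      proof -
        have "1 + (y / a)\<^sup>2 = (a\<^sup>2 + y\<^sup>2) / a\<^sup>2" using a by (simp add: power_divide add_divide_distrib)
        moreover have "(1 / a) / (u / a\<^sup>2) / a ^ 3 = 1 / (a\<^sup>2 * u)" if "u \<noteq> 0" for u
          using a that by (simp add: field_simps power2_eq_square power3_eq_cube)
        ultimately show ?thesis using ne[of y] by simp
      qed
      moreover have "(a\<^sup>2 * (a\<^sup>2 + y\<^sup>2) - y * (a\<^sup>2 * (2 * y))) / (a\<^sup>2 * (a\<^sup>2 + y\<^sup>2))\<^sup>2 = (a\<^sup>2 - y\<^sup>2) / (a\<^sup>2 * (a\<^sup>2 + y\<^sup>2)\<^sup>2)"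
      proof -
        have "a\<^sup>2 * (a\<^sup>2 + y\<^sup>2) - y * (a\<^sup>2 * (2 * y)) = a\<^sup>2 * (a\<^sup>2 - y\<^sup>2)"
          by (simp add: algebra_simps power2_eq_square)
        moreover have "b * c / (b * u)\<^sup>2 = c / (b * u\<^sup>2)" if "b \<noteq> 0" for b c u :: real
          using that by (simp add: power2_eq_square)
        ultimately show ?thesis using a by simp
      qed
      moreover have "(a\<^sup>2 - y\<^sup>2) / (a\<^sup>2 * (a\<^sup>2 + y\<^sup>2)\<^sup>2) + 1 / (a\<^sup>2 * (a\<^sup>2 + y\<^sup>2)) = 2 / (a\<^sup>2 + y\<^sup>2)\<^sup>2"
      proof -
        define u where "u = a\<^sup>2 + y\<^sup>2"
        have u: "a\<^sup>2 - y\<^sup>2 = 2 * a\<^sup>2 - u" "u \<noteq> 0" using ne[of y] by (auto simp: u_def)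
        have "(2 * b - u) / (b * u\<^sup>2) + 1 / (b * u) = 2 / u\<^sup>2" if "b \<noteq> 0" for b
          using that u(2) by (simp add: field_simps power2_eq_square)
        from this[of "a\<^sup>2"] show ?thesis unfolding u_def[symmetric] u(1) using a by simp
      qed
      ultimately show ?thesis by simp
    qed
    have c: "isCont (\<lambda>y. 2 / (a\<^sup>2 + y\<^sup>2)\<^sup>2) y" for y
      using ne by (intro continuous_intros) auto
    have l1: "((\<lambda>y. y / (a\<^sup>2 * (a\<^sup>2 + y\<^sup>2)) + arctan (y / a) / a ^ 3) \<longlongrightarrow> - (pi / (2 * a ^ 3))) at_bot"
      using a by real_asymp (simp add: field_simps)
    have l2: "((\<lambda>y. y / (a\<^sup>2 * (a\<^sup>2 + y\<^sup>2)) + arctan (y / a) / a ^ 3) \<longlongrightarrow> pi / (2 * a ^ 3)) at_top"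
      using a by real_asymp (simp add: field_simps)
    from integral_over_line[OF d c _ l1 l2] show "integrable lborel (\<lambda>y. 2 / (a\<^sup>2 + y\<^sup>2)\<^sup>2)"
      "(LINT y|lborel. 2 / (a\<^sup>2 + y\<^sup>2)\<^sup>2) = pi / a ^ 3"
      using a by (simp_all add: field_simps)
  qed
  have sq: "sqrt (1 + x\<^sup>2) > 0" for x :: real by (simp add: add_pos_nonneg)
  have outer: "integrable lborel (\<lambda>x. pi / sqrt (1 + x\<^sup>2) ^ 3)" "(LINT x|lborel. pi / sqrt (1 + x\<^sup>2) ^ 3) = 2 * pi"
  proof -
    have d: "((\<lambda>x. pi * x / sqrt (1 + x\<^sup>2)) has_real_derivative pi / sqrt (1 + x\<^sup>2) ^ 3) (at x)" for x
    proof -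
      define r where "r = sqrt (1 + x\<^sup>2)"
      have r: "r > 0" "r * r = 1 + x * x" using sq[of x] by (simp_all add: r_def power2_eq_square)
      have pos: "1 + x\<^sup>2 > 0" by (simp add: add_pos_nonneg)
      have "((\<lambda>x. pi * x / sqrt (1 + x\<^sup>2)) has_real_derivative (pi * r - pi * x * (inverse r / 2 * (2 * x))) / (r * r)) (at x)"
        unfolding r_def using pos by (auto intro!: derivative_eq_intros)
      also have "(pi * r - pi * x * (inverse r / 2 * (2 * x))) / (r * r) = pi * (r * r - x * x) / r ^ 3"
        using r(1) by (simp add: field_simps power3_eq_cube)
      also have "\<dots> = pi / r ^ 3" by (simp add: r(2))
      finally show ?thesis by (simp add: r_def)
    qed
    have c: "isCont (\<lambda>x. pi / sqrt (1 + x\<^sup>2) ^ 3) x" for x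
      using sq[of x] by (intro continuous_intros) auto
    have "((\<lambda>x::real. pi * x / sqrt (1 + x\<^sup>2)) \<longlongrightarrow> - pi) at_bot" "((\<lambda>x::real. pi * x / sqrt (1 + x\<^sup>2)) \<longlongrightarrow> pi) at_top"
      by real_asymp+
    from integral_over_line[OF d c _ this] show "integrable lborel (\<lambda>x. pi / sqrt (1 + x\<^sup>2) ^ 3)"
      "(LINT x|lborel. pi / sqrt (1 + x\<^sup>2) ^ 3) = 2 * pi"
      by simp_all
  qed
  have b: "bump 1 (Complex x y) 0 = 2 / ((sqrt (1 + x\<^sup>2))\<^sup>2 + y\<^sup>2)\<^sup>2" for x y
    by (simp add: bump_def cmod_power2 ac_simps)
  have bm [measurable]: "(\<lambda>z. bump 1 z 0) \<in> borel_measurable borel"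
    unfolding bump_def by measurable
  have "integrable (lborel \<Otimes>\<^sub>M lborel) (\<lambda>(x, y). bump 1 (Complex x y) 0)"
  proof (rule lborel_pair.Fubini_integrable)
    show "(\<lambda>(x, y). bump 1 (Complex x y) 0) \<in> borel_measurable (lborel \<Otimes>\<^sub>M lborel)"
      unfolding b by measurable
    show "integrable lborel (\<lambda>x. LINT y|lborel. norm (case (x, y) of (x, y) \<Rightarrow> bump 1 (Complex x y) 0))"
      using outer(1) inner(2)[OF sq] by (simp add: b)
    show "AE x in lborel. integrable lborel (\<lambda>y. case (x, y) of (x, y) \<Rightarrow> bump 1 (Complex x y) 0)"
      using inner(1)[OF sq] by (simp add: b)
  qed
  then show int: "integrable lborel (\<lambda>z. bump 1 z 0)"
    unfolding lborel_complex by (subst integrable_distr_eq) (auto simp: split_beta')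
  show "(LINT z|lborel. bump 1 z 0) = 2 * pi"
    unfolding integral_complex_iterated(2)[OF int] b inner(2)[OF sq] by (rule outer(2))
qed

text \<open>The substitution of \<open>w + s *\<^sub>R z\<close> for z has Jacobian s^2. It fixes
  the kernel and moves s into the argument of \<open>\<phi>\<close>, so the limit as s tends to 0
  becomes a case of dominated convergence.\<close>

lemma integral_bump:
  fixes \<phi> :: "complex \<Rightarrow> real"
  assumes s: "s > 0" and [measurable]: "\<phi> \<in> borel_measurable borel"
  shows "(LINT z|lborel. bump s z w * \<phi> z) = (LINT z|lborel. bump 1 z 0 * \<phi> (w + s *\<^sub>R z))"
proof -
  have [measurable]: "(\<lambda>z. bump s z w) \<in> borel_measurable borel" unfolding bump_def by measurable
  have "(LINT z|lborel. bump s z w * \<phi> z)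
     = (LINT z|density (distr lborel borel (\<lambda>x. w + s *\<^sub>R x)) (\<lambda>_. ennreal (s ^ 2)). bump s z w * \<phi> z)"
    using lborel_affine[of s w] s by simp
  also have "\<dots> = (LINT z|lborel. s\<^sup>2 * (bump s (w + s *\<^sub>R z) w * \<phi> (w + s *\<^sub>R z)))"
    by (subst integral_density) (auto simp: integral_distr)
  also have "\<dots> = (LINT z|lborel. bump 1 z 0 * \<phi> (w + s *\<^sub>R z))"
  proof (rule Bochner_Integration.integral_cong[OF refl])
    fix z
    have "bump s (w + s *\<^sub>R z) w = 2 * s\<^sup>2 / (s\<^sup>2 * ((cmod z)\<^sup>2 + 1))\<^sup>2"
      using s by (simp add: bump_def power_mult_distrib algebra_simps)
    moreover have "b * (2 * b / (b * m)\<^sup>2) = 2 / m\<^sup>2" if "b \<noteq> 0" for b m :: real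
      using that by (simp add: power2_eq_square)
    ultimately have "s\<^sup>2 * bump s (w + s *\<^sub>R z) w = bump 1 z 0"
      using s by (simp add: bump_def)
    then show "s\<^sup>2 * (bump s (w + s *\<^sub>R z) w * \<phi> (w + s *\<^sub>R z)) = bump 1 z 0 * \<phi> (w + s *\<^sub>R z)"
      by (metis mult.assoc)
  qed
  finally show ?thesis .
qed


lemma log_kernel_le_smooth_kernel:
  assumes "s > 0"
  shows "log_kernel s z w \<le> smooth_kernel s z w"
proof -
  define m where "m = max s (cmod (z - w))"
  have m: "m > 0" using assms by (simp add: m_def)
  have "m\<^sup>2 \<le> (cmod (z - w))\<^sup>2 + s\<^sup>2" by (simp add: m_def max_def)
  then have "ln (m\<^sup>2) \<le> ln ((cmod (z - w))\<^sup>2 + s\<^sup>2)"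
    using m by (intro ln_mono) auto
  then have "2 * ln m \<le> ln ((cmod (z - w))\<^sup>2 + s\<^sup>2)"
    using m by (simp add: ln_realpow)
  then show ?thesis by (simp add: log_kernel_def smooth_kernel_def m_def)
qed

text \<open>Two radii are kept apart on purpose. With t = sqrt s the error is s / 2, and the disc of
  radius t over which V is maximised shrinks as well; t = s would leave the constant error
  1/2.\<close>

lemma smooth_kernel_le_log_kernel:
  assumes "s > 0" "t > 0"
  shows "smooth_kernel s z w \<le> log_kernel t z w + s\<^sup>2 / (2 * t\<^sup>2)"
proof -
  define m where "m = max t (cmod (z - w))"
  have m: "m > 0" "t \<le> m" using assms by (auto simp: m_def)
  have "(cmod (z - w))\<^sup>2 \<le> m\<^sup>2" by (intro power_mono) (auto simp: m_def)
  moreover have "s\<^sup>2 / t\<^sup>2 * t\<^sup>2 \<le> s\<^sup>2 / t\<^sup>2 * m\<^sup>2"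
    using m assms by (intro mult_left_mono power_mono) auto
  ultimately have "(cmod (z - w))\<^sup>2 + s\<^sup>2 \<le> m\<^sup>2 * (1 + s\<^sup>2 / t\<^sup>2)"
    using assms by (simp add: algebra_simps)
  then have "ln ((cmod (z - w))\<^sup>2 + s\<^sup>2) \<le> ln (m\<^sup>2 * (1 + s\<^sup>2 / t\<^sup>2))"
    using assms by (intro ln_mono) (auto intro: add_nonneg_pos)
  also have "\<dots> = 2 * ln m + ln (1 + s\<^sup>2 / t\<^sup>2)"
    using m assms by (subst ln_mult_pos) (auto simp: ln_realpow intro: add_pos_nonneg)
  also have "ln (1 + s\<^sup>2 / t\<^sup>2) \<le> s\<^sup>2 / t\<^sup>2"
    by (rule ln_add_one_self_le_self) simp
  finally show ?thesis by (simp add: log_kernel_def smooth_kernel_def m_def)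
qed

lemma smooth_kernel_bounded:
  assumes s: "s > 0"
  shows "\<exists>B. \<forall>z w. cmod z \<le> R \<longrightarrow> \<bar>smooth_kernel s z w\<bar> \<le> B"
proof (intro exI allI impI)
  fix z w :: complex assume z: "cmod z \<le> R"
  have R: "R \<ge> 0" using z norm_ge_zero order_trans by blast
  have "smooth_kernel s z w \<le> log_kernel s z w + 1 / 2"
    using smooth_kernel_le_log_kernel[OF s s, of z w] s by simp
  moreover have "log_kernel s z w \<le> ln (max s 1 + cmod z)" by (rule log_kernel_le[OF s])
  moreover have "ln (max s 1 + cmod z) \<le> ln (max s 1 + R)"
    using z R by (intro ln_mono) (auto intro: add_pos_nonneg)
  moreover have "log_kernel s z w \<le> smooth_kernel s z w" by (rule log_kernel_le_smooth_kernel[OF s])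
  moreover have "- ln ((cmod z + 1) / s + 1) \<le> log_kernel s z w" by (rule log_kernel_ge[OF s])
  moreover have "ln ((cmod z + 1) / s + 1) \<le> ln ((R + 1) / s + 1)"
    using z R s by (intro ln_mono add_mono divide_right_mono) (auto intro!: add_nonneg_pos)
  ultimately show "\<bar>smooth_kernel s z w\<bar> \<le> \<bar>ln (max s 1 + R)\<bar> + \<bar>ln ((R + 1) / s + 1)\<bar> + 1"
    by linarith
qed

lemma continuous_bounded_on_disc:
  fixes f :: "complex \<Rightarrow> real"
  assumes "continuous_on UNIV f"
  shows "\<exists>B. \<forall>z. cmod z \<le> R \<longrightarrow> \<bar>f z\<bar> \<le> B"
proof -
  have "bounded (f ` cball 0 R)"
    by (intro compact_imp_bounded compact_continuous_image continuous_on_subset[OF assms]) auto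
  then obtain a where "\<And>x. x \<in> f ` cball 0 R \<Longrightarrow> norm x \<le> a"
    unfolding bounded_iff by blast
  then show ?thesis by (intro exI[of _ a]) auto
qed

text \<open>The integral of the smoothed potential \<open>F s\<close> against the Laplacian of a
  test function is evaluated twice. \<open>F (\<sigma> n)\<close> converges to V pointwise and
  boundedly on discs, which produces the integral with V. Fubini and Green move the Laplacian onto
  the kernel, where the approximate identity \<open>bump\<close> produces 2 pi times the integral of
  \<open>\<phi>\<close> against \<open>\<nu>\<close>.\<close>

lemma normalized_laplacian_of_potential:
  fixes V :: "complex \<Rightarrow> real"
  assumes V_cont: "continuous_on UNIV V" and \<nu>: "prob_space \<nu>" "sets \<nu> = sets borel"
    and lo: "\<And>t z. t > 0 \<Longrightarrow> V z \<le> c + (LINT w|\<nu>. log_kernel t z w)"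
    and up: "\<And>t z T. t > 0 \<Longrightarrow> (\<And>x. dist z x \<le> t \<Longrightarrow> V x \<le> T) \<Longrightarrow> c + (LINT w|\<nu>. log_kernel t z w) \<le> T"
  shows "is_normalized_laplacian V \<nu>"
proof -
  interpret \<nu>: prob_space \<nu> by fact
  note [measurable_cong] = \<nu>(2)
  define F where "F s z = c + (LINT w|\<nu>. smooth_kernel s z w)" for s z
  define \<sigma> where "\<sigma> n = 1 / real (Suc n)" for n
  have \<sigma>: "\<sigma> n > 0" "\<sigma> n \<le> 1" for n by (auto simp: \<sigma>_def field_simps)
  have \<sigma>0: "\<sigma> \<longlonglongrightarrow> 0" unfolding \<sigma>_def by real_asymp
  have [measurable]: "V \<in> borel_measurable borel"
    by (rule borel_measurable_continuous_onI[OF V_cont])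
  have lk_int: "integrable \<nu> (log_kernel t z)" if t: "t > 0" for t z
  proof -
    have [measurable]: "log_kernel t z \<in> borel_measurable borel"
      by (rule borel_measurable_continuous_onI[OF continuous_on_log_kernel[OF t]])
    obtain B where "\<And>w. norm (log_kernel t z w) \<le> B"
      using bounded_log_kernel[OF t, of z] unfolding bounded_iff by auto
    then show ?thesis by (intro \<nu>.integrable_const_bound[of _ B]) auto
  qed
  have sk_meas [measurable]: "(\<lambda>(z, w). smooth_kernel s z w) \<in> borel_measurable (borel \<Otimes>\<^sub>M borel)" for s
    unfolding smooth_kernel_def by measurable
  have sk_int: "integrable \<nu> (smooth_kernel s z)" if s: "s > 0" for s z
  proof -
    have [measurable]: "smooth_kernel s z \<in> borel_measurable borel"
      unfolding smooth_kernel_def[abs_def] by measurable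
    obtain B where B: "\<And>z' w. cmod z' \<le> cmod z \<Longrightarrow> \<bar>smooth_kernel s z' w\<bar> \<le> B"
      using smooth_kernel_bounded[OF s, of "cmod z"] by blast
    show ?thesis
    proof (rule \<nu>.integrable_const_bound[of _ B])
      show "AE w in \<nu>. norm (smooth_kernel s z w) \<le> B" using B by simp
    qed measurable
  qed
  have F_lo: "V z \<le> F s z" if s: "s > 0" for s z
  proof -
    have "(LINT w|\<nu>. log_kernel s z w) \<le> (LINT w|\<nu>. smooth_kernel s z w)"
      by (intro integral_mono lk_int sk_int s log_kernel_le_smooth_kernel)
    then show ?thesis using lo[OF s, of z] by (simp add: F_def)
  qed
  have F_up: "F s z \<le> T + s / 2" if s: "s > 0" and T: "\<And>x. dist z x \<le> sqrt s \<Longrightarrow> V x \<le> T" for s z T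
  proof -
    have t: "sqrt s > 0" using s by simp
    have "(LINT w|\<nu>. smooth_kernel s z w) \<le> (LINT w|\<nu>. log_kernel (sqrt s) z w + s / 2)"
    proof (intro integral_mono sk_int s Bochner_Integration.integrable_add lk_int t)
      show "smooth_kernel s z w \<le> log_kernel (sqrt s) z w + s / 2" for w
        using smooth_kernel_le_log_kernel[OF s t, of z w] s by (simp add: power2_eq_square)
    qed simp
    also have "\<dots> = (LINT w|\<nu>. log_kernel (sqrt s) z w) + s / 2"
      using lk_int[OF t] by (simp add: \<nu>.prob_space)
    finally have "F s z \<le> c + (LINT w|\<nu>. log_kernel (sqrt s) z w) + s / 2" by (simp add: F_def)
    moreover have "c + (LINT w|\<nu>. log_kernel (sqrt s) z w) \<le> T"
      by (rule up) (use t T in auto)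
    ultimately show ?thesis by simp
  qed
  have F_lim: "(\<lambda>n. F (\<sigma> n) z) \<longlonglongrightarrow> V z" for z
  proof (rule order_tendstoI)
    show "\<forall>\<^sub>F n in sequentially. a < F (\<sigma> n) z" if "a < V z" for a
      using F_lo[OF \<sigma>(1)] that less_le_trans by (intro always_eventually) blast
    show "\<forall>\<^sub>F n in sequentially. F (\<sigma> n) z < a" if a: "V z < a" for a
    proof -
      define e where "e = (a - V z) / 2"
      have e: "e > 0" using a by (simp add: e_def)
      have "isCont V z" using V_cont by (simp add: continuous_on_eq_continuous_at)
      then obtain d where d: "d > 0" "\<And>x. dist x z < d \<Longrightarrow> dist (V x) (V z) < e"
        using e unfolding continuous_at_eps_delta by blast
      have "(\<lambda>n. sqrt (\<sigma> n)) \<longlonglongrightarrow> sqrt 0" by (intro tendsto_intros \<sigma>0)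
      then have "\<forall>\<^sub>F n in sequentially. sqrt (\<sigma> n) < d" using d(1) by (intro order_tendstoD(2)) auto
      moreover have "\<forall>\<^sub>F n in sequentially. \<sigma> n < e" using order_tendstoD(2)[OF \<sigma>0 e] .
      ultimately show ?thesis
      proof eventually_elim
        case (elim n)
        have "F (\<sigma> n) z \<le> (V z + e) + \<sigma> n / 2"
        proof (rule F_up[OF \<sigma>(1)])
          fix x assume "dist z x \<le> sqrt (\<sigma> n)"
          then have "dist x z < d" using elim by (simp add: dist_commute)
          from d(2)[OF this] show "V x \<le> V z + e" by (simp add: dist_real_def)
        qed
        also have "\<dots> < V z + e + e" using elim \<sigma>(1)[of n] by linarith
        finally show ?case by (simp add: e_def field_simps)
      qed
    qed
  qed
  have main: "(LINT z|\<nu>. \<phi> z) = 1 / (2 * pi) * (LINT z|lborel. V z * laplacian \<phi> z)" if \<phi>: "test_function \<phi>" for \<phi>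
  proof -
    note tf = test_function_facts[OF \<phi>]
    obtain R where R: "R > 0" "\<And>z. cmod z > R \<Longrightarrow> \<phi> z = 0" using tf(8) by blast
    have lapR: "laplacian \<phi> z = 0" if "cmod z > R" for z
      using dx_support(1)[of R "dx \<phi>" z] dx_support(2)[of R "dy \<phi>" z] dx_support[of R \<phi>] R(2) that
      by (auto simp: laplacian_def)
    have [measurable]: "\<phi> \<in> borel_measurable borel" "laplacian \<phi> \<in> borel_measurable borel"
      using tf by (auto intro: borel_measurable_continuous_onI)
    have lap_int: "integrable lborel (laplacian \<phi>)"
      by (rule integrable_compact_support[OF tf(7) lapR])
    obtain B0 where B0: "\<And>z. cmod z \<le> R \<Longrightarrow> \<bar>\<phi> z\<bar> \<le> B0"
      using continuous_bounded_on_disc[OF tf(4)] by blast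
    define B where "B = max 0 B0"
    have B: "\<bar>\<phi> z\<bar> \<le> B" for z
      using B0[of z] R(2)[of z] by (cases "cmod z \<le> R") (auto simp: B_def)
    have A: "(\<lambda>n. LINT z|lborel. F (\<sigma> n) z * laplacian \<phi> z) \<longlonglongrightarrow> (LINT z|lborel. V z * laplacian \<phi> z)"
    proof -
      obtain T where T: "\<And>z. cmod z \<le> R + 1 \<Longrightarrow> \<bar>V z\<bar> \<le> T"
        using continuous_bounded_on_disc[OF V_cont] by blast
      have bd: "\<bar>F (\<sigma> n) z\<bar> \<le> T + 1" if z: "cmod z \<le> R" for n z
      proof -
        have "F (\<sigma> n) z \<le> T + \<sigma> n / 2"
        proof (rule F_up[OF \<sigma>(1)])
          fix x assume "dist z x \<le> sqrt (\<sigma> n)"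
          also have "\<dots> \<le> 1" using \<sigma>(2)[of n] by simp
          finally have "cmod x \<le> R + 1"
            using z norm_triangle_ineq4[of z "z - x"] by (simp add: dist_norm)
          then show "V x \<le> T" using T[of x] by simp
        qed
        moreover have "V z \<le> F (\<sigma> n) z" by (rule F_lo[OF \<sigma>(1)])
        ultimately show ?thesis using T[of z] z \<sigma>(2)[of n] by auto
      qed
      show ?thesis
      proof (rule integral_dominated_convergence)
        show "(\<lambda>z. V z * laplacian \<phi> z) \<in> borel_measurable lborel" by measurable
        show "(\<lambda>z. F (\<sigma> n) z * laplacian \<phi> z) \<in> borel_measurable lborel" for n
          unfolding F_def by measurable
        show "integrable lborel (\<lambda>z. (T + 1) * \<bar>laplacian \<phi> z\<bar>)"
          using lap_int by simp
        show "AE z in lborel. (\<lambda>n. F (\<sigma> n) z * laplacian \<phi> z) \<longlonglongrightarrow> V z * laplacian \<phi> z"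
          by (intro AE_I2 tendsto_intros F_lim)
        show "AE z in lborel. norm (F (\<sigma> n) z * laplacian \<phi> z) \<le> (T + 1) * \<bar>laplacian \<phi> z\<bar>" for n
        proof (intro AE_I2)
          fix z
          show "norm (F (\<sigma> n) z * laplacian \<phi> z) \<le> (T + 1) * \<bar>laplacian \<phi> z\<bar>"
            using bd[of z n] lapR[of z] by (cases "cmod z \<le> R") (auto simp: abs_mult intro: mult_right_mono)
        qed
      qed
    qed
    have Bs: "(LINT z|lborel. F s z * laplacian \<phi> z) = (LINT w|\<nu>. LINT z|lborel. bump 1 z 0 * \<phi> (w + s *\<^sub>R z))"
      if s: "s > 0" for s
    proof -
      interpret P: pair_sigma_finite "lborel :: complex measure" \<nu> ..
      obtain C where C: "\<And>z w. cmod z \<le> R \<Longrightarrow> \<bar>smooth_kernel s z w\<bar> \<le> C"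
        using smooth_kernel_bounded[OF s, of R] by blast
      have int: "integrable (lborel \<Otimes>\<^sub>M \<nu>) (\<lambda>(z, w). smooth_kernel s z w * laplacian \<phi> z)"
      proof (rule P.Fubini_integrable)
        show "(\<lambda>(z, w). smooth_kernel s z w * laplacian \<phi> z) \<in> borel_measurable (lborel \<Otimes>\<^sub>M \<nu>)"
          by measurable
        show "integrable lborel (\<lambda>z. LINT w|\<nu>. norm (case (z, w) of (z, w) \<Rightarrow> smooth_kernel s z w * laplacian \<phi> z))"
        proof (rule Bochner_Integration.integrable_bound)
          show "integrable lborel (\<lambda>z. C * laplacian \<phi> z)" using lap_int by simp
          show "(\<lambda>z. LINT w|\<nu>. norm (case (z, w) of (z, w) \<Rightarrow> smooth_kernel s z w * laplacian \<phi> z)) \<in> borel_measurable lborel"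
            by measurable
          show "AE z in lborel. norm (LINT w|\<nu>. norm (case (z, w) of (z, w) \<Rightarrow> smooth_kernel s z w * laplacian \<phi> z))
              \<le> norm (C * laplacian \<phi> z)"
          proof (intro AE_I2)
            fix z
            show "norm (LINT w|\<nu>. norm (case (z, w) of (z, w) \<Rightarrow> smooth_kernel s z w * laplacian \<phi> z)) \<le> norm (C * laplacian \<phi> z)"
            proof (cases "cmod z \<le> R")
              case True
              have "C \<ge> 0" using C[OF True, of 0] by linarith
              have "(LINT w|\<nu>. \<bar>smooth_kernel s z w\<bar>) \<le> C"
                by (rule \<nu>.integral_le_const) (use sk_int[OF s] C[OF True] in auto)
              then show ?thesis using \<open>C \<ge> 0\<close> by (simp add: abs_mult mult_right_mono)
            qed (simp add: lapR)
          qed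
        qed
        show "AE z in lborel. integrable \<nu> (\<lambda>w. case (z, w) of (z, w) \<Rightarrow> smooth_kernel s z w * laplacian \<phi> z)"
          using sk_int[OF s] by simp
      qed
      have i1: "integrable lborel (\<lambda>z. LINT w|\<nu>. smooth_kernel s z w * laplacian \<phi> z)"
        using P.integrable_fst[OF int] by simp
      have "(LINT z|lborel. F s z * laplacian \<phi> z)
          = (LINT z|lborel. c * laplacian \<phi> z + (LINT w|\<nu>. smooth_kernel s z w * laplacian \<phi> z))"
        by (simp add: F_def distrib_right)
      \<comment> \<open>The constant \<open>c\<close> disappears because the Laplacian of a test
        function has integral 0.\<close>
      also have "\<dots> = c * (LINT z|lborel. laplacian \<phi> z) + (LINT z|lborel. LINT w|\<nu>. smooth_kernel s z w * laplacian \<phi> z)"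
        using lap_int i1 by (subst Bochner_Integration.integral_add) auto
      also have "\<dots> = (LINT w|\<nu>. LINT z|lborel. smooth_kernel s z w * laplacian \<phi> z)"
        using P.Fubini_integral[OF int] integral_laplacian[OF \<phi>] by simp
      also have "\<dots> = (LINT w|\<nu>. LINT z|lborel. bump 1 z 0 * \<phi> (w + s *\<^sub>R z))"
        by (simp add: smooth_kernel_Green[OF \<phi> s] integral_bump[OF s])
      finally show ?thesis .
    qed
    have bump_nonneg: "0 \<le> bump s z w" for s z w by (simp add: bump_def)
    have bumpm [measurable]: "(\<lambda>z. bump 1 z 0) \<in> borel_measurable borel"
      unfolding bump_def by measurable
    have Cin: "(\<lambda>n. LINT z|lborel. bump 1 z 0 * \<phi> (w + \<sigma> n *\<^sub>R z)) \<longlonglongrightarrow> 2 * pi * \<phi> w" for w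
    proof -
      have "(\<lambda>n. LINT z|lborel. bump 1 z 0 * \<phi> (w + \<sigma> n *\<^sub>R z)) \<longlonglongrightarrow> (LINT z|lborel. bump 1 z 0 * \<phi> w)"
      proof (rule integral_dominated_convergence)
        show "integrable lborel (\<lambda>z. bump 1 z 0 * B)" using integral_bump_unit(1) by simp
        show "AE z in lborel. (\<lambda>n. bump 1 z 0 * \<phi> (w + \<sigma> n *\<^sub>R z)) \<longlonglongrightarrow> bump 1 z 0 * \<phi> w"
        proof (intro AE_I2 tendsto_intros)
          fix z
          have "(\<lambda>n. w + \<sigma> n *\<^sub>R z) \<longlonglongrightarrow> w + 0 *\<^sub>R z" by (intro tendsto_intros \<sigma>0)
          then have "(\<lambda>n. w + \<sigma> n *\<^sub>R z) \<longlonglongrightarrow> w" by simp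
          then show "(\<lambda>n. \<phi> (w + \<sigma> n *\<^sub>R z)) \<longlonglongrightarrow> \<phi> w"
            using continuous_on_tendsto_compose[OF tf(4)] by auto
        qed
        show "AE z in lborel. norm (bump 1 z 0 * \<phi> (w + \<sigma> n *\<^sub>R z)) \<le> bump 1 z 0 * B" for n
          by (intro AE_I2) (auto simp: abs_mult bump_nonneg intro!: mult_left_mono B)
      qed measurable
      then show ?thesis by (simp add: integral_bump_unit)
    qed
    have "(\<lambda>n. LINT w|\<nu>. LINT z|lborel. bump 1 z 0 * \<phi> (w + \<sigma> n *\<^sub>R z)) \<longlonglongrightarrow> (LINT w|\<nu>. 2 * pi * \<phi> w)"
    proof (rule integral_dominated_convergence)
      show "integrable \<nu> (\<lambda>w. 2 * pi * B)" by simp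
      show "AE w in \<nu>. (\<lambda>n. LINT z|lborel. bump 1 z 0 * \<phi> (w + \<sigma> n *\<^sub>R z)) \<longlonglongrightarrow> 2 * pi * \<phi> w"
        by (intro AE_I2 Cin)
      show "AE w in \<nu>. norm (LINT z|lborel. bump 1 z 0 * \<phi> (w + \<sigma> n *\<^sub>R z)) \<le> 2 * pi * B" for n
      proof (intro AE_I2)
        fix w
        have "norm (LINT z|lborel. bump 1 z 0 * \<phi> (w + \<sigma> n *\<^sub>R z)) \<le> (LINT z|lborel. bump 1 z 0 * B)"
        proof -
          have b: "norm (bump 1 z 0 * \<phi> (w + \<sigma> n *\<^sub>R z)) \<le> bump 1 z 0 * B" for z
            by (auto simp: abs_mult bump_nonneg intro!: mult_left_mono B)
          have "integrable lborel (\<lambda>z. bump 1 z 0 * \<phi> (w + \<sigma> n *\<^sub>R z))"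
          proof (rule Bochner_Integration.integrable_bound)
            show "integrable lborel (\<lambda>z. bump 1 z 0 * B)" using integral_bump_unit(1) by simp
            show "AE z in lborel. norm (bump 1 z 0 * \<phi> (w + \<sigma> n *\<^sub>R z)) \<le> norm (bump 1 z 0 * B)"
              using b order_trans[OF _ abs_ge_self] by (intro AE_I2) fastforce
          qed measurable
          then show ?thesis
            using b integral_bump_unit(1)
            by (intro order_trans[OF integral_norm_bound] integral_mono) auto
        qed
        then show "norm (LINT z|lborel. bump 1 z 0 * \<phi> (w + \<sigma> n *\<^sub>R z)) \<le> 2 * pi * B"
          by (simp add: integral_bump_unit)
      qed
    qed measurable
    then have "(\<lambda>n. LINT z|lborel. F (\<sigma> n) z * laplacian \<phi> z) \<longlonglongrightarrow> 2 * pi * (LINT w|\<nu>. \<phi> w)"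
      by (simp add: Bs[OF \<sigma>(1)])
    then have "2 * pi * (LINT w|\<nu>. \<phi> w) = (LINT z|lborel. V z * laplacian \<phi> z)"
      using A LIMSEQ_unique by blast
    then show ?thesis by (simp add: field_simps)
  qed
  show ?thesis
    unfolding is_normalized_laplacian_def
    using \<nu>(2) \<nu>.emeasure_finite main by (auto simp: less_top[symmetric])
qed

section \<open>Uniqueness of the normalised Laplacian\<close>

text \<open>The classical flat function e^(-s/x), with a polynomial in 1/x as a factor so that the
  family is closed under differentiation.\<close>

definition edge :: "real poly \<Rightarrow> real \<Rightarrow> real \<Rightarrow> real" where
  "edge p s x = (if x > 0 then poly p (1 / x) * exp (- s / x) else 0)"

text \<open>With u = 1/x, differentiating p(u) e^(-s u) in x brings out du/dx = -u^2, hence the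
  polynomial u^2 (s p - p').\<close>

definition edge_deriv :: "real \<Rightarrow> real poly \<Rightarrow> real poly" where
  "edge_deriv s p = [:0, 0, 1:] * (smult s p - pderiv p)"

lemma tendsto_poly_exp_decay:
  fixes p :: "real poly"
  assumes s: "s > 0"
  shows "((\<lambda>u. poly p u * exp (- s * u)) \<longlongrightarrow> 0) at_top"
proof -
  have "((\<lambda>u. u ^ i * exp (- s * u)) \<longlongrightarrow> 0) at_top" for i
  proof -
    have "filterlim (\<lambda>u. s * u) at_top at_top"
      using s by (intro filterlim_tendsto_pos_mult_at_top[OF tendsto_const] filterlim_ident)
    from filterlim_compose[OF tendsto_power_div_exp_0 this, of i]
    have "((\<lambda>u. (s * u) ^ i / exp (s * u) / s ^ i) \<longlongrightarrow> 0 / s ^ i) at_top"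
      using s by (intro tendsto_divide tendsto_const) auto
    then show ?thesis
      using s by (simp add: power_mult_distrib exp_minus field_simps)
  qed
  then have "((\<lambda>u. \<Sum>i\<le>degree p. coeff p i * (u ^ i * exp (- s * u))) \<longlongrightarrow> (\<Sum>i\<le>degree p. coeff p i * 0)) at_top"
    by (intro tendsto_intros)
  then show ?thesis
    by (simp add: poly_altdef sum_distrib_right mult.assoc)
qed

lemma DERIV_edge:
  assumes s: "s > 0"
  shows "(edge p s has_real_derivative edge (edge_deriv s p) s x) (at x)"
proof -
  consider "x > 0" | "x < 0" | "x = 0" by linarith
  then show ?thesis
  proof cases
    case 1
    have "((\<lambda>x. poly p (1 / x) * exp (- s / x)) has_real_derivative
        poly (edge_deriv s p) (1 / x) * exp (- s / x)) (at x)"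
      using 1 unfolding edge_deriv_def
      by (auto intro!: derivative_eq_intros poly_DERIV[THEN DERIV_chain2] simp: field_simps power2_eq_square)
    moreover have "\<forall>\<^sub>F y in nhds x. edge p s y = poly p (1 / y) * exp (- s / y)"
      using eventually_nhds_in_open[of "{0<..}" x] 1 by (auto elim!: eventually_mono simp: edge_def)
    ultimately show ?thesis
      using 1 DERIV_cong_ev[of x x "edge p s" "\<lambda>x. poly p (1 / x) * exp (- s / x)"] by (simp add: edge_def)
  next
    case 2
    have "\<forall>\<^sub>F y in nhds x. edge p s y = 0"
      using eventually_nhds_in_open[of "{..<0}" x] 2 by (auto elim!: eventually_mono simp: edge_def)
    then show ?thesis
      using 2 DERIV_cong_ev[of x x "edge p s" "\<lambda>_. 0" 0] by (simp add: edge_def)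
  next
    case 3
    \<comment> \<open>Division by h is multiplication by u = 1/h, so the difference quotient at 0 is
      again a polynomial in u times e^(-s u), and u tends to infinity.\<close>
    have "((\<lambda>h. edge p s h / h) \<longlongrightarrow> 0) (at_right 0)"
    proof -
      from filterlim_compose[OF tendsto_poly_exp_decay[OF s, of "[:0, 1:] * p"] filterlim_inverse_at_top_right]
      have "((\<lambda>h. poly ([:0, 1:] * p) (inverse h) * exp (- s * inverse h)) \<longlongrightarrow> 0) (at_right 0)" .
      then show ?thesis
        by (rule Lim_transform_eventually)
           (auto simp: eventually_at_right_field edge_def field_simps intro!: exI[of _ 1])
    qed
    moreover have "((\<lambda>h. edge p s h / h) \<longlongrightarrow> 0) (at_left 0)"
      by (rule tendsto_eventually) (auto simp: eventually_at_left_field edge_def intro!: exI[of _ "-1"])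
    ultimately have "((\<lambda>h. edge p s h / h) \<longlongrightarrow> 0) (at 0)"
      by (simp add: filterlim_split_at)
    then show ?thesis
      using 3 by (simp add: DERIV_def edge_def)
  qed
qed

text \<open>Every member is differentiable and the set is closed under \<open>dx\<close> and \<open>dy\<close>, hence its members are smooth.\<close>

inductive_set box_functions :: "real \<Rightarrow> complex \<Rightarrow> complex \<Rightarrow> (complex \<Rightarrow> real) set"
  for s :: real and a b :: complex where
  prod: "(\<lambda>z. (edge p s (Re z - Re a) * edge q s (Re b - Re z)) *
              (edge p' s (Im z - Im a) * edge q' s (Im b - Im z))) \<in> box_functions s a b"
| add: "f \<in> box_functions s a b \<Longrightarrow> g \<in> box_functions s a b \<Longrightarrow> (\<lambda>z. f z + g z) \<in> box_functions s a b"

lemma edge_uminus: "edge (- p) s x = - edge p s x"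
  by (simp add: edge_def)

lemma DERIV_edge_prod:
  assumes "s > 0"
  shows "((\<lambda>t. edge p s (t - a) * edge q s (b - t)) has_real_derivative
     edge (edge_deriv s p) s (x - a) * edge q s (b - x) + edge p s (x - a) * edge (- edge_deriv s q) s (b - x)) (at x)"
proof -
  have 1: "((\<lambda>t. edge p s (t - a)) has_real_derivative edge (edge_deriv s p) s (x - a) * (1 - 0)) (at x)"
    by (rule DERIV_chain2[OF DERIV_edge[OF assms]]) (intro derivative_intros)
  have 2: "((\<lambda>t. edge q s (b - t)) has_real_derivative edge (edge_deriv s q) s (b - x) * (0 - 1)) (at x)"
    by (rule DERIV_chain2[OF DERIV_edge[OF assms]]) (intro derivative_intros)
  show ?thesis
    using DERIV_mult[OF 1 2] by (simp add: edge_uminus algebra_simps)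
qed

lemma box_functions_closed:
  assumes s: "s > 0" and "f \<in> box_functions s a b"
  shows "f differentiable_on UNIV \<and> dx f \<in> box_functions s a b \<and> dy f \<in> box_functions s a b"
  using assms(2)
proof induction
  case (prod p q p' q')
  let ?X = "\<lambda>p q x. edge p s (x - Re a) * edge q s (Re b - x)"
  let ?Y = "\<lambda>p q y. edge p s (y - Im a) * edge q s (Im b - y)"
  note dX = DERIV_edge_prod[OF s, of p "Re a" q "Re b"]
  note dY = DERIV_edge_prod[OF s, of p' "Im a" q' "Im b"]
  have "(\<lambda>z. ?X p q (Re z) * ?Y p' q' (Im z)) differentiable at z" for z
  proof (rule differentiable_mult)
    show "(\<lambda>z. ?X p q (Re z)) differentiable at z"
      using DERIV_compose_FDERIV[OF dX has_derivative_Re[OF has_derivative_ident]] by (rule differentiableI)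
    show "(\<lambda>z. ?Y p' q' (Im z)) differentiable at z"
      using DERIV_compose_FDERIV[OF dY has_derivative_Im[OF has_derivative_ident]] by (rule differentiableI)
  qed
  then have d: "(\<lambda>z. ?X p q (Re z) * ?Y p' q' (Im z)) differentiable_on UNIV"
    by (simp add: differentiable_on_def)
  have dxe: "dx (\<lambda>z. ?X p q (Re z) * ?Y p' q' (Im z))
     = (\<lambda>z. ?X (edge_deriv s p) q (Re z) * ?Y p' q' (Im z) + ?X p (- edge_deriv s q) (Re z) * ?Y p' q' (Im z))"
  proof
    fix z
    show "dx (\<lambda>z. ?X p q (Re z) * ?Y p' q' (Im z)) z
     = ?X (edge_deriv s p) q (Re z) * ?Y p' q' (Im z) + ?X p (- edge_deriv s q) (Re z) * ?Y p' q' (Im z)"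
      unfolding dx_def complex.sel
      by (rule DERIV_imp_deriv) (use DERIV_cmult_right[OF dX[of "Re z"], of "?Y p' q' (Im z)"] in \<open>simp add: distrib_right\<close>)
  qed
  have dye: "dy (\<lambda>z. ?X p q (Re z) * ?Y p' q' (Im z))
     = (\<lambda>z. ?X p q (Re z) * ?Y (edge_deriv s p') q' (Im z) + ?X p q (Re z) * ?Y p' (- edge_deriv s q') (Im z))"
  proof
    fix z
    show "dy (\<lambda>z. ?X p q (Re z) * ?Y p' q' (Im z)) z
     = ?X p q (Re z) * ?Y (edge_deriv s p') q' (Im z) + ?X p q (Re z) * ?Y p' (- edge_deriv s q') (Im z)"
      unfolding dy_def complex.sel
      by (rule DERIV_imp_deriv) (use DERIV_cmult[OF dY[of "Im z"], of "?X p q (Re z)"] in \<open>simp add: distrib_left\<close>)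
  qed
  show ?case
    unfolding dxe dye using d by (intro conjI box_functions.add box_functions.prod)
next
  case (add f g)
  have "dx (\<lambda>z. f z + g z) = (\<lambda>z. dx f z + dx g z)"
  proof
    fix z
    show "dx (\<lambda>z. f z + g z) z = dx f z + dx g z"
      unfolding dx_def[of "\<lambda>z. f z + g z"]
      using DERIV_add[OF has_real_derivative_dx[of f "Im z" "Re z"] has_real_derivative_dx[of g "Im z" "Re z"]] add.IH
      by (intro DERIV_imp_deriv) simp
  qed
  moreover have "dy (\<lambda>z. f z + g z) = (\<lambda>z. dy f z + dy g z)"
  proof
    fix z
    show "dy (\<lambda>z. f z + g z) z = dy f z + dy g z"
      unfolding dy_def[of "\<lambda>z. f z + g z"]
      using DERIV_add[OF has_real_derivative_dy[of f "Re z" "Im z"] has_real_derivative_dy[of g "Re z" "Im z"]] add.IH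
      by (intro DERIV_imp_deriv) simp
  qed
  ultimately show ?case
    using add box_functions.add by (auto intro: differentiable_on_add)
qed

lemma smooth_box_functions:
  assumes s: "s > 0" and "f \<in> box_functions s a b"
  shows "smooth f"
proof -
  have "(dy ^^ j) f \<in> box_functions s a b" for j
    by (induction j) (use box_functions_closed[OF s] assms in auto)
  then have "(dx ^^ i) ((dy ^^ j) f) \<in> box_functions s a b" for i j
    by (induction i) (use box_functions_closed[OF s] in auto)
  then show ?thesis
    unfolding smooth_def using box_functions_closed[OF s] by blast
qed

text \<open>Positive exactly on the open box, and tending to its indicator as s tends to 0; the
  parameter s of \<open>edge\<close> is carried along for this limit.\<close>

definition box_bump :: "real \<Rightarrow> complex \<Rightarrow> complex \<Rightarrow> complex \<Rightarrow> real" where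
  "box_bump s a b z = (edge 1 s (Re z - Re a) * edge 1 s (Re b - Re z)) *
              (edge 1 s (Im z - Im a) * edge 1 s (Im b - Im z))"

lemma edge_bounds: "s > 0 \<Longrightarrow> 0 \<le> edge 1 s x" "s > 0 \<Longrightarrow> edge 1 s x \<le> 1"
  by (auto simp: edge_def)

lemma box_bump_bounds:
  assumes "s > 0"
  shows "\<bar>box_bump s a b z\<bar> \<le> 1"
proof -
  have "\<bar>edge 1 s x\<bar> \<le> 1" for x
    using edge_bounds[OF assms, of x] by simp
  then show ?thesis
    unfolding box_bump_def abs_mult by (intro mult_le_one mult_nonneg_nonneg abs_ge_zero)
qed

lemma box_bump_eq_0: "z \<notin> box a b \<Longrightarrow> box_bump s a b z = 0"
  by (auto simp: box_bump_def edge_def in_box_complex_iff)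

lemma test_function_box_bump:
  assumes "s > 0"
  shows "test_function (box_bump s a b)"
proof -
  have "smooth (box_bump s a b)"
    unfolding box_bump_def[abs_def] by (rule smooth_box_functions[OF assms box_functions.prod])
  moreover have "{z. box_bump s a b z \<noteq> 0} \<subseteq> box a b"
    using box_bump_eq_0 by blast
  then have "compact (closure {z. box_bump s a b z \<noteq> 0})"
    unfolding compact_closure using bounded_box bounded_subset by blast
  ultimately show ?thesis by (simp add: test_function_def)
qed

lemma box_bump_tendsto_indicator:
  "(\<lambda>n. box_bump (1 / real (Suc n)) a b z) \<longlonglongrightarrow> indicator (box a b) z"
proof (cases "z \<in> box a b")
  case False
  then show ?thesis by (simp add: box_bump_eq_0)
next
  case True
  have "(\<lambda>n. edge 1 (1 / real (Suc n)) x) \<longlonglongrightarrow> 1" if "x > 0" for x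
  proof -
    have "(\<lambda>n. exp (- (1 / real (Suc n)) / x)) \<longlonglongrightarrow> exp (- 0 / x)"
      using that by (intro tendsto_intros LIMSEQ_Suc lim_1_over_n) auto
    then show ?thesis using that by (simp add: edge_def)
  qed
  then have "(\<lambda>n. box_bump (1 / real (Suc n)) a b z) \<longlonglongrightarrow> (1 * 1) * (1 * 1)"
    unfolding box_bump_def using True by (intro tendsto_mult) (auto simp: in_box_complex_iff)
  then show ?thesis using True by simp
qed

text \<open>The test functions \<open>box_bump\<close> have equal integrals under both measures and
  converge boundedly to indicators of open boxes. Such boxes form a generator of the Borel sets that
  is stable under intersection.\<close>

lemma normalized_laplacian_unique:
  assumes \<mu>: "is_normalized_laplacian V \<mu>" "prob_space \<mu>" and \<nu>: "is_normalized_laplacian V \<nu>" "prob_space \<nu>"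
  shows "\<mu> = \<nu>"
proof -
  have sets: "sets \<mu> = sets borel" "sets \<nu> = sets borel"
    using \<mu> \<nu> by (auto simp: is_normalized_laplacian_def)
  have lim: "(\<lambda>n. LINT z|m. box_bump (1 / real (Suc n)) a b z) \<longlonglongrightarrow> measure m (box a b)"
    if "prob_space m" "sets m = sets borel" for m a b
  proof -
    interpret prob_space m by fact
    note [measurable_cong] = that(2)
    have "(\<lambda>n. LINT z|m. box_bump (1 / real (Suc n)) a b z) \<longlonglongrightarrow> (LINT z|m. indicator (box a b) z)"
    proof (rule integral_dominated_convergence)
      show "AE z in m. (\<lambda>n. box_bump (1 / real (Suc n)) a b z) \<longlonglongrightarrow> indicator (box a b) z"
        by (intro AE_I2 box_bump_tendsto_indicator)
      show "AE z in m. norm (box_bump (1 / real (Suc n)) a b z) \<le> 1" for n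
        using box_bump_bounds by (intro AE_I2) simp
      show "box_bump (1 / real (Suc n)) a b \<in> borel_measurable m" for n
      proof -
        have "box_bump (1 / real (Suc n)) a b differentiable_on UNIV"
          unfolding box_bump_def[abs_def] using box_functions_closed[OF _ box_functions.prod] by simp
        then have "box_bump (1 / real (Suc n)) a b \<in> borel_measurable borel"
          by (intro borel_measurable_continuous_onI differentiable_imp_continuous_on)
        then show ?thesis by measurable
      qed
    qed measurable
    then show ?thesis using that(2) by simp
  qed
  have same: "measure \<mu> (box a b) = measure \<nu> (box a b)" for a b
  proof (rule LIMSEQ_unique[OF lim[OF \<mu>(2) sets(1)]])
    have "(LINT z|\<mu>. box_bump (1 / real (Suc n)) a b z) = (LINT z|\<nu>. box_bump (1 / real (Suc n)) a b z)" for n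
      using \<mu>(1) \<nu>(1) test_function_box_bump[of "1 / real (Suc n)" a b]
      unfolding is_normalized_laplacian_def by simp
    then show "(\<lambda>n. LINT z|\<mu>. box_bump (1 / real (Suc n)) a b z) \<longlonglongrightarrow> measure \<nu> (box a b)"
      using lim[OF \<nu>(2) sets(2)] by simp
  qed
  interpret \<mu>: prob_space \<mu> by fact
  interpret \<nu>: prob_space \<nu> by fact
  show ?thesis
  proof (rule measure_eqI_generator_eq[where \<Omega> = UNIV and E = "range (\<lambda>(a, b). box a b :: complex set)"
        and A = "\<lambda>i. box (- real i *\<^sub>R One) (real i *\<^sub>R One)"])
    show "Int_stable (range (\<lambda>(a, b). box a b :: complex set))"
      by (auto simp: Int_stable_def box_Int_box)
    show "sets \<mu> = sigma_sets UNIV (range (\<lambda>(a, b). box a b :: complex set))"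
         "sets \<nu> = sigma_sets UNIV (range (\<lambda>(a, b). box a b :: complex set))"
      unfolding sets by (subst borel_eq_box, simp)+
    show "(\<Union>i. box (- real i *\<^sub>R One) (real i *\<^sub>R One)) = (UNIV :: complex set)"
      by (simp add: UN_box_eq_UNIV)
    show "emeasure \<mu> X = emeasure \<nu> X" if "X \<in> range (\<lambda>(a, b). box a b :: complex set)" for X
      using that same by (auto simp: \<mu>.emeasure_eq_measure \<nu>.emeasure_eq_measure)
  qed (auto simp: \<mu>.emeasure_eq_measure)
qed

section \<open>Convergence of the zero measures\<close>

text \<open>The zeros missing when \<open>degree p < n\<close> are placed at the point \<open>n\<close>, so that they escape to infinity;
  tightness of the padded zeros then shows that their proportion tends to 0.\<close>

definition padded :: "nat \<Rightarrow> complex poly \<Rightarrow> complex poly" where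
  "padded n p = (if p = 0 \<or> n = 0 then monom 1 n else p * [:1, - 1 / of_nat n:] ^ (n - degree p))"

lemma padded_nonzero: "padded n p \<noteq> 0"
  by (simp add: padded_def monom_eq_0_iff)

lemma degree_padded: "degree p \<le> n \<Longrightarrow> degree (padded n p) = n"
  by (auto simp: padded_def degree_monom_eq degree_mult_eq degree_power_eq)

lemma proots_padded:
  assumes "p \<noteq> 0" "n > 0"
  shows "proots (padded n p) = proots p + replicate_mset (n - degree p) (of_nat n)"
proof -
  have "[:1, - 1 / of_nat n:] = smult (- 1 / of_nat n) [:- of_nat n, 1 :: complex:]"
    using assms by simp
  then have "proots [:1, - 1 / of_nat n:] = {#of_nat n :: complex#}"
    using assms by (subst \<open>[:1, - 1 / of_nat n:] = _\<close>, subst proots_smult) auto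
  then show ?thesis
    using assms by (simp add: padded_def proots_mult proots_power repeat_mset_replicate_mset)
qed

lemma poly_padded:
  assumes "p \<noteq> 0" "n > 0"
  shows "poly (padded n p) z = poly p z * (1 - z / of_nat n) ^ (n - degree p)"
  using assms by (simp add: padded_def)

lemma expectation_padded:
  fixes g :: "complex \<Rightarrow> real"
  assumes "p \<noteq> 0" "n > 0" "degree p \<le> n"
  shows "measure_pmf.expectation (root_pmf (padded n p)) g
    = ((\<Sum>w\<in>#proots p. g w) + real (n - degree p) * g (of_nat n)) / real n"
  using assms by (subst expectation_root_pmf) (auto simp: degree_padded proots_padded)

lemma integral_zero_measure:
  fixes g :: "complex \<Rightarrow> real"
  assumes p: "p \<noteq> 0" and [measurable]: "g \<in> borel_measurable borel"
  shows "(LINT z|zero_measure n p. g z) = (\<Sum>w\<in>#proots p. g w) / real n"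
proof -
  have "(LINT z|zero_measure n p. g z)
     = (LINT z|density (count_space {z. poly p z = 0}) (\<lambda>z. ennreal (real (order z p) / real n)). g z)"
    using p unfolding zero_measure_def by (simp add: integral_distr)
  also have "\<dots> = (LINT z|count_space {z. poly p z = 0}. (real (order z p) / real n) * g z)"
    by (subst integral_density) auto
  also have "\<dots> = (\<Sum>z | poly p z = 0. (real (order z p) / real n) * g z)"
    using p by (intro lebesgue_integral_count_space_finite poly_roots_finite)
  also have "\<dots> = (\<Sum>w\<in>#proots p. g w) / real n"
    using p by (simp add: sum_mset_multiplicity sum_divide_distrib)
  finally show ?thesis .
qed

lemma tendsto_if_subsequences:
  fixes x :: "nat \<Rightarrow> real"
  assumes "\<And>s :: nat \<Rightarrow> nat. strict_mono s \<Longrightarrow> \<exists>r :: nat \<Rightarrow> nat. strict_mono r \<and> (\<lambda>n. x (s (r n))) \<longlonglongrightarrow> l"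
  shows "x \<longlonglongrightarrow> l"
proof (rule ccontr)
  assume "\<not> x \<longlonglongrightarrow> l"
  then obtain e where e: "e > 0" "\<exists>\<^sub>F n in sequentially. \<not> dist (x n) l < e"
    unfolding tendsto_iff not_all not_imp frequently_def not_not by blast
  then have "infinite {n. \<not> dist (x n) l < e}"
    by (simp add: frequently_sequentially infinite_nat_iff_unbounded_le)
  then obtain s :: "nat \<Rightarrow> nat" where s: "strict_mono s" "\<And>n. \<not> dist (x (s n)) l < e"
    using infinite_enumerate by blast
  obtain r :: "nat \<Rightarrow> nat" where r: "(\<lambda>n. x (s (r n))) \<longlonglongrightarrow> l"
    using assms[OF s(1)] by blast
  then have "\<forall>\<^sub>F n in sequentially. dist (x (s (r n))) l < e"
    using e(1) by (rule tendstoD)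
  then show False using s(2) by (auto simp: eventually_sequentially)
qed

context log_potential_limit
begin

lemma subsequential_normalized_laplacian:
  assumes s: "strict_mono (s :: nat \<Rightarrow> nat)"
  shows "\<exists>r \<nu>. strict_mono (r :: nat \<Rightarrow> nat) \<and> prob_space \<nu> \<and> is_normalized_laplacian V \<nu> \<and>
    (\<forall>g :: complex \<Rightarrow> real. continuous_on UNIV g \<longrightarrow> bounded (range g) \<longrightarrow>
       (\<lambda>n. measure_pmf.expectation (root_pmf (P (s (r n)))) g) \<longlonglongrightarrow> (LINT w|\<nu>. g w))"
proof -
  obtain r \<nu> c where r: "strict_mono (r :: nat \<Rightarrow> nat)" and \<nu>: "prob_space \<nu>" "sets \<nu> = sets borel"
    and conv: "\<And>g :: complex \<Rightarrow> real. continuous_on UNIV g \<Longrightarrow> bounded (range g) \<Longrightarrow>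
       (\<lambda>n. measure_pmf.expectation (root_pmf (P (s (r n)))) g) \<longlonglongrightarrow> (LINT w|\<nu>. g w)"
    and lo: "\<And>t z. t > 0 \<Longrightarrow> V z \<le> c + (LINT w|\<nu>. log_kernel t z w)"
    and up: "\<And>t z T. t > 0 \<Longrightarrow> (\<And>x. dist z x \<le> t \<Longrightarrow> V x \<le> T) \<Longrightarrow> c + (LINT w|\<nu>. log_kernel t z w) \<le> T"
    using subsequential_limit[OF s] by metis
  have "is_normalized_laplacian V \<nu>"
    by (rule normalized_laplacian_of_potential[OF V_cont \<nu> lo up])
  then show ?thesis using r \<nu> conv by blast
qed

text \<open>Every subsequence has a further subsequence with a weak limit that is a normalised
  Laplacian of V. Uniqueness makes all these limits equal to \<open>\<mu>\<close>, which upgrades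
  subsequential convergence to convergence.\<close>

lemma expectation_root_pmf_tendsto:
  fixes g :: "complex \<Rightarrow> real"
  assumes \<mu>: "is_normalized_laplacian V \<mu>" "prob_space \<mu>" and g: "continuous_on UNIV g" "bounded (range g)"
  shows "(\<lambda>n. measure_pmf.expectation (root_pmf (P n)) g) \<longlonglongrightarrow> (LINT w|\<mu>. g w)"
proof (rule tendsto_if_subsequences)
  fix s :: "nat \<Rightarrow> nat" assume "strict_mono s"
  from subsequential_normalized_laplacian[OF this] obtain r \<nu> where
    r: "strict_mono (r :: nat \<Rightarrow> nat)" and \<nu>: "prob_space \<nu>" "is_normalized_laplacian V \<nu>"
    and conv: "(\<lambda>n. measure_pmf.expectation (root_pmf (P (s (r n)))) g) \<longlonglongrightarrow> (LINT w|\<nu>. g w)"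
    using g by blast
  have "\<nu> = \<mu>" by (rule normalized_laplacian_unique[OF \<nu>(2,1) \<mu>])
  then show "\<exists>r. strict_mono r \<and> (\<lambda>n. measure_pmf.expectation (root_pmf (P (s (r n)))) g) \<longlonglongrightarrow> (LINT w|\<mu>. g w)"
    using r conv by blast
qed

end

text \<open>The version met by a random polynomial, whose leading coefficient may vanish: only
  \<open>degree (G n) \<le> n\<close> is guaranteed, and \<open>G n\<close> may even be zero for
  small n.\<close>

locale poly_log_limit =
  fixes G :: "nat \<Rightarrow> complex poly" and V :: "complex \<Rightarrow> real"
  assumes deg: "\<And>n. degree (G n) \<le> n"
    and V_cont: "continuous_on UNIV V"
    and V_growth: "\<exists>R C. \<forall>z. cmod z \<ge> R \<longrightarrow> \<bar>V z - ln (cmod z)\<bar> \<le> C"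
    and upper: "\<And>R \<epsilon>. \<epsilon> > 0 \<Longrightarrow>
        \<forall>\<^sub>F n in sequentially. \<forall>z. cmod z \<le> R \<longrightarrow> cmod (poly (G n) z) \<le> exp (real n * (V z + \<epsilon>))"
    and lower: "\<And>z \<epsilon>. \<epsilon> > 0 \<Longrightarrow>
        \<forall>\<^sub>F n in sequentially. \<exists>x. dist x z < \<epsilon> \<and> cmod (poly (G n) x) \<ge> exp (real n * (V z - \<epsilon>))"
begin

lemma eventually_nonzero: "\<forall>\<^sub>F n in sequentially. G n \<noteq> 0"
  using lower[of 1 0, OF zero_less_one]
proof eventually_elim
  case (elim n)
  then obtain x where "exp (real n * (V 0 - 1)) \<le> cmod (poly (G n) x)" by blast
  then have "cmod (poly (G n) x) > 0" using exp_gt_zero less_le_trans by blast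
  then show ?case by auto
qed

text \<open>On the disc of radius R, the modulus of the factor (1 - z/n)^(n - degree) lies between
  e^(-2 R) and e^R once n is at least 2 R. It is therefore invisible after taking logarithms and
  dividing by n, and both bounds survive with \<open>\<epsilon>\<close> split in halves.\<close>

sublocale padded: log_potential_limit "\<lambda>n. padded n (G n)" V
proof
  show "padded n (G n) \<noteq> 0" for n by (rule padded_nonzero)
  show "degree (padded n (G n)) = n" for n by (rule degree_padded[OF deg])
  show "\<forall>\<^sub>F n in sequentially. \<forall>z. cmod z \<le> R \<longrightarrow> cmod (poly (padded n (G n)) z) \<le> exp (real n * (V z + \<epsilon>))"
    if \<epsilon>: "\<epsilon> > 0" for R \<epsilon>
  proof -
    have "\<forall>\<^sub>F n in sequentially. real n \<ge> 2 * R / \<epsilon>"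
      using filterlim_real_sequentially unfolding filterlim_at_top by blast
    with upper[OF half_gt_zero[OF \<epsilon>], of R] eventually_nonzero eventually_gt_at_top[of 0] show ?thesis
    proof (eventually_elim, safe)
      fix n z
      assume n: "real n \<ge> 2 * R / \<epsilon>" "0 < n" "G n \<noteq> 0" and z: "cmod z \<le> R"
        and G: "\<forall>z. cmod z \<le> R \<longrightarrow> cmod (poly (G n) z) \<le> exp (real n * (V z + \<epsilon> / 2))"
      have "cmod (1 - z / of_nat n) \<le> 1 + R / real n"
        using norm_triangle_ineq4[of 1 "z / of_nat n"] z n(2) divide_right_mono[OF z, of "real n"]
        by (simp add: norm_divide)
      also have "\<dots> \<le> exp (R / real n)" by (rule exp_ge_add_one_self)
      finally have "cmod (1 - z / of_nat n) ^ (n - degree (G n)) \<le> exp (R / real n) ^ (n - degree (G n))"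
        by (intro power_mono) auto
      also have "\<dots> \<le> exp (R / real n) ^ n"
        using z order_trans[OF norm_ge_zero z] by (intro power_increasing) auto
      also have "\<dots> = exp R" using n(2) by (simp add: exp_of_nat_mult[symmetric])
      also have "\<dots> \<le> exp (real n * (\<epsilon> / 2))" using n(1) \<epsilon> by (simp add: field_simps)
      finally have "cmod (poly (padded n (G n)) z) \<le> exp (real n * (V z + \<epsilon> / 2)) * exp (real n * (\<epsilon> / 2))"
        using G z n by (simp add: poly_padded norm_mult norm_power mult_mono)
      also have "\<dots> = exp (real n * (V z + \<epsilon>))"
        by (simp add: exp_add[symmetric] algebra_simps)
      finally show "cmod (poly (padded n (G n)) z) \<le> exp (real n * (V z + \<epsilon>))" .
    qed
  qed
  show "\<forall>\<^sub>F n in sequentially. \<exists>x. dist x z < \<epsilon> \<and> cmod (poly (padded n (G n)) x) \<ge> exp (real n * (V z - \<epsilon>))"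
    if \<epsilon>: "\<epsilon> > 0" for z \<epsilon>
  proof -
    define R where "R = cmod z + \<epsilon>"
    have R: "R \<ge> 0" using \<epsilon> by (simp add: R_def)
    have e2: "\<epsilon> / 2 > 0" using \<epsilon> by simp
    have "\<forall>\<^sub>F n in sequentially. real n \<ge> 4 * R / \<epsilon>" "\<forall>\<^sub>F n in sequentially. real n \<ge> 2 * R"
      using filterlim_real_sequentially unfolding filterlim_at_top by blast+
    with lower[OF e2, of z] eventually_nonzero eventually_gt_at_top[of 0] show ?thesis
    proof eventually_elim
      case (elim n)
      then obtain x where x: "dist x z < \<epsilon> / 2" "exp (real n * (V z - \<epsilon> / 2)) \<le> cmod (poly (G n) x)"
        by blast
      have xR: "cmod x \<le> R"
        using x(1) norm_triangle_sub[of x z] \<epsilon> by (simp add: R_def dist_norm)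
      define u where "u = R / real n"
      \<comment> \<open>The estimate \<open>exp (- 2 * u) \<le> 1 - u\<close> used below relies on
        \<open>u \<le> 1 / 2\<close>, which is where n at least 2 R enters.\<close>
      have u: "0 \<le> u" "u \<le> 1 / 2" using R elim by (auto simp: u_def field_simps)
      have "cmod (x / of_nat n) \<le> u"
        unfolding u_def norm_divide norm_of_nat using xR by (intro divide_right_mono) auto
      then have 1: "1 - u \<le> cmod (1 - x / of_nat n)"
        using norm_triangle_ineq2[of 1 "x / of_nat n"] by simp
      have "exp (- 2 * u) = 1 / exp (2 * u)" by (simp add: exp_minus inverse_eq_divide)
      also have "\<dots> \<le> 1 / (1 + 2 * u)"
        using u exp_ge_add_one_self[of "2 * u"] by (intro divide_left_mono) auto
      also have "\<dots> \<le> 1 - u"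
      proof -
        have "0 \<le> u * (1 - 2 * u)" using u by (intro mult_nonneg_nonneg) auto
        then have "1 \<le> (1 - u) * (1 + 2 * u)" by (simp add: algebra_simps)
        then show ?thesis using u by (simp add: divide_le_eq)
      qed
      finally have 2: "exp (- 2 * u) \<le> cmod (1 - x / of_nat n)" using 1 by linarith
      have "exp (- (real n * (\<epsilon> / 2))) \<le> exp (- 2 * R)" using elim \<epsilon> by (simp add: field_simps)
      also have "\<dots> = exp (- 2 * u) ^ n"
        using elim by (simp add: u_def exp_of_nat_mult[symmetric])
      also have "\<dots> \<le> exp (- 2 * u) ^ (n - degree (G n))"
        using u by (intro power_decreasing) auto
      also have "\<dots> \<le> cmod (1 - x / of_nat n) ^ (n - degree (G n))"
        using 2 by (intro power_mono) auto
      finally have "exp (real n * (V z - \<epsilon> / 2)) * exp (- (real n * (\<epsilon> / 2))) \<le> cmod (poly (padded n (G n)) x)"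
        using x(2) elim by (simp add: poly_padded norm_mult norm_power mult_mono)
      also have "exp (real n * (V z - \<epsilon> / 2)) * exp (- (real n * (\<epsilon> / 2))) = exp (real n * (V z - \<epsilon>))"
        by (simp add: exp_add[symmetric] algebra_simps)
      finally show ?case using x(1) \<epsilon> by (intro exI[of _ x]) auto
    qed
  qed
qed (rule V_cont V_growth)+

lemma degree_defect_tendsto_0: "(\<lambda>n. real (n - degree (G n)) / real n) \<longlonglongrightarrow> 0"
proof (rule order_tendstoI)
  fix a :: real assume "0 < a"
  then have "a / 2 > 0" by simp
  \<comment> \<open>Once n exceeds \<open>R\<close>, the padding point n lies in the tail region, so
    the tail probability is at least the proportion of padded zeros.\<close>
  from padded.root_pmf_tight[OF this] obtain R where
    R: "\<forall>\<^sub>F n in sequentially. measure_pmf.prob (root_pmf (padded n (G n))) {w. cmod w > R} \<le> a / 2"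
    by blast
  have "\<forall>\<^sub>F n in sequentially. real n > R"
    using filterlim_real_sequentially unfolding filterlim_at_top_dense by blast
  with R eventually_nonzero eventually_gt_at_top[of 0]
  show "\<forall>\<^sub>F n in sequentially. real (n - degree (G n)) / real n < a"
  proof eventually_elim
    case (elim n)
    have "measure_pmf.prob (root_pmf (padded n (G n))) {w. cmod w > R}
        = measure_pmf.expectation (root_pmf (padded n (G n))) (indicator {w. cmod w > R})"
      by simp
    also have "\<dots> = ((\<Sum>w\<in>#proots (G n). indicator {w. cmod w > R} w) + real (n - degree (G n)) * 1) / real n"
      using elim deg by (subst expectation_padded) auto
    also have "\<dots> \<ge> real (n - degree (G n)) / real n"
      unfolding sum_mset_multiplicity by (intro divide_right_mono) (auto intro!: sum_nonneg)
    finally show ?case using elim \<open>0 < a\<close> by linarith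
  qed
next
  fix a :: real assume "a < 0"
  then show "\<forall>\<^sub>F n in sequentially. a < real (n - degree (G n)) / real n"
    by (intro always_eventually allI) (rule less_le_trans[of a 0], auto)
qed

theorem zero_measure_weak_star_conv:
  assumes \<mu>: "is_normalized_laplacian V \<mu>" "prob_space \<mu>"
  shows "weak_star_conv (\<lambda>n. zero_measure n (G n)) \<mu>"
  unfolding weak_star_conv_def
proof (intro allI impI)
  fix g :: "complex \<Rightarrow> real" assume g: "continuous_on UNIV g" "bounded (range g)"
  have gm: "g \<in> borel_measurable borel"
    by (rule borel_measurable_continuous_onI[OF g(1)])
  obtain B where B: "\<And>x. \<bar>g x\<bar> \<le> B" using g(2) unfolding bounded_iff by auto
  \<comment> \<open>This is the contribution of the padding to the mean of \<open>g\<close>. As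
    \<open>g\<close> is merely bounded, its smallness comes from the vanishing proportion and not
    from the escape of the point n.\<close>
  have "(\<lambda>n. real (n - degree (G n)) / real n * g (of_nat n)) \<longlonglongrightarrow> 0"
  proof (rule Lim_null_comparison)
    show "\<forall>\<^sub>F n in sequentially. norm (real (n - degree (G n)) / real n * g (of_nat n)) \<le> real (n - degree (G n)) / real n * B"
      using B by (intro always_eventually allI) (auto simp: abs_mult intro!: mult_left_mono divide_right_mono)
    show "(\<lambda>n. real (n - degree (G n)) / real n * B) \<longlonglongrightarrow> 0"
      using tendsto_mult_right[OF degree_defect_tendsto_0, of B] by simp
  qed
  with padded.expectation_root_pmf_tendsto[OF \<mu> g]
  have "(\<lambda>n. measure_pmf.expectation (root_pmf (padded n (G n))) g
      - real (n - degree (G n)) / real n * g (of_nat n)) \<longlonglongrightarrow> (LINT w|\<mu>. g w) - 0"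
    by (rule tendsto_diff)
  then have "(\<lambda>n. measure_pmf.expectation (root_pmf (padded n (G n))) g
      - real (n - degree (G n)) / real n * g (of_nat n)) \<longlonglongrightarrow> (LINT w|\<mu>. g w)"
    by simp
  then show "(\<lambda>n. LINT z|zero_measure n (G n). g z) \<longlonglongrightarrow> (LINT z|\<mu>. g z)"
  proof (rule Lim_transform_eventually)
    show "\<forall>\<^sub>F n in sequentially. measure_pmf.expectation (root_pmf (padded n (G n))) g
      - real (n - degree (G n)) / real n * g (of_nat n) = (LINT z|zero_measure n (G n). g z)"
      using eventually_nonzero eventually_gt_at_top[of 0]
      by eventually_elim (simp add: expectation_padded deg integral_zero_measure gm add_divide_distrib)
  qed
qed

end

section \<open>From random coefficients to the deterministic bounds\<close>

lemma degree_random_poly: "degree (random_poly f x n) \<le> n"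
  unfolding random_poly_def by (intro degree_sum_le) (auto intro: order_trans[OF degree_monom_le])

text \<open>The bound holds on a neighbourhood of each point from some index on; compactness of the
  closed disc reduces this to finitely many neighbourhoods, hence to one index.\<close>

lemma locally_uniform_upper_bound:
  fixes S :: "nat \<Rightarrow> complex \<Rightarrow> real"
  assumes lim: "\<And>z0. \<exists>U. open U \<and> z0 \<in> U \<and> (\<forall>\<^sub>F n in sequentially. \<forall>z\<in>U. S n z > 0) \<and>
        uniform_limit U (\<lambda>n z. 1 / real n * ln (S n z)) V sequentially"
    and \<epsilon>: "\<epsilon> > 0"
  shows "\<forall>\<^sub>F n in sequentially. \<forall>z. cmod z \<le> R \<longrightarrow> S n z \<le> exp (real n * (V z + \<epsilon>))"
proof -
  have "\<exists>U. open U \<and> z0 \<in> U \<and> (\<forall>\<^sub>F n in sequentially. \<forall>z\<in>U. S n z \<le> exp (real n * (V z + \<epsilon>)))" for z0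
  proof -
    obtain U where U: "open U" "z0 \<in> U" "\<forall>\<^sub>F n in sequentially. \<forall>z\<in>U. S n z > 0"
      "uniform_limit U (\<lambda>n z. 1 / real n * ln (S n z)) V sequentially"
      using lim by blast
    from U(3) uniform_limitD[OF U(4) \<epsilon>] eventually_gt_at_top[of 0]
    have "\<forall>\<^sub>F n in sequentially. \<forall>z\<in>U. S n z \<le> exp (real n * (V z + \<epsilon>))"
    proof eventually_elim
      case (elim n)
      show ?case
      proof
        fix z assume z: "z \<in> U"
        have "1 / real n * ln (S n z) \<le> V z + \<epsilon>"
          using elim(2) z by (fastforce simp: dist_real_def)
        then have "ln (S n z) \<le> real n * (V z + \<epsilon>)" using elim(3) by (simp add: field_simps)
        then show "S n z \<le> exp (real n * (V z + \<epsilon>))"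
          using elim(1) z by (metis exp_le_cancel_iff exp_ln)
      qed
    qed
    then show ?thesis using U by blast
  qed
  then have "\<exists>U. \<forall>z0. open (U z0) \<and> z0 \<in> U z0 \<and> (\<forall>\<^sub>F n in sequentially. \<forall>z\<in>U z0. S n z \<le> exp (real n * (V z + \<epsilon>)))"
    by (intro choice allI)
  then obtain U where U: "\<And>z. open (U z)" "\<And>z. z \<in> U z"
    "\<And>z0. \<forall>\<^sub>F n in sequentially. \<forall>z\<in>U z0. S n z \<le> exp (real n * (V z + \<epsilon>))"
    by blast
  have cov: "cball 0 R \<subseteq> (\<Union>c\<in>cball 0 R. U c)" using U(2) by blast
  obtain C where C: "C \<subseteq> cball 0 R" "finite C" "cball 0 R \<subseteq> (\<Union>c\<in>C. U c)"
    by (rule compactE_image[of "cball 0 R" "cball 0 R" U, OF compact_cball U(1) cov])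
  have "\<forall>\<^sub>F n in sequentially. \<forall>c\<in>C. \<forall>z\<in>U c. S n z \<le> exp (real n * (V z + \<epsilon>))"
    using U(3) by (intro eventually_ball_finite C(2)) auto
  then show ?thesis
    by eventually_elim (use C(3) in \<open>auto simp: subset_iff\<close>)
qed

lemma conull_imp_dense:
  fixes D :: "'a :: euclidean_space set"
  assumes "- D \<in> null_sets lebesgue"
  shows "closure D = UNIV"
proof -
  have "negligible (- D)" using assms by (simp add: negligible_iff_null_sets)
  then have "negligible (- closure D)" using negligible_subset[of "- D" "- closure D"] closure_subset[of D] by auto
  then have "- closure D = {}" using open_not_negligible[of "- closure D"] by auto
  then show ?thesis by blast
qed

text \<open>For j up to sqrt n, the ratio (1 + 1/n)^j is at most exp (j/n), hence at most exp (1 /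
  sqrt n), which tends to 1.\<close>

lemma geometric_points_tendsto:
  fixes z :: complex
  assumes "e > 0"
  shows "\<forall>\<^sub>F n in sequentially. \<forall>j<nat \<lfloor>sqrt (real n)\<rfloor>. dist (z * of_real (1 + 1 / real n) ^ j) z < e"
proof -
  have "(\<lambda>n. cmod z * (exp (1 / sqrt (real n)) - 1)) \<longlonglongrightarrow> 0" by real_asymp
  then have "\<forall>\<^sub>F n in sequentially. cmod z * (exp (1 / sqrt (real n)) - 1) < e"
    using assms by (rule order_tendstoD(2))
  then show ?thesis
    using eventually_gt_at_top[of 0]
  proof eventually_elim
    case (elim n)
    show ?case
    proof (intro allI impI)
      fix j assume "j < nat \<lfloor>sqrt (real n)\<rfloor>"
      then have j: "real j \<le> sqrt (real n)" by linarith
      define q where "q = 1 + 1 / real n"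
      have q: "q \<ge> 1" by (simp add: q_def)
      have "q ^ j \<le> exp (1 / real n) ^ j"
        unfolding q_def by (intro power_mono exp_ge_add_one_self) auto
      also have "\<dots> = exp (real j / real n)" by (simp add: exp_of_nat_mult[symmetric])
      also have "\<dots> \<le> exp (1 / sqrt (real n))"
      proof -
        have "real j / real n \<le> sqrt (real n) / real n" using j by (intro divide_right_mono) auto
        also have "\<dots> = 1 / sqrt (real n)" using elim(2) by (simp add: field_simps)
        finally show ?thesis by simp
      qed
      finally have qj: "q ^ j \<le> exp (1 / sqrt (real n))" .
      have "z * of_real q ^ j - z = z * of_real (q ^ j - 1)" by (simp add: algebra_simps)
      then have "dist (z * of_real q ^ j) z = cmod z * (q ^ j - 1)"
        using one_le_power[OF q, of j] unfolding dist_norm by (simp only: norm_mult norm_of_real)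
      also have "\<dots> \<le> cmod z * (exp (1 / sqrt (real n)) - 1)" using qj by (intro mult_left_mono) auto
      finally show "dist (z * of_real (1 + 1 / real n) ^ j) z < e" using elim(1) by (simp add: q_def)
    qed
  qed
qed

lemma poly_log_limit_random_poly:
  fixes V :: "complex \<Rightarrow> real"
  assumes V_cont: "continuous_on UNIV V"
    and V_growth: "\<exists>R C. \<forall>z. cmod z \<ge> R \<longrightarrow> \<bar>V z - ln (cmod z)\<bar> \<le> C"
    and V_limit: "\<And>z0. \<exists>U. open U \<and> z0 \<in> U \<and>
        (\<forall>\<^sub>F n in sequentially. \<forall>z\<in>U. (\<Sum>k\<le>n. cmod (f n k) * cmod z ^ k) > 0) \<and>
        uniform_limit U (\<lambda>n z. 1 / real n * ln (\<Sum>k\<le>n. cmod (f n k) * cmod z ^ k)) V sequentially"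
    and growth: "\<And>\<epsilon>. \<epsilon> > 0 \<Longrightarrow> \<exists>C. \<forall>k. cmod (x k) \<le> C * exp (\<epsilon> * real k)"
    and dense: "closure D0 = UNIV"
    and not_small: "\<And>z m. z \<in> D0 \<Longrightarrow> \<forall>\<^sub>F n in sequentially. \<exists>j<nat \<lfloor>sqrt (real n)\<rfloor>.
       cmod (poly (random_poly f x n) (z * of_real (1 + 1 / real n) ^ j)) > exp (real n * (V z - inverse (real (Suc m))))"
  shows "poly_log_limit (random_poly f x) V"
proof
  show "degree (random_poly f x n) \<le> n" for n by (rule degree_random_poly)
  show "\<forall>\<^sub>F n in sequentially. \<forall>z. cmod z \<le> R \<longrightarrow> cmod (poly (random_poly f x n) z) \<le> exp (real n * (V z + \<epsilon>))"
    if \<epsilon>: "\<epsilon> > 0" for R \<epsilon>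
  proof -
    define S where "S n z = (\<Sum>k\<le>n. cmod (f n k) * cmod z ^ k)" for n z
    \<comment> \<open>One quarter of \<open>\<epsilon>\<close> pays for the exponential growth of
      the coefficients, another for the constant \<open>C\<close>, and the remaining half for the
      convergence to V.\<close>
    have e2: "\<epsilon> / 2 > 0" and e4: "\<epsilon> / 4 > 0" using \<epsilon> by auto
    obtain C0 where C0: "\<And>k. cmod (x k) \<le> C0 * exp (\<epsilon> / 4 * real k)" using growth[OF e4] by blast
    define C where "C = max 1 C0"
    have C: "C \<ge> 1" "cmod (x k) \<le> C * exp (\<epsilon> / 4 * real k)" for k
      using order_trans[OF C0[of k] mult_right_mono[of C0 C "exp (\<epsilon> / 4 * real k)"]] by (auto simp: C_def)
    have up: "\<forall>\<^sub>F n in sequentially. \<forall>z. cmod z \<le> R \<longrightarrow> S n z \<le> exp (real n * (V z + \<epsilon> / 2))"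
      by (rule locally_uniform_upper_bound[OF _ e2]) (use V_limit in \<open>simp add: S_def\<close>)
    have "\<forall>\<^sub>F n in sequentially. real n \<ge> ln C / (\<epsilon> / 4)"
      using filterlim_real_sequentially unfolding filterlim_at_top by blast
    with up show ?thesis
    proof (eventually_elim, safe)
      fix n z
      assume n: "ln C / (\<epsilon> / 4) \<le> real n" and z: "cmod z \<le> R"
        and up: "\<forall>z. cmod z \<le> R \<longrightarrow> S n z \<le> exp (real n * (V z + \<epsilon> / 2))"
      have "ln C \<le> \<epsilon> / 4 * real n" using n \<epsilon> by (simp add: field_simps)
      then have Cn: "C \<le> exp (\<epsilon> / 4 * real n)" using C(1) by (metis exp_le_cancel_iff exp_ln less_le_trans zero_less_one)
      have xk: "cmod (x k) \<le> exp (\<epsilon> / 2 * real n)" if "k \<le> n" for k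
      proof -
        note C(2)[of k]
        also have "C * exp (\<epsilon> / 4 * real k) \<le> exp (\<epsilon> / 4 * real n) * exp (\<epsilon> / 4 * real n)"
          using Cn C(1) \<epsilon> that by (intro mult_mono) auto
        also have "\<dots> = exp (\<epsilon> / 2 * real n)" by (simp add: exp_add[symmetric])
        finally show ?thesis .
      qed
      have "cmod (poly (random_poly f x n) z) \<le> (\<Sum>k\<le>n. cmod (x k * f n k * z ^ k))"
        unfolding poly_random_poly by (rule norm_sum)
      also have "\<dots> \<le> (\<Sum>k\<le>n. exp (\<epsilon> / 2 * real n) * (cmod (f n k) * cmod z ^ k))"
        unfolding norm_mult norm_power mult.assoc using xk by (intro sum_mono mult_right_mono) auto
      also have "\<dots> = exp (\<epsilon> / 2 * real n) * S n z" by (simp add: S_def sum_distrib_left)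
      also have "\<dots> \<le> exp (\<epsilon> / 2 * real n) * exp (real n * (V z + \<epsilon> / 2))"
        using up z by (intro mult_left_mono) auto
      also have "\<dots> = exp (real n * (V z + \<epsilon>))" by (simp add: exp_add[symmetric] algebra_simps)
      finally show "cmod (poly (random_poly f x n) z) \<le> exp (real n * (V z + \<epsilon>))" .
    qed
  qed
  show "\<forall>\<^sub>F n in sequentially. \<exists>y. dist y z < \<epsilon> \<and> cmod (poly (random_poly f x n) y) \<ge> exp (real n * (V z - \<epsilon>))"
    if \<epsilon>: "\<epsilon> > 0" for z \<epsilon>
  proof -
    have e2: "\<epsilon> / 2 > 0" using \<epsilon> by simp
    have "isCont V z" using V_cont by (simp add: continuous_on_eq_continuous_at)
    then obtain d where d: "d > 0" "\<And>y. dist y z < d \<Longrightarrow> dist (V y) (V z) < \<epsilon> / 2"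
      using e2 unfolding continuous_at_eps_delta by blast
    \<comment> \<open>A point \<open>z0\<close> of \<open>D0\<close> replaces \<open>z\<close>:
      continuity of V costs less than \<open>\<epsilon> / 2\<close> and so does the rate 1/(m+1).
      The distance to \<open>z0\<close> takes up one half of the allowed radius, and the geometric
      points around \<open>z0\<close> the other.\<close>
    have "z \<in> closure D0" using dense by simp
    then obtain z0 where z0: "z0 \<in> D0" "dist z0 z < min d (\<epsilon> / 2)"
      using d(1) e2 unfolding closure_approachable by (metis min_less_iff_conj)
    obtain m where m: "inverse (real (Suc m)) < \<epsilon> / 2" using reals_Archimedean[OF e2] by blast
    have Vz: "V z - \<epsilon> \<le> V z0 - inverse (real (Suc m))"
    proof -
      have "\<bar>V z0 - V z\<bar> < \<epsilon> / 2" using d(2)[of z0] z0(2) by (simp add: dist_real_def)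
      then show ?thesis using m by linarith
    qed
    from not_small[OF z0(1), of m] geometric_points_tendsto[OF e2, of z0] show ?thesis
    proof eventually_elim
      case (elim n)
      then obtain j where j: "j < nat \<lfloor>sqrt (real n)\<rfloor>"
        "exp (real n * (V z0 - inverse (real (Suc m)))) < cmod (poly (random_poly f x n) (z0 * of_real (1 + 1 / real n) ^ j))"
        by blast
      define y where "y = z0 * of_real (1 + 1 / real n) ^ j"
      have "dist y z0 < \<epsilon> / 2" using elim(2) j(1) by (simp add: y_def)
      then have "dist y z < \<epsilon>" using dist_triangle[of y z z0] z0(2) by simp
      moreover have "exp (real n * (V z - \<epsilon>)) \<le> exp (real n * (V z0 - inverse (real (Suc m))))"
        using Vz by (simp add: mult_left_mono)
      then have "exp (real n * (V z - \<epsilon>)) \<le> cmod (poly (random_poly f x n) y)"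
        unfolding y_def using j(2) by linarith
      ultimately show ?case by blast
    qed
  qed
qed (rule V_cont V_growth)+

theorem theorem6p5:
  fixes f :: "nat \<Rightarrow> nat \<Rightarrow> complex" and V :: "complex \<Rightarrow> real" and D :: "complex set"
    and M :: "'w measure" and \<xi> :: "nat \<Rightarrow> 'w \<Rightarrow> complex"
  assumes V_cont: "continuous_on UNIV V"
    and V_limit: "\<And>z0. \<exists>U. open U \<and> z0 \<in> U \<and>
        (\<forall>\<^sub>F n in sequentially. \<forall>z\<in>U. (\<Sum>k\<le>n. cmod (f n k) * cmod z ^ k) > 0) \<and>
        uniform_limit U (\<lambda>n z. 1 / real n * ln (\<Sum>k\<le>n. cmod (f n k) * cmod z ^ k)) V sequentially"
    and V_subharmonic: "continuous_subharmonic V"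
    and V_growth: "\<exists>R C. \<forall>z. cmod z \<ge> R \<longrightarrow> \<bar>V z - ln (cmod z)\<bar> \<le> C"
    and D_conull: "- D \<in> null_sets lebesgue"
    and many_large: "\<And>z \<epsilon>. z \<in> D \<Longrightarrow> \<epsilon> > 0 \<Longrightarrow> \<exists>(n0::nat) (\<delta>::real). \<delta> > 0 \<and>
        (\<forall>n\<ge>n0. real (card {k \<in> {0..n}. cmod (f n k) * cmod z ^ k \<ge> exp (real n * (V z - \<epsilon>))})
            \<ge> real n powr (2/3 + \<delta>))"
    and M_prob: "prob_space M"
    and indep: "prob_space.indep_vars M (\<lambda>_. borel) \<xi> UNIV"
    and ident: "\<And>k. distr M borel (\<xi> k) = distr M borel (\<xi> 0)"
    and nondeg: "non_degenerate M (\<xi> 0)"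
    and log_moment: "integrable M (\<lambda>\<omega>. ln (1 + cmod (\<xi> 0 \<omega>)))"
  shows "\<exists>\<mu>. is_normalized_laplacian V \<mu> \<and> prob_space \<mu> \<and>
     (AE \<omega> in M. weak_star_conv (\<lambda>n. zero_measure n (random_poly f (\<lambda>k. \<xi> k \<omega>) n)) \<mu>)"
proof -
  interpret M: prob_space M by fact
  have rv [measurable]: "\<xi> k \<in> borel_measurable M" for k
    using indep by (auto simp: M.indep_vars_def)
  obtain \<rho> Q where \<rho>: "\<rho> > 0" "0 < Q" "Q < 1"
    and conc: "\<And>y. M.prob {\<omega> \<in> space M. cmod (\<xi> 0 \<omega> + y) \<le> \<rho>} \<le> Q"
    using M.non_degenerate_concentration[OF rv nondeg] by metis
  have conc': "M.prob {\<omega> \<in> space M. cmod (\<xi> k \<omega> + y) \<le> \<rho>} \<le> Q" for k y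
  proof -
    have "M.prob {\<omega> \<in> space M. cmod (\<xi> i \<omega> + y) \<le> \<rho>} = measure (distr M borel (\<xi> i)) {x. cmod (x + y) \<le> \<rho>}" for i
      by (subst measure_distr) (auto simp: vimage_def Int_def conj_commute)
    then show ?thesis using conc[of y] ident[of k] by simp
  qed
  \<comment> \<open>The lower bound is almost sure for each point and each rate separately; a
    countable dense set of points and countable rates make it almost sure simultaneously.\<close>
  obtain D0 where D0: "countable D0" "D0 \<subseteq> D" "D \<subseteq> closure D0"
    using separable by blast
  have dense: "closure D0 = UNIV"
    using conull_imp_dense[OF D_conull] closure_minimal[OF D0(3) closed_closure] by blast
  have "AE \<omega> in M. \<forall>\<^sub>F n in sequentially. \<exists>j<nat \<lfloor>sqrt (real n)\<rfloor>.
       cmod (poly (random_poly f (\<lambda>k. \<xi> k \<omega>) n) (z * of_real (1 + 1 / real n) ^ j))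
         > exp (real n * (V z - inverse (real (Suc m))))" if z: "z \<in> D0" for z m
  proof -
    \<comment> \<open>The hypothesis is used at half the target rate; the other half absorbs the
      interpolation loss.\<close>
    have "inverse (real (Suc m)) / 2 > 0" by simp
    from many_large[OF _ this] z D0(2) obtain n0 \<delta> where "\<delta> > 0"
      "\<forall>n\<ge>n0. real (card {k \<in> {0..n}. cmod (f n k) * cmod z ^ k \<ge> exp (real n * (V z - inverse (real (Suc m)) / 2))})
         \<ge> real n powr (2/3 + \<delta>)" by blast
    then show ?thesis
      by (intro M.AE_random_poly_not_small[OF indep conc' \<rho>]) auto
  qed
  then have "AE \<omega> in M. \<forall>z\<in>D0. \<forall>m. \<forall>\<^sub>F n in sequentially. \<exists>j<nat \<lfloor>sqrt (real n)\<rfloor>.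
       cmod (poly (random_poly f (\<lambda>k. \<xi> k \<omega>) n) (z * of_real (1 + 1 / real n) ^ j))
         > exp (real n * (V z - inverse (real (Suc m))))"
    by (simp add: AE_ball_countable[OF D0(1)] AE_all_countable)
  moreover have "AE \<omega> in M. \<forall>\<epsilon>>0. \<exists>C. \<forall>k. cmod (\<xi> k \<omega>) \<le> C * exp (\<epsilon> * real k)"
    by (rule M.AE_subexponential_growth; fact)
  ultimately have good: "AE \<omega> in M. poly_log_limit (random_poly f (\<lambda>k. \<xi> k \<omega>)) V"
  proof eventually_elim
    case (elim \<omega>)
    show ?case
      by (rule poly_log_limit_random_poly[OF V_cont V_growth V_limit _ dense]) (use elim in auto)
  qed
  \<comment> \<open>A single good outcome already produces a measure \<open>\<mu>\<close>. Being a
    probability measure that is a normalised Laplacian of V, it is determined by V, so it serves as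
    the limit for almost every other outcome too.\<close>
  have "\<exists>\<omega>. poly_log_limit (random_poly f (\<lambda>k. \<xi> k \<omega>)) V"
    using M.AE_False good by (metis (mono_tags, lifting) eventually_mono)
  then obtain \<omega> where "poly_log_limit (random_poly f (\<lambda>k. \<xi> k \<omega>)) V" by blast
  then interpret poly_log_limit "random_poly f (\<lambda>k. \<xi> k \<omega>)" V .
  have "strict_mono (\<lambda>n :: nat. n)" by (simp add: strict_mono_def)
  from padded.subsequential_normalized_laplacian[OF this] obtain \<mu> where
    \<mu>: "is_normalized_laplacian V \<mu>" "prob_space \<mu>" by blast
  have "AE \<omega> in M. weak_star_conv (\<lambda>n. zero_measure n (random_poly f (\<lambda>k. \<xi> k \<omega>) n)) \<mu>"
    using good by eventually_elim (rule poly_log_limit.zero_measure_weak_star_conv[OF _ \<mu>])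
  then show ?thesis using \<mu> by blast
qed

end
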